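(* Let $\Omega\subset\mathbb{R}^n$ be open, bounded and connected with Lipschitz boundary, let $f$ be an appropriate function on $\Omega\times\mathbb{R}$, let $I=[a,b]\supset\overline{\partial_2 f(\Omega,\mathbb{R})}$, and let $X=W_X\oplus V_X$, $Y=W_Y\oplus V_Y$ be the $I$-decompositions of $X=H^1_0(\Omega)$ and $Y=H^{-1}(\Omega)$. Let $F:X\to Y$, $F(u)=-\Delta u-f(\cdot,u)$, with projected restrictions $F_v:W_X\to W_Y$, $v\in V_X$. Then the derivatives $DF_v$ are uniformly bounded from below: there exists $C>0$ such that $$\forall v\in V_X\ \ \forall w\in W_X\ \ \forall h\in W_X,\qquad \|DF_v(w)h\|_{-1}\ge C\|h\|_1 .$$ Also, all the derivatives $DF_v(w):W_X\to W_Y$ ($v\in V_X$, $w\in W_X$) are invertible.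
   Context: $f:\Omega\times\mathbb{R}\to\mathbb{R}$ is appropriate if $f\in C^1(\Omega\times\mathbb{R})$, $\|f(\cdot,0)\|_{L^2(\Omega)}<\infty$ and $\|\partial_2 f\|_\infty<\infty$, where $\partial_2$ is the partial derivative in the second variable and $\|\cdot\|_\infty$ is the sup norm. $X=H^1_0(\Omega)$ carries the inner product $\langle u,v\rangle_1=\int_\Omega\nabla u\cdot\nabla v$, with norm $\|\cdot\|_1$ (equivalent to the full $H^1$ norm by Poincaré). $Y=H^{-1}(\Omega)$ is its dual, with dual norm $\|\cdot\|_{-1}$ and the inner product transported by the isometry $-\Delta:X\to Y$, $u\mapsto\langle u,\cdot\rangle_1$. An $L^2$ function $\phi$ is regarded as the element $z\mapsto\int_\Omega\phi z$ of $Y$. The map $F$ is understood weakly: $F(u)$ is the functional $z\mapsto\int_\Omega\nabla u\cdot\nabla z-\int_\Omega f(x,u(x))z(x)\,dx$. Let $0<\lambda_1\le\lambda_2\le\dots$ be the eigenvalues (with multiplicity) of the Dirichlet Laplacian $-\Delta_D$ on $\Omega$, with corresponding orthogonal eigenfunctions $\varphi_k$ (orthogonal in $L^2$, $H^1_0$ and $H^{-1}$). The $I$-index set is $\mathcal{I}=\{i:\lambda_i\in I\}$. The $I$-decompositions are given by $V_X=V_Y=\operatorname{Span}\{\varphi_i: i\in\mathcal{I}\}$ (as a subspace of $X$, respectively of $Y$), $W_X=V_X^\perp$ in $X$ and $W_Y=V_Y^\perp$ in $Y$. Let $P_Y:Y\to W_Y$ be the orthogonal projection. For $v\in V_X$ the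 projected restriction is $F_v:W_X\to W_Y$, $F_v(w)=P_YF(w+v)$, and $DF_v(w)$ denotes its Fréchet derivative at $w$. *)

theory Defs
  imports "HOL-Analysis.Analysis" "HOL-Library.Function_Algebras"
begin

section \<open>Square-integrable functions modulo equality almost everywhere\<close>

definition square_integrable :: "('a::euclidean_space \<Rightarrow> real) \<Rightarrow> bool" where
  "square_integrable u \<longleftrightarrow> u \<in> borel_measurable lborel \<and> integrable lborel (\<lambda>x. (u x)\<^sup>2)"

lemma square_integrable_zero: "square_integrable (\<lambda>x. 0)"
  by (simp add: square_integrable_def)

lemma square_integrable_mult:
  assumes "square_integrable u" "square_integrable v"
  shows "integrable lborel (\<lambda>x. u x * v x)"
proof (rule Bochner_Integration.integrable_bound)
  show "integrable lborel (\<lambda>x. (u x)\<^sup>2 + (v x)\<^sup>2)"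
    using assms by (auto simp: square_integrable_def)
  show "(\<lambda>x. u x * v x) \<in> borel_measurable lborel"
    using assms by (auto simp: square_integrable_def)
  have "\<bar>s * t\<bar> \<le> s\<^sup>2 + t\<^sup>2" for s t :: real
    using sum_squares_bound[of s t] sum_squares_bound[of s "- t"] by (simp add: abs_le_iff)
  then show "AE x in lborel. norm (u x * v x) \<le> norm ((u x)\<^sup>2 + (v x)\<^sup>2)"
    by simp
qed

lemma square_integrable_add:
  assumes "square_integrable u" "square_integrable v"
  shows "square_integrable (\<lambda>x. u x + v x)"
proof -
  have "integrable lborel (\<lambda>x. (u x)\<^sup>2 + (v x)\<^sup>2 + 2 * (u x * v x))"
    using assms square_integrable_mult[OF assms] by (auto simp: square_integrable_def)
  then show ?thesis
    using assms by (auto simp: square_integrable_def power2_sum mult.assoc)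
qed

lemma square_integrable_cmult: "square_integrable u \<Longrightarrow> square_integrable (\<lambda>x. c * u x)"
  by (auto simp: square_integrable_def power_mult_distrib)

lemma square_integrable_minus: "square_integrable u \<Longrightarrow> square_integrable (\<lambda>x. - u x)"
  using square_integrable_cmult[of u "- 1"] by simp

lemma square_integrable_diff:
  "square_integrable u \<Longrightarrow> square_integrable v \<Longrightarrow> square_integrable (\<lambda>x. u x - v x)"
  using square_integrable_add[of u "\<lambda>x. - v x"] square_integrable_minus[of v] by simp

text \<open>
  The space \<open>L\<^sup>2(\<real>\<^sup>n)\<close> as a type; \<open>l2_fun\<close> picks a representative.
  Borel representatives lose nothing, as every Lebesgue measurable function is almost everywhere
  equal to a Borel measurable one.
\<close>

quotient_type (overloaded) 'a l2 = "'a::euclidean_space \<Rightarrow> real" / partial: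
    "\<lambda>u v. square_integrable u \<and> square_integrable v \<and> (AE x in lborel. u x = v x)"
  morphisms l2_fun to_l2
proof (rule part_equivpI)
  show "\<exists>u::'a \<Rightarrow> real. square_integrable u \<and> square_integrable u \<and> (AE x in lborel. u x = u x)"
    using square_integrable_zero by auto
  show "symp (\<lambda>u v::'a \<Rightarrow> real. square_integrable u \<and> square_integrable v \<and> (AE x in lborel. u x = v x))"
    by (auto intro!: sympI)
  show "transp (\<lambda>u v::'a \<Rightarrow> real. square_integrable u \<and> square_integrable v \<and> (AE x in lborel. u x = v x))"
    by (rule transpI) auto
qed

instantiation l2 :: (euclidean_space) real_inner
begin

lift_definition zero_l2 :: "'a l2" is "\<lambda>x. 0"
  by (simp add: square_integrable_zero)

lift_definition plus_l2 :: "'a l2 \<Rightarrow> 'a l2 \<Rightarrow> 'a l2" is "\<lambda>u v x. u x + v x"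
  by (auto intro: square_integrable_add)

lift_definition minus_l2 :: "'a l2 \<Rightarrow> 'a l2 \<Rightarrow> 'a l2" is "\<lambda>u v x. u x - v x"
  by (auto intro: square_integrable_diff)

lift_definition uminus_l2 :: "'a l2 \<Rightarrow> 'a l2" is "\<lambda>u x. - u x"
  by (auto intro: square_integrable_minus)

lift_definition scaleR_l2 :: "real \<Rightarrow> 'a l2 \<Rightarrow> 'a l2" is "\<lambda>c u x. c * u x"
  by (auto intro: square_integrable_cmult)

lift_definition inner_l2 :: "'a l2 \<Rightarrow> 'a l2 \<Rightarrow> real" is "\<lambda>u v. LINT x|lborel. u x * v x"
  by (rule integral_cong_AE) (auto simp: square_integrable_def)

definition norm_l2 :: "'a l2 \<Rightarrow> real" where
  "norm_l2 u = sqrt (u \<bullet> u)"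

definition dist_l2 :: "'a l2 \<Rightarrow> 'a l2 \<Rightarrow> real" where
  "dist_l2 u v = norm (u - v)"

definition sgn_l2 :: "'a l2 \<Rightarrow> 'a l2" where
  "sgn_l2 u = inverse (norm u) *\<^sub>R u"

definition uniformity_l2 :: "('a l2 \<times> 'a l2) filter" where
  "uniformity_l2 = (INF e\<in>{0<..}. principal {(u, v). dist u v < e})"

definition open_l2 :: "'a l2 set \<Rightarrow> bool" where
  "open_l2 U \<longleftrightarrow> (\<forall>u\<in>U. \<forall>\<^sub>F (u', v) in uniformity. u' = u \<longrightarrow> v \<in> U)"

instance
proof
  fix u v w :: "'a l2" and c d :: real
  show "u + v + w = u + (v + w)"
    by transfer (auto intro!: square_integrable_add)
  show "u + v = v + u"
    by transfer (auto intro!: square_integrable_add)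
  show "0 + u = u"
    by transfer (auto intro!: square_integrable_add)
  show "- u + u = 0"
    by transfer (auto intro: square_integrable_zero)
  show "u - v = u + - v"
    by transfer (auto intro!: square_integrable_add square_integrable_diff square_integrable_minus)
  show "c *\<^sub>R (u + v) = c *\<^sub>R u + c *\<^sub>R v"
    by transfer (auto intro!: square_integrable_add square_integrable_cmult simp: algebra_simps)
  show "(c + d) *\<^sub>R u = c *\<^sub>R u + d *\<^sub>R u"
    by transfer (auto intro!: square_integrable_add square_integrable_cmult simp: algebra_simps)
  show "c *\<^sub>R d *\<^sub>R u = (c * d) *\<^sub>R u"
    by transfer (auto intro!: square_integrable_cmult simp: algebra_simps)
  show "1 *\<^sub>R u = u"
    by transfer auto
  show "dist u v = norm (u - v)"
    by (rule dist_l2_def)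
  show "sgn u = inverse (norm u) *\<^sub>R u"
    by (rule sgn_l2_def)
  show "uniformity = (INF e\<in>{0<..}. principal {(u::'a l2, v). dist u v < e})"
    by (rule uniformity_l2_def)
  show "open U \<longleftrightarrow> (\<forall>u\<in>U. \<forall>\<^sub>F (u', v) in uniformity. u' = u \<longrightarrow> v \<in> U)" for U :: "'a l2 set"
    by (rule open_l2_def)
  show "u \<bullet> v = v \<bullet> u"
    by transfer (simp add: mult.commute)
  show "(u + v) \<bullet> w = u \<bullet> w + v \<bullet> w"
    by transfer (simp add: distrib_right square_integrable_mult)
  show "c *\<^sub>R u \<bullet> v = c * (u \<bullet> v)"
    by transfer (simp add: mult.assoc)
  show "0 \<le> u \<bullet> u"
    by transfer simp
  show "u \<bullet> u = 0 \<longleftrightarrow> u = 0"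
    by transfer
      (auto simp: square_integrable_def integral_nonneg_eq_0_iff_AE simp flip: power2_eq_square)
  show "norm u = sqrt (u \<bullet> u)"
    by (rule norm_l2_def)
qed

end


section \<open>The pointwise vector space structure on functionals\<close>

instantiation "fun" :: (type, real_vector) real_vector
begin

definition scaleR_fun :: "real \<Rightarrow> ('a \<Rightarrow> 'b) \<Rightarrow> 'a \<Rightarrow> 'b" where
  "scaleR_fun c g = (\<lambda>x. c *\<^sub>R g x)"

instance
  by standard (auto simp: scaleR_fun_def fun_eq_iff scaleR_add_left scaleR_add_right)

end


section \<open>Maps between subspaces carrying their own norms\<close>

text \<open>
  The norms of \<open>H\<^sup>1\<^sub>0(\<Omega>)\<close> and \<open>H\<^sup>-\<^sup>1(\<Omega>)\<close> depend on \<open>\<Omega>\<close>, so a normed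
  space is given below by a linear subspace of an ambient type together with a norm or an inner
  product on it.
\<close>

definition bounded_linear_between ::
  "'x::real_vector set \<Rightarrow> ('x \<Rightarrow> real) \<Rightarrow> 'y::real_vector set \<Rightarrow> ('y \<Rightarrow> real) \<Rightarrow> ('x \<Rightarrow> 'y) \<Rightarrow> bool"
where
  "bounded_linear_between W nW U nU L \<longleftrightarrow>
     (\<forall>x\<in>W. L x \<in> U) \<and>
     (\<forall>x\<in>W. \<forall>y\<in>W. L (x + y) = L x + L y) \<and>
     (\<forall>c. \<forall>x\<in>W. L (c *\<^sub>R x) = c *\<^sub>R L x) \<and>
     (\<exists>K. \<forall>x\<in>W. nU (L x) \<le> K * nW x)"

definition invertible_between ::
  "'x::real_vector set \<Rightarrow> ('x \<Rightarrow> real) \<Rightarrow> 'y::real_vector set \<Rightarrow> ('y \<Rightarrow> real) \<Rightarrow> ('x \<Rightarrow> 'y) \<Rightarrow> bool"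
where
  "invertible_between W nW U nU L \<longleftrightarrow>
     bounded_linear_between W nW U nU L \<and>
     (\<exists>T. bounded_linear_between U nU W nW T \<and>
        (\<forall>x\<in>W. T (L x) = x) \<and> (\<forall>y\<in>U. L (T y) = y))"

definition has_frechet_derivative_between ::
  "'x::real_vector set \<Rightarrow> ('x \<Rightarrow> real) \<Rightarrow> 'y::real_vector set \<Rightarrow> ('y \<Rightarrow> real) \<Rightarrow>
     ('x \<Rightarrow> 'y) \<Rightarrow> ('x \<Rightarrow> 'y) \<Rightarrow> 'x \<Rightarrow> bool"
where
  "has_frechet_derivative_between W nW U nU G L w \<longleftrightarrow>
     bounded_linear_between W nW U nU L \<and>
     (\<forall>e>0. \<exists>d>0. \<forall>h\<in>W. nW h < d \<longrightarrow> nU (G (w + h) - G w - L h) \<le> e * nW h)"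

definition orthogonal_complement_in ::
  "'x set \<Rightarrow> ('x \<Rightarrow> 'x \<Rightarrow> real) \<Rightarrow> 'x set \<Rightarrow> 'x set"
where
  "orthogonal_complement_in S ip A = {x\<in>S. \<forall>y\<in>A. ip x y = 0}"

definition orthogonal_projection ::
  "('x::real_vector \<Rightarrow> 'x \<Rightarrow> real) \<Rightarrow> 'x set \<Rightarrow> 'x \<Rightarrow> 'x"
where
  "orthogonal_projection ip W g = (THE w. w \<in> W \<and> (\<forall>y\<in>W. ip (g - w) y = 0))"


section \<open>The Sobolev space of functions with zero trace, and its dual\<close>

primrec continuously_differentiable :: "nat \<Rightarrow> ('a::euclidean_space \<Rightarrow> real) \<Rightarrow> bool" where
  "continuously_differentiable 0 g \<longleftrightarrow> continuous_on UNIV g"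
| "continuously_differentiable (Suc k) g \<longleftrightarrow>
     (\<forall>x. g differentiable (at x)) \<and>
     (\<forall>b\<in>Basis. continuously_differentiable k (\<lambda>x. frechet_derivative g (at x) b))"

definition test_functions :: "'a::euclidean_space set \<Rightarrow> ('a \<Rightarrow> real) set" where
  "test_functions \<Omega> =
     {\<psi>. (\<forall>k. continuously_differentiable k \<psi>) \<and>
         compact (closure {x. \<psi> x \<noteq> 0}) \<and> closure {x. \<psi> x \<noteq> 0} \<subseteq> \<Omega>}"

text \<open>Functions on \<open>\<Omega>\<close> are identified with their extensions by zero.\<close>

definition L2_space :: "'a::euclidean_space set \<Rightarrow> 'a l2 set" where
  "L2_space \<Omega> = {u. AE x in lborel. x \<notin> \<Omega> \<longrightarrow> l2_fun u x = 0}"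

definition is_weak_pderiv :: "'a::euclidean_space set \<Rightarrow> 'a \<Rightarrow> 'a l2 \<Rightarrow> 'a l2 \<Rightarrow> bool" where
  "is_weak_pderiv \<Omega> b u g \<longleftrightarrow> g \<in> L2_space \<Omega> \<and>
     (\<forall>\<psi>\<in>test_functions \<Omega>.
        (LINT x|lborel. l2_fun u x * frechet_derivative \<psi> (at x) b)
          = - (LINT x|lborel. l2_fun g x * \<psi> x))"

definition weak_pderiv :: "'a::euclidean_space set \<Rightarrow> 'a \<Rightarrow> 'a l2 \<Rightarrow> 'a l2" where
  "weak_pderiv \<Omega> b u = (THE g. is_weak_pderiv \<Omega> b u g)"

definition H1 :: "'a::euclidean_space set \<Rightarrow> 'a l2 set" where
  "H1 \<Omega> = {u \<in> L2_space \<Omega>. \<forall>b\<in>Basis. \<exists>g. is_weak_pderiv \<Omega> b u g}"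

text \<open>\<open>\<integral>\<^sub>\<Omega> \<nabla>u \<cdot> \<nabla>v\<close> and the norm \<open>\<parallel>u\<parallel>\<^sub>1\<close> it induces on \<open>H\<^sup>1\<^sub>0(\<Omega>)\<close>\<close>

definition h1_inner :: "'a::euclidean_space set \<Rightarrow> 'a l2 \<Rightarrow> 'a l2 \<Rightarrow> real" where
  "h1_inner \<Omega> u v = (\<Sum>b\<in>Basis. weak_pderiv \<Omega> b u \<bullet> weak_pderiv \<Omega> b v)"

definition h1_norm :: "'a::euclidean_space set \<Rightarrow> 'a l2 \<Rightarrow> real" where
  "h1_norm \<Omega> u = sqrt (h1_inner \<Omega> u u)"

definition full_H1_norm :: "'a::euclidean_space set \<Rightarrow> 'a l2 \<Rightarrow> real" where
  "full_H1_norm \<Omega> u = sqrt ((norm u)\<^sup>2 + h1_inner \<Omega> u u)"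

definition H10 :: "'a::euclidean_space set \<Rightarrow> 'a l2 set" where
  "H10 \<Omega> = {u \<in> H1 \<Omega>. \<forall>e>0. \<exists>\<psi>\<in>test_functions \<Omega>. full_H1_norm \<Omega> (u - to_l2 \<psi>) < e}"

text \<open>
  Elements of \<open>H\<^sup>-\<^sup>1(\<Omega>)\<close> are functions on the whole ambient type; taking the value zero outside
  \<open>H\<^sup>1\<^sub>0(\<Omega>)\<close> makes equality of functionals coincide with equality of functions.
\<close>

definition Hminus1 :: "'a::euclidean_space set \<Rightarrow> ('a l2 \<Rightarrow> real) set" where
  "Hminus1 \<Omega> =
     {g. bounded_linear_between (H10 \<Omega>) (h1_norm \<Omega>) UNIV norm g \<and> (\<forall>z. z \<notin> H10 \<Omega> \<longrightarrow> g z = 0)}"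

definition neg_laplacian :: "'a::euclidean_space set \<Rightarrow> 'a l2 \<Rightarrow> 'a l2 \<Rightarrow> real" where
  "neg_laplacian \<Omega> u = (\<lambda>z. if z \<in> H10 \<Omega> then h1_inner \<Omega> u z else 0)"

definition l2_functional :: "'a::euclidean_space set \<Rightarrow> 'a l2 \<Rightarrow> 'a l2 \<Rightarrow> real" where
  "l2_functional \<Omega> u = (\<lambda>z. if z \<in> H10 \<Omega> then u \<bullet> z else 0)"

definition hm1_norm :: "'a::euclidean_space set \<Rightarrow> ('a l2 \<Rightarrow> real) \<Rightarrow> real" where
  "hm1_norm \<Omega> g = (SUP z\<in>{z \<in> H10 \<Omega>. h1_norm \<Omega> z \<le> 1}. \<bar>g z\<bar>)"

definition hm1_inner ::
  "'a::euclidean_space set \<Rightarrow> ('a l2 \<Rightarrow> real) \<Rightarrow> ('a l2 \<Rightarrow> real) \<Rightarrow> real"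
where
  "hm1_inner \<Omega> g k =
     h1_inner \<Omega> (inv_into (H10 \<Omega>) (neg_laplacian \<Omega>) g) (inv_into (H10 \<Omega>) (neg_laplacian \<Omega>) k)"


section \<open>The domain, the nonlinearity and the spectrum\<close>

text \<open>
  Near each boundary point, \<open>\<Omega>\<close> is the region above a Lipschitz graph over the hyperplane
  orthogonal to some unit vector \<open>e\<close>.
\<close>

definition lipschitz_boundary :: "'a::euclidean_space set \<Rightarrow> bool" where
  "lipschitz_boundary \<Omega> \<longleftrightarrow>
     (\<forall>p\<in>frontier \<Omega>. \<exists>r>0. \<exists>e. norm e = 1 \<and>
        (\<exists>(\<gamma>::'a \<Rightarrow> real) K. K-lipschitz_on {y. y \<bullet> e = 0} \<gamma> \<and>
           \<Omega> \<inter> ball p r = {y \<in> ball p r. \<gamma> (y - (y \<bullet> e) *\<^sub>R e) < y \<bullet> e}))"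

definition C1_on :: "'b::real_normed_vector set \<Rightarrow> ('b \<Rightarrow> real) \<Rightarrow> bool" where
  "C1_on S g \<longleftrightarrow>
     (\<exists>g'::'b \<Rightarrow> 'b \<Rightarrow>\<^sub>L real.
        (\<forall>p\<in>S. (g has_derivative blinfun_apply (g' p)) (at p)) \<and> continuous_on S g')"

definition pderiv2 :: "('a \<times> real \<Rightarrow> real) \<Rightarrow> 'a \<times> real \<Rightarrow> real" where
  "pderiv2 f = (\<lambda>(x, t). deriv (\<lambda>s. f (x, s)) t)"

definition appropriate :: "'a::euclidean_space set \<Rightarrow> ('a \<times> real \<Rightarrow> real) \<Rightarrow> bool" where
  "appropriate \<Omega> f \<longleftrightarrow>
     C1_on (\<Omega> \<times> UNIV) f \<and>
     square_integrable (\<lambda>x. indicator \<Omega> x * f (x, 0)) \<and>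
     bounded (pderiv2 f ` (\<Omega> \<times> UNIV))"

text \<open>
  The last clause says that the sequence lists every eigenvalue, repeated according to its
  multiplicity. Orthogonality in \<open>L\<^sup>2\<close> implies orthogonality in \<open>H\<^sup>1\<^sub>0\<close> and in \<open>H\<^sup>-\<^sup>1\<close>
  by the eigenvalue equation.
\<close>

definition dirichlet_eigensystem ::
  "'a::euclidean_space set \<Rightarrow> (nat \<Rightarrow> real) \<Rightarrow> (nat \<Rightarrow> 'a l2) \<Rightarrow> bool"
where
  "dirichlet_eigensystem \<Omega> ev \<phi> \<longleftrightarrow>
     0 < ev 0 \<and> incseq ev \<and>
     (\<forall>k. \<phi> k \<in> H10 \<Omega> \<and> \<phi> k \<noteq> 0 \<and>
        neg_laplacian \<Omega> (\<phi> k) = ev k *\<^sub>R l2_functional \<Omega> (\<phi> k)) \<and>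
     (\<forall>i j. i \<noteq> j \<longrightarrow> \<phi> i \<bullet> \<phi> j = 0) \<and>
     (\<forall>\<mu>. {u \<in> H10 \<Omega>. neg_laplacian \<Omega> u = \<mu> *\<^sub>R l2_functional \<Omega> u} = span (\<phi> ` {k. ev k = \<mu>}))"


section \<open>The decompositions and the projected restrictions\<close>

definition index_set :: "(nat \<Rightarrow> real) \<Rightarrow> real set \<Rightarrow> nat set" where
  "index_set ev I = {i. ev i \<in> I}"

definition V_X :: "(nat \<Rightarrow> real) \<Rightarrow> (nat \<Rightarrow> 'a::euclidean_space l2) \<Rightarrow> real set \<Rightarrow> 'a l2 set" where
  "V_X ev \<phi> I = span (\<phi> ` index_set ev I)"

definition W_X ::
  "'a::euclidean_space set \<Rightarrow> (nat \<Rightarrow> real) \<Rightarrow> (nat \<Rightarrow> 'a l2) \<Rightarrow> real set \<Rightarrow> 'a l2 set"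
where
  "W_X \<Omega> ev \<phi> I = orthogonal_complement_in (H10 \<Omega>) (h1_inner \<Omega>) (V_X ev \<phi> I)"

definition V_Y ::
  "'a::euclidean_space set \<Rightarrow> (nat \<Rightarrow> real) \<Rightarrow> (nat \<Rightarrow> 'a l2) \<Rightarrow> real set \<Rightarrow> ('a l2 \<Rightarrow> real) set"
where
  "V_Y \<Omega> ev \<phi> I = span ((\<lambda>i. l2_functional \<Omega> (\<phi> i)) ` index_set ev I)"

definition W_Y ::
  "'a::euclidean_space set \<Rightarrow> (nat \<Rightarrow> real) \<Rightarrow> (nat \<Rightarrow> 'a l2) \<Rightarrow> real set \<Rightarrow> ('a l2 \<Rightarrow> real) set"
where
  "W_Y \<Omega> ev \<phi> I = orthogonal_complement_in (Hminus1 \<Omega>) (hm1_inner \<Omega>) (V_Y \<Omega> ev \<phi> I)"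

definition P_Y ::
  "'a::euclidean_space set \<Rightarrow> (nat \<Rightarrow> real) \<Rightarrow> (nat \<Rightarrow> 'a l2) \<Rightarrow> real set \<Rightarrow>
     ('a l2 \<Rightarrow> real) \<Rightarrow> 'a l2 \<Rightarrow> real"
where
  "P_Y \<Omega> ev \<phi> I = orthogonal_projection (hm1_inner \<Omega>) (W_Y \<Omega> ev \<phi> I)"

definition F_map :: "'a::euclidean_space set \<Rightarrow> ('a \<times> real \<Rightarrow> real) \<Rightarrow> 'a l2 \<Rightarrow> 'a l2 \<Rightarrow> real" where
  "F_map \<Omega> f u =
     (\<lambda>z. if z \<in> H10 \<Omega>
          then h1_inner \<Omega> u z - (LINT x:\<Omega>|lborel. f (x, l2_fun u x) * l2_fun z x)
          else 0)"

definition F_restr ::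
  "'a::euclidean_space set \<Rightarrow> ('a \<times> real \<Rightarrow> real) \<Rightarrow> (nat \<Rightarrow> real) \<Rightarrow> (nat \<Rightarrow> 'a l2) \<Rightarrow> real set \<Rightarrow>
     'a l2 \<Rightarrow> 'a l2 \<Rightarrow> 'a l2 \<Rightarrow> real"
where
  "F_restr \<Omega> f ev \<phi> I v w = P_Y \<Omega> ev \<phi> I (F_map \<Omega> f (w + v))"

definition F_restr_has_derivative ::
  "'a::euclidean_space set \<Rightarrow> ('a \<times> real \<Rightarrow> real) \<Rightarrow> (nat \<Rightarrow> real) \<Rightarrow> (nat \<Rightarrow> 'a l2) \<Rightarrow> real set \<Rightarrow>
     'a l2 \<Rightarrow> ('a l2 \<Rightarrow> 'a l2 \<Rightarrow> real) \<Rightarrow> 'a l2 \<Rightarrow> bool"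
where
  "F_restr_has_derivative \<Omega> f ev \<phi> I v L w \<longleftrightarrow>
     has_frechet_derivative_between (W_X \<Omega> ev \<phi> I) (h1_norm \<Omega>) (W_Y \<Omega> ev \<phi> I) (hm1_norm \<Omega>)
       (F_restr \<Omega> f ev \<phi> I v) L w"

text \<open>As for \<^const>\<open>frechet_derivative\<close>, the value is meaningful where a derivative exists.\<close>

definition DF_restr ::
  "'a::euclidean_space set \<Rightarrow> ('a \<times> real \<Rightarrow> real) \<Rightarrow> (nat \<Rightarrow> real) \<Rightarrow> (nat \<Rightarrow> 'a l2) \<Rightarrow> real set \<Rightarrow>
     'a l2 \<Rightarrow> 'a l2 \<Rightarrow> 'a l2 \<Rightarrow> 'a l2 \<Rightarrow> real"
where
  "DF_restr \<Omega> f ev \<phi> I v w = (SOME L. F_restr_has_derivative \<Omega> f ev \<phi> I v L w)"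

end

theory Submission
  imports Defs "HOL-Library.Diagonal_Subsequence" "HOL-Computational_Algebra.Polynomial"
begin

text \<open>
  The derivative of \<open>F\<close> at \<open>u\<close> is the bilinear form \<open>\<integral> \<nabla>h \<cdot> \<nabla>z - \<integral> p h z\<close> with
  \<open>p = \<partial>\<^sub>2f(\<cdot>, u)\<close> taking values in \<open>[a, b]\<close>. An element of \<open>W\<^sub>X\<close> splits as \<open>h = h\<^sub>1 + h\<^sub>2\<close> along the
  eigenvalues above \<open>b\<close> and below \<open>a\<close>. Testing the form against \<open>h\<^sub>1 - h\<^sub>2\<close> cancels the cross terms
  and leaves at least \<open>C \<parallel>h\<parallel>\<^sub>1\<^sup>2\<close>, where \<open>C\<close> depends only on \<open>a\<close>, \<open>b\<close> and the eigenvalues. The lower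
  bound follows since \<open>\<parallel>h\<^sub>1 - h\<^sub>2\<parallel>\<^sub>1 = \<parallel>h\<parallel>\<^sub>1\<close>, and a self-adjoint operator bounded from below is
  invertible. On the complement of the eigenvalues up to \<open>b\<close>, a minimizer of the Rayleigh quotient
  is an eigenvector, so the quotient stays above some \<open>\<mu> > b\<close>; the minimizer exists by Rellich's
  theorem, which also replaces the Sobolev embedding in the proof that \<open>F\<close> is differentiable.
\<close>

section \<open>The space \<open>L\<^sup>2\<close>\<close>

text \<open>Everything in \<open>H\<^sup>-\<^sup>1\<close> is pulled back to
  \<open>H\<^sup>1\<^sub>0\<close> by the Riesz isometry -\<Delta>. There F becomes u minus
  \<open>inv_lap (superpos u)\<close>, \<open>P_Y\<close> becomes the projection
  \<open>proj_WX\<close>, and the derivative becomes an operator \<open>linearized u\<close> from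
  \<open>WX\<close> to itself; in this form self-adjointness can be stated. The eigensystem lists
  all weak eigenvectors but provides no expansion theorem. Hence h is never expanded: the finitely
  many components with eigenvalue below a are split off by a finite sum, and the rest is controlled
  through the Rayleigh quotient alone. The strict gaps, with \<mu> > b above and the largest
  eigenvalue \<nu> < a below, give the constants 1 - b/\<mu> and a/\<nu> - 1. As the norms depend on
  \<Omega>, projection and representation theorems are proved for forms on subsets of an ambient
  type.\<close>

lemma square_integrable_l2_fun [simp, intro]: "square_integrable (l2_fun u)"
  using Quotient3_rep_reflp[OF Quotient3_l2, of u] by simp

lemma to_l2_l2_fun [simp]: "to_l2 (l2_fun u) = u"
  by (rule Quotient3_abs_rep[OF Quotient3_l2])

lemma to_l2_eq_iff:
  assumes "square_integrable f" "square_integrable g"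
  shows "to_l2 f = to_l2 g \<longleftrightarrow> (AE x in lborel. f x = g x)"
  using Quotient3_rel[OF Quotient3_l2, of f g] assms by simp

lemma l2_fun_to_l2:
  assumes "square_integrable f"
  shows "AE x in lborel. l2_fun (to_l2 f) x = f x"
  using assms by (subst to_l2_eq_iff[symmetric]) auto

lemma l2_eqI: "(AE x in lborel. l2_fun u x = l2_fun v x) \<Longrightarrow> u = v"
  using to_l2_eq_iff[of "l2_fun u" "l2_fun v"] by simp

lemma borel_measurable_l2_fun [measurable]: "l2_fun u \<in> borel_measurable borel"
  using square_integrable_l2_fun[of u] by (simp add: square_integrable_def)

lemma square_integrable_measurable: "square_integrable f \<Longrightarrow> f \<in> borel_measurable borel"
  by (simp add: square_integrable_def)

lemma to_l2_add:
  "square_integrable f \<Longrightarrow> square_integrable g \<Longrightarrow> to_l2 f + to_l2 g = to_l2 (\<lambda>x. f x + g x)"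
  by (rule plus_l2.abs_eq) auto

lemma to_l2_diff:
  "square_integrable f \<Longrightarrow> square_integrable g \<Longrightarrow> to_l2 f - to_l2 g = to_l2 (\<lambda>x. f x - g x)"
  by (rule minus_l2.abs_eq) auto

lemma to_l2_scaleR: "square_integrable f \<Longrightarrow> c *\<^sub>R to_l2 f = to_l2 (\<lambda>x. c * f x)"
  by (rule scaleR_l2.abs_eq) auto

lemma l2_fun_add: "AE x in lborel. l2_fun (u + v) x = l2_fun u x + l2_fun v x"
proof -
  have "AE x in lborel. l2_fun (to_l2 (\<lambda>x. l2_fun u x + l2_fun v x)) x = l2_fun u x + l2_fun v x"
    by (intro l2_fun_to_l2 square_integrable_add square_integrable_l2_fun)
  then show ?thesis by (simp flip: to_l2_add)
qed

lemma l2_fun_diff: "AE x in lborel. l2_fun (u - v) x = l2_fun u x - l2_fun v x"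
proof -
  have "AE x in lborel. l2_fun (to_l2 (\<lambda>x. l2_fun u x - l2_fun v x)) x = l2_fun u x - l2_fun v x"
    by (intro l2_fun_to_l2 square_integrable_diff square_integrable_l2_fun)
  then show ?thesis by (simp flip: to_l2_diff)
qed

lemma l2_fun_scaleR: "AE x in lborel. l2_fun (c *\<^sub>R u) x = c * l2_fun u x"
proof -
  have "AE x in lborel. l2_fun (to_l2 (\<lambda>x. c * l2_fun u x)) x = c * l2_fun u x"
    by (intro l2_fun_to_l2 square_integrable_cmult square_integrable_l2_fun)
  then show ?thesis by (simp flip: to_l2_scaleR)
qed

lemma l2_fun_zero: "AE x in lborel. l2_fun 0 x = 0"
  unfolding zero_l2.abs_eq by (rule l2_fun_to_l2[OF square_integrable_zero])

lemma inner_to_l2: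
  assumes "square_integrable f"
  shows "u \<bullet> to_l2 f = (LINT x|lborel. l2_fun u x * f x)"
  unfolding inner_l2.rep_eq
proof (rule integral_cong_AE)
  show "AE x in lborel. l2_fun u x * l2_fun (to_l2 f) x = l2_fun u x * f x"
    using l2_fun_to_l2[OF assms] by auto
qed (use square_integrable_measurable[OF assms] in auto)

lemma inner_to_l2_to_l2:
  assumes "square_integrable f" "square_integrable g"
  shows "to_l2 f \<bullet> to_l2 g = (LINT x|lborel. f x * g x)"
  unfolding inner_to_l2[OF assms(2)]
proof (rule integral_cong_AE)
  show "AE x in lborel. l2_fun (to_l2 f) x * g x = f x * g x"
    using l2_fun_to_l2[OF assms(1)] by auto
qed (use assms[THEN square_integrable_measurable] in auto)

lemma norm_to_l2_square: "square_integrable f \<Longrightarrow> (norm (to_l2 f))\<^sup>2 = (LINT x|lborel. (f x)\<^sup>2)"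
  by (simp add: power2_norm_eq_inner inner_to_l2_to_l2 flip: power2_eq_square)

lemma square_integrable_integrable: "square_integrable f \<Longrightarrow> integrable lborel (\<lambda>x. (f x)\<^sup>2)"
  by (simp add: square_integrable_def)

lemma nn_integral_l2_diff:
  "(\<integral>\<^sup>+x. ennreal ((l2_fun u x - l2_fun v x)\<^sup>2) \<partial>lborel) = ennreal ((norm (u - v))\<^sup>2)"
proof -
  have si: "square_integrable (\<lambda>x. l2_fun u x - l2_fun v x)"
    by (intro square_integrable_diff square_integrable_l2_fun)
  have "(norm (u - v))\<^sup>2 = (LINT x|lborel. (l2_fun u x - l2_fun v x)\<^sup>2)"
    using norm_to_l2_square[OF si] by (simp flip: to_l2_diff)
  with si show ?thesis
    by (simp add: nn_integral_eq_integral square_integrable_integrable)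
qed

lemma square_integrable_dominated:
  assumes "square_integrable g" "f \<in> borel_measurable borel"
    "AE x in lborel. \<bar>f x\<bar> \<le> C * \<bar>g x\<bar>"
  shows "square_integrable f"
  unfolding square_integrable_def
proof
  show "integrable lborel (\<lambda>x. (f x)\<^sup>2)"
  proof (rule Bochner_Integration.integrable_bound)
    show "integrable lborel (\<lambda>x. C\<^sup>2 * (g x)\<^sup>2)"
      using assms(1) by (simp add: square_integrable_def)
    show "AE x in lborel. norm ((f x)\<^sup>2) \<le> norm (C\<^sup>2 * (g x)\<^sup>2)"
      using assms(3)
    proof eventually_elim
      case (elim x)
      then have "\<bar>f x\<bar>\<^sup>2 \<le> (C * \<bar>g x\<bar>)\<^sup>2" by (intro power_mono) auto
      then show ?case by (simp add: power_mult_distrib)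
    qed
  qed (use assms(2) in measurable)
qed (use assms(2) in simp)

lemma norm_to_l2_le:
  assumes "square_integrable g" "f \<in> borel_measurable borel" "0 \<le> C"
    "AE x in lborel. \<bar>f x\<bar> \<le> C * \<bar>g x\<bar>"
  shows "norm (to_l2 f) \<le> C * norm (to_l2 g)"
proof (rule power2_le_imp_le)
  have f: "square_integrable f" using assms(1,2,4) by (rule square_integrable_dominated)
  have "(LINT x|lborel. (f x)\<^sup>2) \<le> (LINT x|lborel. C\<^sup>2 * (g x)\<^sup>2)"
  proof (rule integral_mono_AE)
    show "AE x in lborel. (f x)\<^sup>2 \<le> C\<^sup>2 * (g x)\<^sup>2"
      using assms(4)
    proof eventually_elim
      case (elim x)
      then have "\<bar>f x\<bar>\<^sup>2 \<le> (C * \<bar>g x\<bar>)\<^sup>2" by (intro power_mono) auto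
      then show ?case by (simp add: power_mult_distrib)
    qed
  qed (use f assms(1) in \<open>auto simp: square_integrable_def\<close>)
  then show "(norm (to_l2 f))\<^sup>2 \<le> (C * norm (to_l2 g))\<^sup>2"
    by (simp add: norm_to_l2_square f assms(1) power_mult_distrib)
qed (use assms in simp)

text \<open>The Riesz-Fischer argument: along a subsequence with consecutive distances at most
  \<open>(1/2) ^ n\<close>, the telescoping series of differences converges absolutely almost
  everywhere. The weight \<open>2 ^ n\<close> on the squared differences still leaves a convergent
  sum of integrals and pays for the passage from squares to absolute values.\<close>

lemma l2_Cauchy_subseq_AE:
  fixes X :: "nat \<Rightarrow> 'a::euclidean_space l2"
  assumes "Cauchy X"
  obtains r where "strict_mono r" "AE x in lborel. convergent (\<lambda>n. l2_fun (X (r n)) x)"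
proof -
  have "\<exists>N. \<forall>m\<ge>N. \<forall>n\<ge>N. norm (X m - X n) < (1/2) ^ k" for k
    using CauchyD[OF assms, of "(1/2) ^ k"] by simp
  then obtain N where N: "\<And>k m n. m \<ge> N k \<Longrightarrow> n \<ge> N k \<Longrightarrow> norm (X m - X n) < (1/2) ^ k"
    by metis
  \<comment> \<open>The summand \<open>k\<close> makes \<open>r\<close> strictly increasing, and the
    sum dominates \<open>N k\<close>.\<close>
  define r where "r k = k + (\<Sum>i\<le>k. N i)" for k
  have r: "strict_mono r" by (simp add: r_def strict_mono_Suc_iff)
  have rN: "r k \<ge> N k" for k
    using member_le_sum[of k "{..k}" N] by (simp add: r_def)
  define d where "d n x = l2_fun (X (r (Suc n))) x - l2_fun (X (r n)) x" for n x
  have [measurable]: "d n \<in> borel_measurable borel" for n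
    unfolding d_def by measurable
  have dn: "norm (X (r (Suc n)) - X (r n)) \<le> (1/2) ^ n" for n
    using N[of n "r (Suc n)" "r n"] rN[of n] strict_monoD[OF r, of n "Suc n"] by simp
  have "(\<integral>\<^sup>+x. (\<Sum>n. ennreal (2 ^ n * (d n x)\<^sup>2)) \<partial>lborel) = (\<Sum>n. \<integral>\<^sup>+x. ennreal (2 ^ n * (d n x)\<^sup>2) \<partial>lborel)"
    by (rule nn_integral_suminf) measurable
  also have "\<dots> = (\<Sum>n. ennreal (2 ^ n * (norm (X (r (Suc n)) - X (r n)))\<^sup>2))"
    by (intro suminf_cong) (simp add: ennreal_mult nn_integral_cmult d_def nn_integral_l2_diff)
  also have "\<dots> \<le> (\<Sum>n. ennreal ((1/2) ^ n))"
  proof (intro suminf_le ennreal_leI)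
    fix n
    have "2 ^ n * (norm (X (r (Suc n)) - X (r n)))\<^sup>2 \<le> 2 ^ n * ((1/2) ^ n)\<^sup>2"
      using dn[of n] by (intro mult_left_mono power_mono) auto
    also have "\<dots> = (1/2) ^ n" by (simp add: power2_eq_square power_divide)
    finally show "2 ^ n * (norm (X (r (Suc n)) - X (r n)))\<^sup>2 \<le> (1/2) ^ n" .
  qed auto
  also have "\<dots> = ennreal (\<Sum>n. (1/2) ^ n)"
    by (intro suminf_ennreal2) (auto intro: summable_geometric)
  also have "\<dots> < \<infinity>" by simp
  finally have "AE x in lborel. (\<Sum>n. ennreal (2 ^ n * (d n x)\<^sup>2)) \<noteq> \<infinity>"
    by (intro nn_integral_noteq_infinite) auto
  then have "AE x in lborel. convergent (\<lambda>n. l2_fun (X (r n)) x)"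
  proof eventually_elim
    case (elim x)
    then have sq: "summable (\<lambda>n. 2 ^ n * (d n x)\<^sup>2)"
      by (intro summable_suminf_not_top) auto
    have telescope: "(\<Sum>i<n. d i x) = l2_fun (X (r n)) x - l2_fun (X (r 0)) x" for n
      by (induction n) (auto simp: d_def)
    have "summable (\<lambda>n. d n x)"
    proof (rule summable_comparison_test')
      show "summable (\<lambda>n. 2 ^ n * (d n x)\<^sup>2 + (1/2) ^ n)"
        by (intro summable_add sq summable_geometric) auto
      fix n
      \<comment> \<open>Completing the square: after division by \<open>2 ^ n\<close> this is
        \<open>2 * \<bar>d n x\<bar> \<le> 2 ^ n * (d n x)\<^sup>2 + (1/2) ^ n\<close>, whose right
        side is summable.\<close>
      have "0 \<le> (2 ^ n * \<bar>d n x\<bar> - 1)\<^sup>2" by simp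
      also have "\<dots> = 2 ^ n * (2 ^ n * (d n x)\<^sup>2 - 2 * \<bar>d n x\<bar> + (1/2) ^ n)"
        by (simp add: power2_eq_square algebra_simps power_divide abs_if)
      finally have "2 * \<bar>d n x\<bar> \<le> 2 ^ n * (d n x)\<^sup>2 + (1/2) ^ n"
        unfolding zero_le_mult_iff using zero_less_power[of "2::real" n] by linarith
      then show "norm (d n x) \<le> 2 ^ n * (d n x)\<^sup>2 + (1/2) ^ n" by simp
    qed
    then have "convergent (\<lambda>n. \<Sum>i<n. d i x)" by (simp add: summable_iff_convergent)
    then have "convergent (\<lambda>n. l2_fun (X (r n)) x - l2_fun (X (r 0)) x)"
      by (simp add: telescope)
    then show ?case
      using convergent_add[OF _ convergent_const[of "l2_fun (X (r 0)) x"]] by fastforce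
  qed
  with r that show ?thesis by blast
qed

text \<open>Fatou's lemma turns an eventual bound on the distances to the subsequence into a bound
  on the distance to its pointwise limit. It is used twice: with bound 1 to see that the limit is
  square integrable, and with \<open>e / 2\<close> for convergence of the whole sequence.\<close>

lemma l2_complete:
  fixes X :: "nat \<Rightarrow> 'a::euclidean_space l2"
  assumes "Cauchy X"
  shows "convergent X"
proof -
  obtain r where r: "strict_mono r" and conv: "AE x in lborel. convergent (\<lambda>n. l2_fun (X (r n)) x)"
    using l2_Cauchy_subseq_AE[OF assms] by blast
  define u where "u x = lim (\<lambda>n. l2_fun (X (r n)) x)" for x
  have u[measurable]: "u \<in> borel_measurable borel" unfolding u_def by measurable
  have lim: "AE x in lborel. (\<lambda>n. l2_fun (X (r n)) x) \<longlonglongrightarrow> u x"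
    using conv by (auto simp: convergent_LIMSEQ_iff u_def)
  have fatou: "(\<integral>\<^sup>+x. ennreal ((l2_fun v x - u x)\<^sup>2) \<partial>lborel) \<le> ennreal (e\<^sup>2)"
    if e: "\<forall>\<^sub>F n in sequentially. norm (v - X (r n)) \<le> e" for v e
  proof -
    have "(\<integral>\<^sup>+x. ennreal ((l2_fun v x - u x)\<^sup>2) \<partial>lborel)
        = (\<integral>\<^sup>+x. liminf (\<lambda>n. ennreal ((l2_fun v x - l2_fun (X (r n)) x)\<^sup>2)) \<partial>lborel)"
    proof (rule nn_integral_cong_AE)
      show "AE x in lborel. ennreal ((l2_fun v x - u x)\<^sup>2) =
          liminf (\<lambda>n. ennreal ((l2_fun v x - l2_fun (X (r n)) x)\<^sup>2))"
        using lim
      proof eventually_elim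
        case (elim x)
        then have "(\<lambda>n. ennreal ((l2_fun v x - l2_fun (X (r n)) x)\<^sup>2)) \<longlonglongrightarrow> ennreal ((l2_fun v x - u x)\<^sup>2)"
          by (intro tendsto_intros)
        then show ?case by (intro lim_imp_Liminf[symmetric]) auto
      qed
    qed
    also have "\<dots> \<le> liminf (\<lambda>n. \<integral>\<^sup>+x. ennreal ((l2_fun v x - l2_fun (X (r n)) x)\<^sup>2) \<partial>lborel)"
      by (rule nn_integral_liminf) measurable
    also have "\<dots> = liminf (\<lambda>n. ennreal ((norm (v - X (r n)))\<^sup>2))"
      by (simp add: nn_integral_l2_diff)
    also have "\<dots> \<le> liminf (\<lambda>n. ennreal (e\<^sup>2))"
      using e by (intro Liminf_mono) (auto elim!: eventually_mono intro!: ennreal_leI power_mono)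
    finally show ?thesis by (simp add: Liminf_const)
  qed
  have tail: "\<exists>N. \<forall>m\<ge>N. \<forall>\<^sub>F n in sequentially. norm (X m - X (r n)) \<le> e" if "e > 0" for e
  proof -
    obtain N where N: "\<And>m n. m \<ge> N \<Longrightarrow> n \<ge> N \<Longrightarrow> norm (X m - X n) < e"
      using CauchyD[OF assms \<open>e > 0\<close>] by blast
    have "\<forall>\<^sub>F n in sequentially. norm (X m - X (r n)) \<le> e" if "m \<ge> N" for m
      using N[OF that] seq_suble[OF r]
      by (intro eventually_sequentiallyI[of N]) (meson le_trans less_imp_le)
    then show ?thesis by blast
  qed
  obtain m where m: "\<forall>\<^sub>F n in sequentially. norm (X m - X (r n)) \<le> 1"
    using tail[of 1] by auto
  have "integrable lborel (\<lambda>x. (l2_fun (X m) x - u x)\<^sup>2)"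
    using order.strict_trans1[OF fatou[OF m], of \<infinity>]
    by (intro integrableI_nonneg) auto
  then have "square_integrable (\<lambda>x. l2_fun (X m) x - u x)" by (simp add: square_integrable_def)
  from square_integrable_diff[OF square_integrable_l2_fun[of "X m"] this]
  have su: "square_integrable u" by simp
  have "X \<longlonglongrightarrow> to_l2 u"
  proof (rule LIMSEQ_I)
    fix e :: real assume "e > 0"
    then obtain N where N: "\<And>m. m \<ge> N \<Longrightarrow> \<forall>\<^sub>F n in sequentially. norm (X m - X (r n)) \<le> e / 2"
      using tail[of "e / 2"] by auto
    have "norm (X m - to_l2 u) < e" if "m \<ge> N" for m
    proof -
      have si: "square_integrable (\<lambda>x. l2_fun (X m) x - u x)"
        by (intro square_integrable_diff square_integrable_l2_fun su)
      have "X m - to_l2 u = to_l2 (\<lambda>x. l2_fun (X m) x - u x)"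
        using to_l2_diff[OF square_integrable_l2_fun su, of "X m"] by simp
      then have "ennreal ((norm (X m - to_l2 u))\<^sup>2) = (\<integral>\<^sup>+x. ennreal ((l2_fun (X m) x - u x)\<^sup>2) \<partial>lborel)"
        using si by (simp add: norm_to_l2_square nn_integral_eq_integral square_integrable_integrable)
      also have "\<dots> \<le> ennreal ((e/2)\<^sup>2)" using N[OF that] by (rule fatou)
      finally have "(norm (X m - to_l2 u))\<^sup>2 \<le> (e/2)\<^sup>2" by simp
      then have "norm (X m - to_l2 u) \<le> e / 2"
        using \<open>e > 0\<close> by (simp add: power2_le_iff_abs_le)
      with \<open>e > 0\<close> show ?thesis by simp
    qed
    then show "\<exists>N. \<forall>n\<ge>N. norm (X n - to_l2 u) < e" by blast
  qed
  then show ?thesis by (rule convergentI)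
qed

lemma l2_tendsto_subseq_AE:
  fixes X :: "nat \<Rightarrow> 'a::euclidean_space l2"
  assumes "X \<longlonglongrightarrow> u"
  obtains r where "strict_mono r" "AE x in lborel. (\<lambda>n. l2_fun (X (r n)) x) \<longlonglongrightarrow> l2_fun u x"
proof -
  have si: "square_integrable (\<lambda>x. l2_fun (X n) x - l2_fun u x)" for n
    by (intro square_integrable_diff square_integrable_l2_fun)
  have "(LINT x|lborel. norm ((l2_fun (X n) x - l2_fun u x)\<^sup>2)) = (norm (X n - u))\<^sup>2" for n
    using norm_to_l2_square[OF si, of n] by (simp flip: to_l2_diff)
  moreover have "(\<lambda>n. (norm (X n - u))\<^sup>2) \<longlonglongrightarrow> 0\<^sup>2"
    using assms by (intro tendsto_power) (simp add: tendsto_norm_zero_iff LIM_zero_iff)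
  ultimately have "(\<lambda>n. LINT x|lborel. norm ((l2_fun (X n) x - l2_fun u x)\<^sup>2)) \<longlonglongrightarrow> 0" by simp
  from tendsto_L1_AE_subseq[OF square_integrable_integrable[OF si] this]
  obtain r where r: "strict_mono r"
      "AE x in lborel. (\<lambda>n. (l2_fun (X (r n)) x - l2_fun u x)\<^sup>2) \<longlonglongrightarrow> 0" by blast
  have "AE x in lborel. (\<lambda>n. l2_fun (X (r n)) x) \<longlonglongrightarrow> l2_fun u x"
    using r(2)
  proof eventually_elim
    case (elim x)
    then have "(\<lambda>n. sqrt ((l2_fun (X (r n)) x - l2_fun u x)\<^sup>2)) \<longlonglongrightarrow> sqrt 0"
      by (intro tendsto_real_sqrt)
    then show ?case by (simp add: tendsto_rabs_zero_iff LIM_zero_iff)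
  qed
  with r(1) that show ?thesis by blast
qed


section \<open>The fundamental lemma of the calculus of variations\<close>

lemma cont_diff_imp_continuous: "continuously_differentiable k g \<Longrightarrow> continuous_on UNIV g"
  by (cases k) (auto intro!: continuous_at_imp_continuous_on differentiable_imp_continuous_within)

lemma cont_diff_pred: "continuously_differentiable (Suc k) g \<Longrightarrow> continuously_differentiable k g"
proof (induction k arbitrary: g)
  case 0
  from cont_diff_imp_continuous[OF 0] show ?case by simp
next
  case (Suc k)
  then show ?case by (metis continuously_differentiable.simps(2))
qed

lemma cont_diff_const [simp]: "continuously_differentiable k (\<lambda>x. c)"
  by (induction k arbitrary: c) (auto simp: frechet_derivative_const)

lemma cont_diff_add:
  "continuously_differentiable k f \<Longrightarrow> continuously_differentiable k g \<Longrightarrow>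
   continuously_differentiable k (\<lambda>x. f x + g x)"
proof (induction k arbitrary: f g)
  case (Suc k)
  have "frechet_derivative (\<lambda>x. f x + g x) (at x) = (\<lambda>b. frechet_derivative f (at x) b + frechet_derivative g (at x) b)" for x
    using Suc.prems frechet_derivative_works
    by (intro frechet_derivative_at[symmetric] has_derivative_add) auto
  with Suc show ?case by auto
qed (auto intro: continuous_intros)

lemma frechet_derivative_mult_real:
  fixes f g :: "'a::real_normed_vector \<Rightarrow> real"
  assumes "f differentiable at x" "g differentiable at x"
  shows "frechet_derivative (\<lambda>x. f x * g x) (at x) =
    (\<lambda>b. f x * frechet_derivative g (at x) b + frechet_derivative f (at x) b * g x)"
  using has_derivative_mult[OF assms(1)[unfolded frechet_derivative_works] assms(2)[unfolded frechet_derivative_works]]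
  by (rule frechet_derivative_at[symmetric])

lemma cont_diff_mult:
  "continuously_differentiable k f \<Longrightarrow> continuously_differentiable k g \<Longrightarrow>
   continuously_differentiable k (\<lambda>x. f x * g x)"
proof (induction k arbitrary: f g)
  case (Suc k)
  have "continuously_differentiable k (\<lambda>x. frechet_derivative (\<lambda>x. f x * g x) (at x) b)"
    if b: "b \<in> Basis" for b
  proof -
    have "(\<lambda>x. frechet_derivative (\<lambda>x. f x * g x) (at x) b) =
        (\<lambda>x. f x * frechet_derivative g (at x) b + frechet_derivative f (at x) b * g x)"
      using Suc.prems by (simp add: frechet_derivative_mult_real)
    moreover have "continuously_differentiable k \<dots>"
      using Suc.prems b cont_diff_pred[OF Suc.prems(1)] cont_diff_pred[OF Suc.prems(2)]
      by (intro cont_diff_add Suc.IH) auto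
    ultimately show ?thesis by simp
  qed
  then show ?case using Suc.prems by auto
qed (auto intro: continuous_intros)

lemma cont_diff_cmult: "continuously_differentiable k f \<Longrightarrow> continuously_differentiable k (\<lambda>x. c * f x)"
  by (intro cont_diff_mult cont_diff_const)

lemma cont_diff_prod:
  "(\<And>i. i \<in> A \<Longrightarrow> continuously_differentiable k (f i)) \<Longrightarrow>
   continuously_differentiable k (\<lambda>x. \<Prod>i\<in>A. f i x)"
  by (induction A rule: infinite_finite_induct) (auto intro: cont_diff_mult)

text \<open>Every partial derivative of the ridge function with profile \<open>D j\<close> is a
  constant times the one with profile \<open>D (Suc j)\<close>. Treating the whole chain of profiles
  at once, with \<open>j\<close> arbitrary, makes the induction on \<open>k\<close> go
  through.\<close>

lemma cont_diff_ridge: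
  fixes D :: "nat \<Rightarrow> real \<Rightarrow> real"
  assumes D: "\<And>j t. (D j has_real_derivative D (Suc j) t) (at t)"
  shows "continuously_differentiable k (\<lambda>x::'a::euclidean_space. D j (x \<bullet> v + c))"
proof (induction k arbitrary: j)
  have der: "((\<lambda>x::'a. D j (x \<bullet> v + c)) has_derivative (\<lambda>h. (h \<bullet> v) * D (Suc j) (x \<bullet> v + c))) (at x)"
    for j x
    by (rule has_derivative_eq_rhs, rule has_derivative_compose[OF _ D[unfolded has_field_derivative_def]])
      (auto intro!: derivative_eq_intros simp: mult.commute)
  {
    case 0
    show ?case
      using der by (auto intro!: continuous_at_imp_continuous_on has_derivative_continuous)
  next
    case (Suc k)
    have "frechet_derivative (\<lambda>x. D j (x \<bullet> v + c)) (at x) b = (b \<bullet> v) * D (Suc j) (x \<bullet> v + c)" for x b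
      using frechet_derivative_at[OF der[of j x]] by metis
    moreover have "(\<lambda>x. D j (x \<bullet> v + c)) differentiable at x" for x
      using der by (rule differentiableI)
    ultimately show ?case by (auto intro!: cont_diff_cmult Suc.IH)
  }
qed

section \<open>Bump functions supported in boxes\<close>

definition flat_exp :: "real poly \<Rightarrow> real \<Rightarrow> real" where
  "flat_exp p t = (if 0 < t then poly p (1 / t) * exp (- (1 / t)) else 0)"

lemma poly_times_exp_tendsto_0: "((\<lambda>s. poly p s * exp (- s)) \<longlongrightarrow> (0::real)) at_top"
proof -
  have "((\<lambda>s. \<Sum>i\<le>degree p. coeff p i * (s ^ i / exp s)) \<longlongrightarrow> (\<Sum>i\<le>degree p. coeff p i * (0::real))) at_top"
    by (intro tendsto_intros tendsto_power_div_exp_0)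
  then show ?thesis
    by (simp add: poly_altdef exp_minus sum_distrib_right divide_inverse mult.assoc sum_distrib_left)
qed

lemma flat_exp_tendsto_0: "(flat_exp p \<longlongrightarrow> 0) (at 0)"
proof (rule filterlim_split_at)
  show "(flat_exp p \<longlongrightarrow> 0) (at_left 0)"
    by (rule tendsto_eventually) (auto simp: eventually_at_filter flat_exp_def)
  have "((\<lambda>t. poly p (inverse t) * exp (- inverse t)) \<longlongrightarrow> 0) (at_right 0)"
    by (rule filterlim_compose[OF poly_times_exp_tendsto_0 filterlim_inverse_at_top_right])
  moreover have "\<forall>\<^sub>F t in at_right 0. poly p (inverse t) * exp (- inverse t) = flat_exp p t"
    by (auto simp: eventually_at_filter flat_exp_def inverse_eq_divide)
  ultimately show "(flat_exp p \<longlongrightarrow> 0) (at_right 0)" by (rule Lim_transform_eventually)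
qed

text \<open>With s = 1/t the derivative of p(s) exp(-s) in t is s^2 (p(s) - p'(s)) exp(-s). The
  polynomial factor thus closes the family under differentiation, as \<open>cont_diff_ridge\<close>
  requires.\<close>

lemma flat_exp_derivative:
  "(flat_exp p has_real_derivative flat_exp ([:0, 0, 1:] * (p - pderiv p)) t) (at t)"
proof (cases t "0::real" rule: linorder_cases)
  case less
  have "((\<lambda>t. 0) has_real_derivative 0) (at t)" by simp
  then have "(flat_exp p has_real_derivative 0) (at t)"
    by (rule has_field_derivative_transform_within_open[of _ _ _ "{..<0}"])
      (use less in \<open>auto simp: flat_exp_def\<close>)
  then show ?thesis using less by (simp add: flat_exp_def)
next
  case equal
  \<comment> \<open>Since \<open>flat_exp p 0 = 0\<close>, the difference quotient at the origin
    only multiplies the polynomial by its variable 1/h; it is again a member of the family and tends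
    to 0.\<close>
  have "(\<lambda>h. (flat_exp p (0 + h) - flat_exp p 0) / h) = flat_exp (pCons 0 p)"
    by (auto simp: fun_eq_iff flat_exp_def)
  then have "(flat_exp p has_real_derivative 0) (at 0)"
    using flat_exp_tendsto_0 by (simp add: DERIV_def)
  then show ?thesis using equal by (simp add: flat_exp_def)
next
  case greater
  have "((\<lambda>t. poly p (1 / t) * exp (- (1 / t))) has_real_derivative
      flat_exp ([:0, 0, 1:] * (p - pderiv p)) t) (at t)"
    using greater
    by (auto intro!: derivative_eq_intros DERIV_chain2[OF poly_DERIV]
        simp: flat_exp_def power2_eq_square field_simps)
  then show ?thesis
    by (rule has_field_derivative_transform_within_open[of _ _ _ "{0<..}"])
      (use greater in \<open>auto simp: flat_exp_def\<close>)
qed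

lemma cont_diff_flat_exp_ridge: "continuously_differentiable k (\<lambda>x::'a::euclidean_space. flat_exp p (x \<bullet> v + c))"
  using cont_diff_ridge[of "\<lambda>j. flat_exp (((\<lambda>q. [:0, 0, 1:] * (q - pderiv q)) ^^ j) p)" k 0 v c]
    flat_exp_derivative by simp

text \<open>For n > 0 this is positive exactly on \<open>box l u\<close>. The arguments are written
  as inner products so that each factor is a ridge function. The factor \<open>n\<close> steepens
  the flanks: as n grows, the value at each point of the box tends to
  \<open>exp 0 = 1\<close>.\<close>

definition bump :: "nat \<Rightarrow> 'a::euclidean_space \<Rightarrow> 'a \<Rightarrow> 'a \<Rightarrow> real" where
  "bump n l u x = (\<Prod>b\<in>Basis. flat_exp 1 (x \<bullet> (real n *\<^sub>R b) + - real n * (l \<bullet> b)) *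
     flat_exp 1 (x \<bullet> (- real n *\<^sub>R b) + real n * (u \<bullet> b)))"

lemma bump_eq:
  assumes "n > 0"
  shows "bump n l u x = (if x \<in> box l u
    then \<Prod>b\<in>Basis. exp (- (1 / (real n * (x \<bullet> b - l \<bullet> b)))) * exp (- (1 / (real n * (u \<bullet> b - x \<bullet> b)))) else 0)"
proof -
  have 1: "x \<bullet> (real n *\<^sub>R b) + - real n * (l \<bullet> b) = real n * (x \<bullet> b - l \<bullet> b)"
    "x \<bullet> (- real n *\<^sub>R b) + real n * (u \<bullet> b) = real n * (u \<bullet> b - x \<bullet> b)" for b
    by (simp_all add: algebra_simps)
  show ?thesis
  proof (cases "x \<in> box l u")
    case True
    then show ?thesis
      unfolding bump_def 1 using assms
      by (auto simp: mem_box flat_exp_def intro!: prod.cong)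
  next
    case False
    then obtain b where "b \<in> Basis" "\<not> (l \<bullet> b < x \<bullet> b \<and> x \<bullet> b < u \<bullet> b)" by (auto simp: mem_box)
    then have "bump n l u x = 0"
      unfolding bump_def 1 using assms
      by (auto intro!: prod_zero bexI[of _ b] simp: flat_exp_def zero_less_mult_iff)
    with False show ?thesis by simp
  qed
qed

lemma bump_test_function:
  assumes "n > 0" "cbox l u \<subseteq> \<Omega>"
  shows "bump n l u \<in> test_functions \<Omega>"
proof -
  have "{x. bump n l u x \<noteq> 0} \<subseteq> cbox l u"
    using box_subset_cbox[of l u] by (auto simp: bump_eq[OF assms(1)] split: if_splits)
  then have cl: "closure {x. bump n l u x \<noteq> 0} \<subseteq> cbox l u"
    by (rule closure_minimal) (rule closed_cbox)
  have "continuously_differentiable k (bump n l u)" for k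
    unfolding bump_def[abs_def] by (intro cont_diff_prod cont_diff_mult cont_diff_flat_exp_ridge)
  moreover have "compact (closure {x. bump n l u x \<noteq> 0})"
    using compact_Int_closed[OF compact_cbox closed_closure] cl by (metis inf.absorb2)
  ultimately show ?thesis using cl assms(2) by (auto simp: test_functions_def)
qed

lemma bump_bounds: "n > 0 \<Longrightarrow> 0 \<le> bump n l u x" "n > 0 \<Longrightarrow> bump n l u x \<le> indicator (box l u) x"
proof -
  assume n: "n > 0"
  show "0 \<le> bump n l u x" by (auto simp: bump_eq[OF n] intro!: prod_nonneg)
  show "bump n l u x \<le> indicator (box l u) x"
    using n by (auto simp: bump_eq[OF n] mem_box intro!: prod_le_1 mult_le_one)
qed

lemma bump_tendsto: "(\<lambda>n. bump (Suc n) l u x) \<longlonglongrightarrow> indicator (box l u) x"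
proof (cases "x \<in> box l u")
  case True
  have lim: "(\<lambda>n. exp (- (1 / (real (Suc n) * c)))) \<longlonglongrightarrow> 1" for c :: real
  proof -
    have "(\<lambda>n. exp (- (1 / real (Suc n)) * (1 / c))) \<longlonglongrightarrow> exp (- 0 * (1 / c))"
      by (intro tendsto_intros LIMSEQ_Suc[OF lim_1_over_n])
    then show ?thesis by simp
  qed
  have "(\<lambda>n. \<Prod>b\<in>Basis. exp (- (1 / (real (Suc n) * (x \<bullet> b - l \<bullet> b)))) *
      exp (- (1 / (real (Suc n) * (u \<bullet> b - x \<bullet> b))))) \<longlonglongrightarrow> (\<Prod>b\<in>(Basis::'a set). 1 * 1)"
    by (intro tendsto_prod tendsto_mult lim)
  with True show ?thesis by (simp add: bump_eq)
next
  case False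
  then show ?thesis by (simp add: bump_eq)
qed

text \<open>Dynkin's argument: boxes form an intersection-stable generator of the Borel sets, and
  the sets over which G integrates to zero are closed under complements and countable disjoint
  unions. The total integral supplies the complement step.\<close>

lemma integral_zero_boxes_AE_zero:
  fixes G :: "'a::euclidean_space \<Rightarrow> real"
  assumes G: "integrable lborel G"
    and total: "(LINT x|lborel. G x) = 0"
    and boxes: "\<And>l u. (LINT x:box l u|lborel. G x) = 0"
  shows "AE x in lborel. G x = 0"
proof -
  let ?E = "range (\<lambda>(a, b). box a b::'a set)"
  have int: "set_integrable lborel A G" if "A \<in> sets borel" for A
    unfolding set_integrable_def using that by (intro integrable_mult_indicator G) simp
  have zero: "(LINT x:A|lborel. G x) = 0" if "A \<in> sets borel" for A
  proof -
    have stable: "Int_stable ?E" by (auto simp: Int_stable_def box_Int_box)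
    have borel: "sets borel = sigma_sets UNIV ?E" by (simp add: borel_eq_box)
    have subset: "?E \<subseteq> Pow UNIV" by simp
    have A: "A \<in> sigma_sets UNIV ?E" using that borel by simp
    show ?thesis
      using stable subset A
    proof (induction rule: sigma_sets_induct_disjoint)
      case (basic A)
      then show ?case using boxes by auto
    next
      case empty
      show ?case by (simp add: set_lebesgue_integral_def)
    next
      case (compl A)
      then have [measurable]: "A \<in> sets borel" using borel by simp
      have "(LINT x:A \<union> (UNIV - A)|lborel. G x) = (LINT x:A|lborel. G x) + (LINT x:UNIV - A|lborel. G x)"
        by (intro set_integral_Un int) auto
      then show ?case using compl total by (simp add: set_lebesgue_integral_def)
    next
      case (union A)
      then have sets: "A i \<in> sets borel" for i using borel by auto
      then have "(LINT x:(\<Union>i. A i)|lborel. G x) = (\<Sum>i. LINT x:A i|lborel. G x)"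
        using union.hyps
        by (intro lebesgue_integral_countable_add int sets.countable_UN)
          (auto simp: disjoint_family_on_def)
      then show ?case using union by simp
    qed
  qed
  have "AE x in lborel. G x = (\<lambda>x. 0) x"
    using G zero by (intro density_unique_real) (auto simp: set_lebesgue_integral_def)
  then show ?thesis by simp
qed

text \<open>The corners are clipped coordinatewise. The inclusion of the closed box keeps the bumps
  on the intersection inside the domain.\<close>

lemma box_Int_box_box: "\<exists>p q. box a b \<inter> box l u = box p (q::'a::euclidean_space) \<and> cbox p q \<subseteq> cbox a b"
proof -
  let ?p = "\<Sum>i\<in>Basis. max (a\<bullet>i) (l\<bullet>i) *\<^sub>R i" and ?q = "\<Sum>i\<in>Basis. min (b\<bullet>i) (u\<bullet>i) *\<^sub>R i"
  have "cbox ?p ?q \<subseteq> cbox a b" by (auto simp: mem_box)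
  then show ?thesis by (intro exI[of _ ?p] exI[of _ ?q]) (simp add: box_Int_box)
qed

text \<open>Bumps converge dominatedly to indicators of boxes with closure in \<Omega>, so g
  integrates to zero over all such boxes. Within one such box the subboxes determine g almost
  everywhere, and countably many closed boxes exhaust \<Omega>.\<close>

lemma fundamental_lemma:
  fixes g :: "'a::euclidean_space l2"
  assumes "open \<Omega>" "g \<in> L2_space \<Omega>"
    and zero: "\<And>\<psi>. \<psi> \<in> test_functions \<Omega> \<Longrightarrow> (LINT x|lborel. l2_fun g x * \<psi> x) = 0"
  shows "g = 0"
proof -
  have si: "square_integrable (indicat_real (box l u))" for l u :: 'a
  proof -
    have "(\<lambda>x. (indicat_real (box l u) x)\<^sup>2) = indicator (box l u)"
      by (auto simp: indicator_def fun_eq_iff)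
    then show ?thesis
      using emeasure_lborel_box_finite[of l u] by (simp add: square_integrable_def)
  qed
  have int: "integrable lborel (\<lambda>x. l2_fun g x * indicator (box l u) x)" for l u :: 'a
    by (rule square_integrable_mult[OF square_integrable_l2_fun si])
  have box0: "(LINT x|lborel. l2_fun g x * indicator (box l u) x) = 0" if sub: "cbox l u \<subseteq> \<Omega>" for l u
  proof -
    have [measurable]: "bump (Suc n) l u \<in> borel_measurable borel" for n
      using bump_test_function[OF _ sub, of "Suc n"]
      by (auto simp: test_functions_def intro!: borel_measurable_continuous_onI cont_diff_imp_continuous)
    have "(\<lambda>n. LINT x|lborel. l2_fun g x * bump (Suc n) l u x) \<longlonglongrightarrow>
        (LINT x|lborel. l2_fun g x * indicator (box l u) x)"
    proof (rule integral_dominated_convergence)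
      show "integrable lborel (\<lambda>x. \<bar>l2_fun g x * indicator (box l u) x\<bar>)"
        using int by (rule integrable_abs)
      show "AE x in lborel. (\<lambda>n. l2_fun g x * bump (Suc n) l u x) \<longlonglongrightarrow> l2_fun g x * indicator (box l u) x"
        by (intro AE_I2 tendsto_mult bump_tendsto tendsto_const)
      show "AE x in lborel. norm (l2_fun g x * bump (Suc n) l u x) \<le> \<bar>l2_fun g x * indicator (box l u) x\<bar>" for n
      proof (rule AE_I2)
        fix x
        show "norm (l2_fun g x * bump (Suc n) l u x) \<le> \<bar>l2_fun g x * indicator (box l u) x\<bar>"
          using bump_bounds[of "Suc n" l u x] by (auto simp: abs_mult intro!: mult_left_mono)
      qed
    qed measurable
    then show ?thesis
      using zero[OF bump_test_function[OF _ sub]] by (simp add: LIMSEQ_const_iff)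
  qed
  have AE_box: "AE x in lborel. x \<in> cbox a b \<longrightarrow> l2_fun g x = 0" if sub: "cbox a b \<subseteq> \<Omega>" for a b
  proof -
    have "AE x in lborel. l2_fun g x * indicator (box a b) x = 0"
    proof (rule integral_zero_boxes_AE_zero[OF int box0[OF sub]])
      fix l u
      obtain p q where pq: "box a b \<inter> box l u = box p q" "cbox p q \<subseteq> cbox a b"
        using box_Int_box_box by blast
      have "(LINT x:box l u|lborel. l2_fun g x * indicator (box a b) x) =
          (LINT x|lborel. l2_fun g x * indicator (box p q) x)"
        unfolding set_lebesgue_integral_def pq(1)[symmetric]
        by (intro Bochner_Integration.integral_cong) (auto simp: indicator_def)
      then show "(LINT x:box l u|lborel. l2_fun g x * indicator (box a b) x) = 0"
        using box0[of p q] pq(2) sub by simp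
    qed
    \<comment> \<open>The integrals determine g on open boxes, while the cover below consists of
      closed ones; the faces are a null set.\<close>
    moreover have "AE x in lborel. x \<notin> cbox a b - box a b"
    proof (rule AE_not_in)
      have "emeasure lborel (cbox a b - box a b) = emeasure lborel (cbox a b) - emeasure lborel (box a b)"
        using emeasure_lborel_box_finite[of a b] by (intro emeasure_Diff) (auto simp: box_subset_cbox)
      also have "\<dots> = 0"
        by (simp add: emeasure_lborel_box_eq emeasure_lborel_cbox_eq)
      finally show "cbox a b - box a b \<in> null_sets lborel" by (auto simp: null_sets_def)
    qed
    ultimately show ?thesis by eventually_elim (auto simp: indicator_def split: if_splits)
  qed
  obtain \<D> where \<D>: "countable \<D>" "\<D> \<subseteq> Pow \<Omega>" "\<And>X. X \<in> \<D> \<Longrightarrow> \<exists>a b. X = cbox a b" "\<Union>\<D> = \<Omega>"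
    using open_countable_Union_open_cbox[OF assms(1)] by metis
  have "AE x in lborel. x \<in> X \<longrightarrow> l2_fun g x = 0" if "X \<in> \<D>" for X
    using \<D>(3)[OF that] \<D>(2) that AE_box by blast
  then have "AE x in lborel. \<forall>X\<in>\<D>. x \<in> X \<longrightarrow> l2_fun g x = 0"
    by (subst AE_ball_countable[OF \<D>(1)]) blast
  moreover have "AE x in lborel. x \<notin> \<Omega> \<longrightarrow> l2_fun g x = 0"
    using assms(2) by (simp add: L2_space_def)
  ultimately have "AE x in lborel. l2_fun g x = l2_fun 0 x"
    using l2_fun_zero by eventually_elim (use \<D>(4) in auto)
  then show ?thesis by (rule l2_eqI)
qed


section \<open>Integration by parts\<close>

lemma integral_translate:
  fixes f :: "'a::euclidean_space \<Rightarrow> real"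
  assumes [measurable]: "f \<in> borel_measurable borel"
  shows "(LINT x|lborel. f (x + c)) = (LINT x|lborel. f x)"
proof -
  have "(LINT x|lborel. f x) = (LINT x|distr lborel borel ((+) c). f x)"
    by (simp add: lborel_distr_plus)
  also have "\<dots> = (LINT x|lborel. f (c + x))"
    by (rule integral_distr) auto
  finally show ?thesis by (simp add: add.commute)
qed

lemma integrable_translate:
  fixes f :: "'a::euclidean_space \<Rightarrow> real"
  assumes "integrable lborel f"
  shows "integrable lborel (\<lambda>x. f (x + c))"
proof -
  have "integrable (distr lborel borel ((+) c)) f"
    using assms by (simp add: lborel_distr_plus)
  then have "integrable lborel (\<lambda>x. f (c + x))"
    by (subst (asm) integrable_distr_eq) (use assms in auto)
  then show ?thesis by (simp add: add.commute)
qed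

lemma square_integrable_translate:
  "square_integrable f \<Longrightarrow> square_integrable (\<lambda>x. f (x + c))"
  using integrable_translate[of "\<lambda>x. (f x)\<^sup>2" c] by (auto simp: square_integrable_def)

lemma norm_to_l2_translate:
  assumes "square_integrable f"
  shows "norm (to_l2 (\<lambda>x. f (x + c))) = norm (to_l2 f)"
proof -
  have "(norm (to_l2 (\<lambda>x. f (x + c))))\<^sup>2 = (norm (to_l2 f))\<^sup>2"
    using assms integral_translate[of "\<lambda>x. (f x)\<^sup>2" c] square_integrable_measurable[OF assms]
    by (simp add: norm_to_l2_square square_integrable_translate)
  then show ?thesis by (simp add: power2_eq_iff_nonneg)
qed

definition dir_deriv :: "('a::euclidean_space \<Rightarrow> real) \<Rightarrow> 'a \<Rightarrow> 'a \<Rightarrow> real" where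
  "dir_deriv \<psi> y x = frechet_derivative \<psi> (at x) y"

lemma test_function_cont_diff: "\<psi> \<in> test_functions \<Omega> \<Longrightarrow> continuously_differentiable k \<psi>"
  by (simp add: test_functions_def)

lemma test_function_differentiable: "\<psi> \<in> test_functions \<Omega> \<Longrightarrow> \<psi> differentiable at x"
  using test_function_cont_diff[of \<psi> \<Omega> "Suc 0"] by simp

lemma test_function_continuous: "\<psi> \<in> test_functions \<Omega> \<Longrightarrow> continuous_on UNIV \<psi>"
  by (rule cont_diff_imp_continuous[OF test_function_cont_diff])

lemma test_function_measurable: "\<psi> \<in> test_functions \<Omega> \<Longrightarrow> \<psi> \<in> borel_measurable borel"
  by (intro borel_measurable_continuous_onI test_function_continuous)

lemma mem_closure_support: "\<psi> x \<noteq> 0 \<Longrightarrow> x \<in> closure {x. \<psi> x \<noteq> 0}"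
  by (rule subsetD[OF closure_subset]) simp

lemma compact_closed_subset: "compact S \<Longrightarrow> closed T \<Longrightarrow> T \<subseteq> S \<Longrightarrow> compact (T :: 'a::t2_space set)"
  using compact_Int_closed[of S T] by (simp add: Int_absorb1)

lemma test_functionI:
  assumes "\<And>k. continuously_differentiable k \<eta>" "\<psi> \<in> test_functions \<Omega>"
    and "\<And>x. x \<notin> closure {x. \<psi> x \<noteq> 0} \<Longrightarrow> \<eta> x = 0"
  shows "\<eta> \<in> test_functions \<Omega>"
proof -
  have sub: "closure {x. \<eta> x \<noteq> 0} \<subseteq> closure {x. \<psi> x \<noteq> 0}"
    using assms(3) by (intro closure_minimal) auto
  have "compact (closure {x. \<psi> x \<noteq> 0})" using assms(2) by (simp add: test_functions_def)
  then have "compact (closure {x. \<eta> x \<noteq> 0})"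
    by (rule compact_closed_subset[OF _ closed_closure sub])
  with sub show ?thesis using assms(1,2) by (auto simp: test_functions_def)
qed

lemma test_function_zero: "(\<lambda>x. 0) \<in> test_functions \<Omega>"
  by (simp add: test_functions_def)

lemma test_function_mult:
  assumes "\<And>k. continuously_differentiable k g" "\<psi> \<in> test_functions \<Omega>"
  shows "(\<lambda>x. g x * \<psi> x) \<in> test_functions \<Omega>"
proof (rule test_functionI[OF _ assms(2)])
  fix x assume "x \<notin> closure {x. \<psi> x \<noteq> 0}"
  then have "\<psi> x = 0" using mem_closure_support[of \<psi> x] by blast
  then show "g x * \<psi> x = 0" by simp
qed (intro cont_diff_mult assms(1) test_function_cont_diff[OF assms(2)])

lemma test_function_cmult: "\<psi> \<in> test_functions \<Omega> \<Longrightarrow> (\<lambda>x. c * \<psi> x) \<in> test_functions \<Omega>"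
  by (rule test_function_mult) auto

lemma test_function_add:
  assumes "\<psi> \<in> test_functions \<Omega>" "\<eta> \<in> test_functions \<Omega>"
  shows "(\<lambda>x. \<psi> x + \<eta> x) \<in> test_functions \<Omega>"
proof -
  let ?S = "\<lambda>\<psi>. closure {x. \<psi> x \<noteq> 0}"
  have "{x. \<psi> x + \<eta> x \<noteq> 0} \<subseteq> ?S \<psi> \<union> ?S \<eta>"
  proof
    fix x assume "x \<in> {x. \<psi> x + \<eta> x \<noteq> 0}"
    then have "\<psi> x \<noteq> 0 \<or> \<eta> x \<noteq> 0" by auto
    then show "x \<in> ?S \<psi> \<union> ?S \<eta>"
      using mem_closure_support[of \<psi>] mem_closure_support[of \<eta>] by blast
  qed
  then have sub: "?S (\<lambda>x. \<psi> x + \<eta> x) \<subseteq> ?S \<psi> \<union> ?S \<eta>"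
    by (intro closure_minimal) auto
  have "compact (?S \<psi> \<union> ?S \<eta>)"
    using assms by (intro compact_Un) (auto simp: test_functions_def)
  then have "compact (?S (\<lambda>x. \<psi> x + \<eta> x))"
    by (rule compact_closed_subset[OF _ closed_closure sub])
  with sub assms show ?thesis
    by (auto simp: test_functions_def intro!: cont_diff_add)
qed

lemma test_function_sum:
  "finite A \<Longrightarrow> (\<And>i. i \<in> A \<Longrightarrow> \<psi> i \<in> test_functions \<Omega>) \<Longrightarrow> (\<lambda>x. \<Sum>i\<in>A. \<psi> i x) \<in> test_functions \<Omega>"
  by (induction A rule: finite_induct) (auto intro: test_function_zero test_function_add)

lemma test_function_diff:
  "\<psi> \<in> test_functions \<Omega> \<Longrightarrow> \<eta> \<in> test_functions \<Omega> \<Longrightarrow> (\<lambda>x. \<psi> x - \<eta> x) \<in> test_functions \<Omega>"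
  using test_function_add[OF _ test_function_cmult[of \<eta> \<Omega> "-1"]] by fastforce

lemma test_function_outside: "\<psi> \<in> test_functions \<Omega> \<Longrightarrow> x \<notin> \<Omega> \<Longrightarrow> \<psi> x = 0"
  using closure_subset[of "{x. \<psi> x \<noteq> 0}"] by (auto simp: test_functions_def)

lemma has_derivative_test_function:
  "\<psi> \<in> test_functions \<Omega> \<Longrightarrow> (\<psi> has_derivative (\<lambda>y. dir_deriv \<psi> y x)) (at x)"
  unfolding dir_deriv_def using test_function_differentiable frechet_derivative_works by fastforce

lemma dir_deriv_eqI: "(\<psi> has_derivative D) (at x) \<Longrightarrow> dir_deriv \<psi> y x = D y"
  by (simp add: dir_deriv_def frechet_derivative_at[symmetric])

lemma dir_deriv_sum_Basis:
  assumes "\<psi> \<in> test_functions \<Omega>"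
  shows "dir_deriv \<psi> y x = (\<Sum>b\<in>Basis. (y \<bullet> b) * dir_deriv \<psi> b x)"
proof -
  interpret linear "\<lambda>y. dir_deriv \<psi> y x"
    using has_derivative_linear[OF has_derivative_test_function[OF assms]] .
  have "dir_deriv \<psi> y x = dir_deriv \<psi> (\<Sum>b\<in>Basis. (y \<bullet> b) *\<^sub>R b) x" by (simp add: euclidean_representation)
  then show ?thesis by (simp add: sum scale)
qed

lemma dir_deriv_test_function:
  assumes "\<psi> \<in> test_functions \<Omega>"
  shows "dir_deriv \<psi> y \<in> test_functions \<Omega>"
proof -
  have "dir_deriv \<psi> b \<in> test_functions \<Omega>" if b: "b \<in> Basis" for b
  proof (rule test_functionI[OF _ assms])
    show "continuously_differentiable k (dir_deriv \<psi> b)" for k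
      using test_function_cont_diff[OF assms, of "Suc k"] b by (simp add: dir_deriv_def[abs_def])
    fix x assume x: "x \<notin> closure {x. \<psi> x \<noteq> 0}"
    have "(\<psi> has_derivative (\<lambda>y. 0)) (at x)"
      by (rule has_derivative_transform_within_open[of "\<lambda>x. 0" _ _ _ "- closure {x. \<psi> x \<noteq> 0}"])
        (use x mem_closure_support[of \<psi>] in auto)
    then show "dir_deriv \<psi> b x = 0" by (rule dir_deriv_eqI)
  qed
  \<comment> \<open>\<open>continuously_differentiable\<close> speaks of basis directions only; a
    general direction is reached by linearity of the derivative.\<close>
  then have "(\<lambda>x. \<Sum>b\<in>Basis. (y \<bullet> b) * dir_deriv \<psi> b x) \<in> test_functions \<Omega>"
    by (intro test_function_sum test_function_cmult) auto
  also have "(\<lambda>x. \<Sum>b\<in>Basis. (y \<bullet> b) * dir_deriv \<psi> b x) = dir_deriv \<psi> y"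
    by (intro ext dir_deriv_sum_Basis[OF assms, symmetric])
  finally show ?thesis .
qed

lemma test_function_bounds:
  assumes "\<psi> \<in> test_functions \<Omega>"
  obtains M R where "0 \<le> M" "\<And>x. \<bar>\<psi> x\<bar> \<le> M" "\<And>x. \<psi> x \<noteq> 0 \<Longrightarrow> norm x \<le> R"
proof -
  let ?S = "closure {x. \<psi> x \<noteq> 0}"
  have S: "compact ?S" using assms by (simp add: test_functions_def)
  have "continuous_on ?S \<psi>"
    using test_function_continuous[OF assms] by (rule continuous_on_subset) simp
  from compact_continuous_image[OF this S] have "bounded (\<psi> ` ?S)"
    by (rule compact_imp_bounded)
  then obtain M where M: "\<And>x. x \<in> ?S \<Longrightarrow> \<bar>\<psi> x\<bar> \<le> M" by (auto simp: bounded_iff)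
  have bM: "\<bar>\<psi> x\<bar> \<le> \<bar>M\<bar>" for x
  proof (cases "\<psi> x = 0")
    case False
    from M[OF mem_closure_support[of \<psi> x, OF this]] show ?thesis by linarith
  qed simp
  obtain R where "\<And>x. x \<in> ?S \<Longrightarrow> norm x \<le> R"
    using compact_imp_bounded[OF S] by (auto simp: bounded_iff)
  then have "norm x \<le> R" if "\<psi> x \<noteq> 0" for x
    using mem_closure_support[of \<psi> x, OF that] by blast
  then show ?thesis using that[of "\<bar>M\<bar>" R] bM by simp
qed

lemma integrable_indicator_cball: "integrable lborel (\<lambda>x. c * indicat_real (cball a R) x)"
  using emeasure_lborel_cball_finite[of a R] by (intro integrable_mult_right) simp

lemma square_integrable_bounded_support:
  fixes f :: "'a::euclidean_space \<Rightarrow> real"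
  assumes [measurable]: "f \<in> borel_measurable borel"
    and "\<And>x. \<bar>f x\<bar> \<le> M * indicator (cball 0 R) x"
  shows "square_integrable f"
  unfolding square_integrable_def
proof
  show "integrable lborel (\<lambda>x. (f x)\<^sup>2)"
  proof (rule Bochner_Integration.integrable_bound)
    show "integrable lborel (\<lambda>x. M\<^sup>2 * indicator (cball 0 R) x)"
      by (rule integrable_indicator_cball)
    have "(f x)\<^sup>2 \<le> M\<^sup>2 * indicator (cball 0 R) x" for x
      using power_mono[OF assms(2)[of x], of 2] by (auto simp: indicator_def)
    then show "AE x in lborel. norm ((f x)\<^sup>2) \<le> norm (M\<^sup>2 * indicator (cball 0 R) x :: real)"
      by (auto simp: indicator_def)
  qed simp
qed simp

lemma test_function_square_integrable: "\<psi> \<in> test_functions \<Omega> \<Longrightarrow> square_integrable \<psi>"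
proof -
  assume \<psi>: "\<psi> \<in> test_functions \<Omega>"
  obtain M R where b: "0 \<le> M" "\<And>x. \<bar>\<psi> x\<bar> \<le> M" "\<And>x. \<psi> x \<noteq> 0 \<Longrightarrow> norm x \<le> R"
    using test_function_bounds[OF \<psi>] by metis
  have "\<bar>\<psi> x\<bar> \<le> M * indicator (cball 0 R) x" for x
    using b(2,3)[of x] by (cases "\<psi> x = 0") (auto simp: indicator_def b(1))
  with test_function_measurable[OF \<psi>] show ?thesis by (rule square_integrable_bounded_support)
qed

text \<open>One majorant serves dominated convergence for all step sizes: the mean value theorem
  bounds the quotients by a bound on the directional derivative, and steps of length at most
  \<open>norm y\<close> enlarge the support by no more than that.\<close>

lemma test_function_difference_quotient:
  assumes \<psi>: "\<psi> \<in> test_functions \<Omega>"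
  obtains M R where
    "\<And>m x. \<bar>real (Suc m) * (\<psi> (x + (1 / real (Suc m)) *\<^sub>R y) - \<psi> x)\<bar> \<le> M * indicator (cball 0 R) x"
    "\<And>x. (\<lambda>m. real (Suc m) * (\<psi> (x + (1 / real (Suc m)) *\<^sub>R y) - \<psi> x)) \<longlonglongrightarrow> dir_deriv \<psi> y x"
proof -
  have der: "((\<lambda>t. \<psi> (x + t *\<^sub>R y)) has_real_derivative dir_deriv \<psi> y (x + t *\<^sub>R y)) (at t)" for x t
  proof -
    interpret linear "\<lambda>h. dir_deriv \<psi> h (x + t *\<^sub>R y)"
      using has_derivative_linear[OF has_derivative_test_function[OF \<psi>]] .
    have "((\<lambda>t. \<psi> (x + t *\<^sub>R y)) has_derivative (\<lambda>h. dir_deriv \<psi> (h *\<^sub>R y) (x + t *\<^sub>R y))) (at t)"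
      by (rule has_derivative_compose[OF _ has_derivative_test_function[OF \<psi>]])
        (auto intro!: derivative_eq_intros)
    moreover have "(\<lambda>h. h * dir_deriv \<psi> y (x + t *\<^sub>R y)) = (*) (dir_deriv \<psi> y (x + t *\<^sub>R y))"
      by (simp add: fun_eq_iff)
    ultimately show ?thesis by (simp add: has_field_derivative_def scale)
  qed
  obtain M where M: "0 \<le> M" "\<And>x. \<bar>dir_deriv \<psi> y x\<bar> \<le> M"
    using test_function_bounds[OF dir_deriv_test_function[OF \<psi>]] by metis
  obtain R where R: "\<And>x. \<psi> x \<noteq> 0 \<Longrightarrow> norm x \<le> R"
    using test_function_bounds[OF \<psi>] by metis
  have mvt: "\<bar>real (Suc m) * (\<psi> (x + (1 / real (Suc m)) *\<^sub>R y) - \<psi> x)\<bar> \<le> M" for m x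
  proof -
    have "\<exists>z>0. z < 1 / real (Suc m) \<and>
        \<psi> (x + (1 / real (Suc m)) *\<^sub>R y) - \<psi> (x + 0 *\<^sub>R y) = (1 / real (Suc m) - 0) * dir_deriv \<psi> y (x + z *\<^sub>R y)"
      by (rule MVT2) (use der in auto)
    then obtain z where "\<psi> (x + (1 / real (Suc m)) *\<^sub>R y) - \<psi> x = 1 / real (Suc m) * dir_deriv \<psi> y (x + z *\<^sub>R y)"
      by auto
    then have "real (Suc m) * (\<psi> (x + (1 / real (Suc m)) *\<^sub>R y) - \<psi> x) = dir_deriv \<psi> y (x + z *\<^sub>R y)"
      by simp
    with M(2) show ?thesis by simp
  qed
  have supp: "\<psi> (x + (1 / real (Suc m)) *\<^sub>R y) = 0" if "norm x > \<bar>R\<bar> + norm y" for m x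
  proof (rule ccontr)
    assume "\<psi> (x + (1 / real (Suc m)) *\<^sub>R y) \<noteq> 0"
    then have "norm (x + (1 / real (Suc m)) *\<^sub>R y) \<le> R" by (rule R)
    moreover have "norm x \<le> norm (x + (1 / real (Suc m)) *\<^sub>R y) + norm ((1 / real (Suc m)) *\<^sub>R y)"
      using norm_triangle_ineq4[of "x + (1 / real (Suc m)) *\<^sub>R y" "(1 / real (Suc m)) *\<^sub>R y"] by simp
    moreover have "norm ((1 / real (Suc m)) *\<^sub>R y) \<le> norm y"
      by (simp add: field_simps mult_le_cancel_left1)
    ultimately show False using that by simp
  qed
  have supp0: "\<psi> x = 0" if "norm x > \<bar>R\<bar> + norm y" for x
  proof (rule ccontr)
    assume "\<psi> x \<noteq> 0"
    from R[OF this] that norm_ge_zero[of y] show False by linarith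
  qed
  show ?thesis
  proof (rule that)
    fix m x
    show "\<bar>real (Suc m) * (\<psi> (x + (1 / real (Suc m)) *\<^sub>R y) - \<psi> x)\<bar> \<le> M * indicator (cball 0 (\<bar>R\<bar> + norm y)) x"
    proof (cases "x \<in> cball 0 (\<bar>R\<bar> + norm y)")
      case True
      with mvt show ?thesis by simp
    next
      case False
      then have "norm x > \<bar>R\<bar> + norm y" by simp
      from supp[OF this] supp0[OF this] show ?thesis using M by simp
    qed
  next
    fix x
    have "((\<lambda>h. (\<psi> (x + h *\<^sub>R y) - \<psi> x) / h) \<longlongrightarrow> dir_deriv \<psi> y x) (at 0)"
      using der[of x 0] by (simp add: DERIV_def)
    moreover have "filterlim (\<lambda>m. 1 / real (Suc m)) (at 0) sequentially"
      using LIMSEQ_Suc[OF lim_1_over_n] by (auto simp: filterlim_at simp del: of_nat_Suc)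
    ultimately have "(\<lambda>m. (\<psi> (x + (1 / real (Suc m)) *\<^sub>R y) - \<psi> x) / (1 / real (Suc m))) \<longlonglongrightarrow> dir_deriv \<psi> y x"
      by (rule filterlim_compose)
    then show "(\<lambda>m. real (Suc m) * (\<psi> (x + (1 / real (Suc m)) *\<^sub>R y) - \<psi> x)) \<longlonglongrightarrow> dir_deriv \<psi> y x"
      by (simp add: mult.commute del: of_nat_Suc)
  qed
qed

text \<open>Each difference quotient integrates to zero because Lebesgue measure is translation
  invariant; dominated convergence passes this on to the derivative.\<close>

lemma integral_dir_deriv_zero:
  assumes \<psi>: "\<psi> \<in> test_functions \<Omega>"
  shows "(LINT x|lborel. dir_deriv \<psi> y x) = 0"
proof -
  obtain M R where
    b: "\<And>m x. \<bar>real (Suc m) * (\<psi> (x + (1 / real (Suc m)) *\<^sub>R y) - \<psi> x)\<bar> \<le> M * indicator (cball 0 R) x"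
    and l: "\<And>x. (\<lambda>m. real (Suc m) * (\<psi> (x + (1 / real (Suc m)) *\<^sub>R y) - \<psi> x)) \<longlonglongrightarrow> dir_deriv \<psi> y x"
    using test_function_difference_quotient[OF \<psi>] by metis
  note [measurable] = test_function_measurable[OF \<psi>] test_function_measurable[OF dir_deriv_test_function[OF \<psi>]]
  obtain M0 R0 where b0: "0 \<le> M0" "\<And>x. \<bar>\<psi> x\<bar> \<le> M0" "\<And>x. \<psi> x \<noteq> 0 \<Longrightarrow> norm x \<le> R0"
    using test_function_bounds[OF \<psi>] by metis
  have int: "integrable lborel \<psi>"
  proof (rule Bochner_Integration.integrable_bound)
    show "integrable lborel (\<lambda>x. M0 * indicator (cball 0 R0) x)"
      by (rule integrable_indicator_cball)
    have "\<bar>\<psi> x\<bar> \<le> \<bar>M0 * indicator (cball 0 R0) x\<bar>" for x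
      using b0(2,3)[of x] by (cases "\<psi> x = 0") (auto simp: indicator_def b0(1))
    then show "AE x in lborel. norm (\<psi> x) \<le> norm (M0 * indicator (cball 0 R0) x :: real)" by simp
  qed simp
  have "(\<lambda>m. LINT x|lborel. real (Suc m) * (\<psi> (x + (1 / real (Suc m)) *\<^sub>R y) - \<psi> x)) \<longlonglongrightarrow> (LINT x|lborel. dir_deriv \<psi> y x)"
  proof (rule integral_dominated_convergence)
    show "integrable lborel (\<lambda>x. M * indicator (cball 0 R) x)"
      by (rule integrable_indicator_cball)
    show "AE x in lborel. norm (real (Suc m) * (\<psi> (x + (1 / real (Suc m)) *\<^sub>R y) - \<psi> x)) \<le> M * indicator (cball 0 R) x" for m
      using b by simp
    show "AE x in lborel. (\<lambda>m. real (Suc m) * (\<psi> (x + (1 / real (Suc m)) *\<^sub>R y) - \<psi> x)) \<longlonglongrightarrow> dir_deriv \<psi> y x"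
      using l by simp
  qed measurable
  moreover have "(LINT x|lborel. real (Suc m) * (\<psi> (x + (1 / real (Suc m)) *\<^sub>R y) - \<psi> x)) = 0" for m
    using int integrable_translate[OF int]
    by (simp add: integral_translate del: of_nat_Suc)
  ultimately show ?thesis by (simp add: LIMSEQ_const_iff)
qed

lemma dir_deriv_mult:
  assumes "\<psi> \<in> test_functions \<Omega>" "\<eta> \<in> test_functions \<Omega>"
  shows "dir_deriv (\<lambda>x. \<psi> x * \<eta> x) y x = \<psi> x * dir_deriv \<eta> y x + dir_deriv \<psi> y x * \<eta> x"
  by (rule dir_deriv_eqI) (intro has_derivative_mult has_derivative_test_function[OF assms(1)]
      has_derivative_test_function[OF assms(2)])

lemma integration_by_parts:
  assumes \<psi>: "\<psi> \<in> test_functions \<Omega>" and \<eta>: "\<eta> \<in> test_functions \<Omega>"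
  shows "(LINT x|lborel. \<psi> x * dir_deriv \<eta> y x) = - (LINT x|lborel. dir_deriv \<psi> y x * \<eta> x)"
proof -
  have "(LINT x|lborel. dir_deriv (\<lambda>x. \<psi> x * \<eta> x) y x) = 0"
    by (intro integral_dir_deriv_zero[where \<Omega> = \<Omega>] test_function_mult \<eta> test_function_cont_diff[OF \<psi>])
  moreover have "(LINT x|lborel. dir_deriv (\<lambda>x. \<psi> x * \<eta> x) y x)
      = (LINT x|lborel. \<psi> x * dir_deriv \<eta> y x) + (LINT x|lborel. dir_deriv \<psi> y x * \<eta> x)"
    unfolding dir_deriv_mult[OF assms]
    by (intro Bochner_Integration.integral_add square_integrable_mult
        test_function_square_integrable[where \<Omega> = \<Omega>] dir_deriv_test_function assms)
  ultimately show ?thesis by simp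
qed

text \<open>A linear function is a ridge function with the profile chain t, 1, 0, 0, and so
  on.\<close>

lemma cont_diff_inner: "continuously_differentiable k (\<lambda>x::'a::euclidean_space. x \<bullet> v)"
proof -
  have "((\<lambda>t. if j = 0 then t else if j = 1 then 1 else 0) has_real_derivative
      (if Suc j = 0 then t else if Suc j = 1 then 1 else 0)) (at t)" for j :: nat and t :: real
    by (auto intro!: derivative_eq_intros)
  from cont_diff_ridge[of "\<lambda>j t. if j = 0 then t else if j = 1 then 1 else 0", OF this, of k 0 v 0]
  show ?thesis by simp
qed

text \<open>Integrating the derivative of \<open>(x \<bullet> b) \<psi>\<^sup>2\<close> avoids integration along lines.\<close>

lemma poincare_test_function:
  assumes \<psi>: "\<psi> \<in> test_functions \<Omega>" and b: "b \<in> Basis" and R: "\<And>x. x \<in> \<Omega> \<Longrightarrow> norm x \<le> R"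
  shows "norm (to_l2 \<psi>) \<le> 2 * \<bar>R\<bar> * norm (to_l2 (dir_deriv \<psi> b))"
proof -
  define \<eta> where "\<eta> = (\<lambda>x. (x \<bullet> b) * \<psi> x)"
  have \<eta>: "\<eta> \<in> test_functions \<Omega>" unfolding \<eta>_def by (intro test_function_mult cont_diff_inner \<psi>)
  note si = test_function_square_integrable[OF \<psi>] test_function_square_integrable[OF \<eta>]
    test_function_square_integrable[OF dir_deriv_test_function[OF \<psi>, of b]]
    test_function_square_integrable[OF dir_deriv_test_function[OF \<eta>, of b]]
  have der: "dir_deriv \<eta> b x = \<psi> x + (x \<bullet> b) * dir_deriv \<psi> b x" for x
  proof -
    have "(\<eta> has_derivative (\<lambda>h. (x \<bullet> b) * dir_deriv \<psi> h x + (h \<bullet> b) * \<psi> x)) (at x)"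
      unfolding \<eta>_def
      by (rule has_derivative_mult[OF _ has_derivative_test_function[OF \<psi>]])
        (auto intro!: derivative_eq_intros)
    from dir_deriv_eqI[OF this, of b] b show ?thesis by (simp add: inner_same_Basis)
  qed
  \<comment> \<open>Expanding the derivative of \<eta> on the left gives the integral of \<psi>^2
    plus the same integral that stands on the right with a minus sign. Collecting both yields the
    factor 2 of the constant.\<close>
  have "(LINT x|lborel. \<psi> x * dir_deriv \<eta> b x) = - (LINT x|lborel. dir_deriv \<psi> b x * \<eta> x)"
    by (rule integration_by_parts[OF \<psi> \<eta>])
  moreover have "(LINT x|lborel. \<psi> x * dir_deriv \<eta> b x) = (LINT x|lborel. \<psi> x * \<psi> x) + (LINT x|lborel. dir_deriv \<psi> b x * \<eta> x)"
  proof -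
    have "\<psi> x * dir_deriv \<eta> b x = \<psi> x * \<psi> x + dir_deriv \<psi> b x * \<eta> x" for x
      unfolding der by (simp add: \<eta>_def algebra_simps)
    then show ?thesis using si by (simp add: square_integrable_mult)
  qed
  ultimately have eq: "(norm (to_l2 \<psi>))\<^sup>2 = - 2 * (to_l2 (dir_deriv \<psi> b) \<bullet> to_l2 \<eta>)"
    using si by (simp add: power2_norm_eq_inner inner_to_l2_to_l2)
  have le: "norm (to_l2 \<eta>) \<le> \<bar>R\<bar> * norm (to_l2 \<psi>)"
  proof (rule norm_to_l2_le[OF si(1) test_function_measurable[OF \<eta>] abs_ge_zero], rule AE_I2)
    fix x
    show "\<bar>\<eta> x\<bar> \<le> \<bar>R\<bar> * \<bar>\<psi> x\<bar>"
    proof (cases "x \<in> \<Omega>")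
      case True
      have "\<bar>x \<bullet> b\<bar> \<le> norm x" using Basis_le_norm[OF b] .
      also have "\<dots> \<le> \<bar>R\<bar>" using R[OF True] by simp
      finally show ?thesis unfolding \<eta>_def abs_mult by (intro mult_right_mono) auto
    qed (use test_function_outside[OF \<psi>] in \<open>simp add: \<eta>_def\<close>)
  qed
  define n0 n1 n2 where "n0 = norm (to_l2 \<psi>)" "n1 = norm (to_l2 (dir_deriv \<psi> b))" "n2 = norm (to_l2 \<eta>)"
  have "- (to_l2 (dir_deriv \<psi> b) \<bullet> to_l2 \<eta>) \<le> n1 * n2"
    unfolding n0_n1_n2_def by (rule abs_le_D2[OF Cauchy_Schwarz_ineq2])
  with eq have "n0\<^sup>2 \<le> 2 * (n1 * n2)" by (simp add: n0_n1_n2_def(1))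
  also have "\<dots> \<le> 2 * (n1 * (\<bar>R\<bar> * n0))"
    using le by (intro mult_left_mono) (simp_all add: n0_n1_n2_def)
  finally have "n0 * n0 \<le> (2 * \<bar>R\<bar> * n1) * n0" by (simp add: power2_eq_square mult_ac)
  moreover have "0 \<le> n0" "0 \<le> n1" by (simp_all add: n0_n1_n2_def)
  ultimately have "n0 \<le> 2 * \<bar>R\<bar> * n1"
    by (cases "n0 = 0") (auto dest: mult_right_le_imp_le)
  then show ?thesis by (simp add: n0_n1_n2_def)
qed


section \<open>Forms on subspaces\<close>

definition form_norm :: "('x \<Rightarrow> 'x \<Rightarrow> real) \<Rightarrow> 'x \<Rightarrow> real" where
  "form_norm ip x = sqrt (ip x x)"

definition complete_wrt :: "('x::real_vector \<Rightarrow> 'x \<Rightarrow> real) \<Rightarrow> 'x set \<Rightarrow> bool" where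
  "complete_wrt ip M \<longleftrightarrow>
     (\<forall>X. (\<forall>n. X n \<in> M) \<longrightarrow>
        (\<forall>e>0. \<exists>N::nat. \<forall>m\<ge>N. \<forall>n\<ge>N. form_norm ip (X m - X n) < e) \<longrightarrow>
        (\<exists>l\<in>M. (\<lambda>n. form_norm ip (X n - l)) \<longlonglongrightarrow> 0))"

lemma complete_wrtD:
  assumes "complete_wrt ip M" "\<And>n. X n \<in> M"
    "\<And>e. e > 0 \<Longrightarrow> \<exists>N::nat. \<forall>m\<ge>N. \<forall>n\<ge>N. form_norm ip (X m - X n) < e"
  obtains l where "l \<in> M" "(\<lambda>n. form_norm ip (X n - l)) \<longlonglongrightarrow> 0"
  using assms unfolding complete_wrt_def by blast

lemma linear_coefficient_zero:
  fixes c q :: real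
  assumes "\<And>t. 0 \<le> t\<^sup>2 * q - 2 * t * c"
  shows "c = 0"
proof (rule ccontr)
  assume "c \<noteq> 0"
  \<comment> \<open>Any positive Q above q works: at t = c / Q the quadratic is at most - c^2 / Q,
    which is negative.\<close>
  define Q where "Q = \<bar>q\<bar> + 1"
  have Q: "0 < Q" "q < Q" by (auto simp: Q_def)
  have "0 \<le> (c / Q)\<^sup>2 * q - 2 * (c / Q) * c" by (rule assms)
  also have "\<dots> \<le> (c / Q)\<^sup>2 * Q - 2 * (c / Q) * c"
    using Q by (intro diff_right_mono mult_left_mono) auto
  also have "\<dots> = - (c\<^sup>2 / Q)" using Q by (simp add: field_simps power2_eq_square)
  finally have "c\<^sup>2 / Q \<le> 0" by simp
  moreover have "0 < c\<^sup>2 / Q" using Q \<open>c \<noteq> 0\<close> by simp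
  ultimately show False by simp
qed

text \<open>The form may be degenerate, so that two degenerate forms are instances as well: the
  Dirichlet form on \<open>H1 \<Omega>\<close>, which vanishes on functions with zero weak gradient,
  and the form E minus L times the ambient inner product on \<open>high b\<close>, which vanishes at
  a minimizer of the Rayleigh quotient.\<close>

locale semi_inner_space =
  fixes S :: "'x::real_vector set" and ip :: "'x \<Rightarrow> 'x \<Rightarrow> real"
  assumes subspace: "subspace S"
    and sym: "x \<in> S \<Longrightarrow> y \<in> S \<Longrightarrow> ip x y = ip y x"
    and add_left: "x \<in> S \<Longrightarrow> y \<in> S \<Longrightarrow> z \<in> S \<Longrightarrow> ip (x + y) z = ip x z + ip y z"
    and scale_left: "x \<in> S \<Longrightarrow> y \<in> S \<Longrightarrow> ip (c *\<^sub>R x) y = c * ip x y"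
    and nonneg: "x \<in> S \<Longrightarrow> 0 \<le> ip x x"
begin

abbreviation nrm :: "'x \<Rightarrow> real" where "nrm \<equiv> form_norm ip"

lemma mem [simp, intro]:
  "0 \<in> S" "x \<in> S \<Longrightarrow> y \<in> S \<Longrightarrow> x + y \<in> S" "x \<in> S \<Longrightarrow> y \<in> S \<Longrightarrow> x - y \<in> S"
  "x \<in> S \<Longrightarrow> - x \<in> S" "x \<in> S \<Longrightarrow> c *\<^sub>R x \<in> S"
  using subspace by (auto simp: subspace_0 subspace_add subspace_diff subspace_neg subspace_scale)

lemma add_right: "x \<in> S \<Longrightarrow> y \<in> S \<Longrightarrow> z \<in> S \<Longrightarrow> ip z (x + y) = ip z x + ip z y"
  by (simp add: sym[of z] add_left)

lemma scale_right: "x \<in> S \<Longrightarrow> y \<in> S \<Longrightarrow> ip y (c *\<^sub>R x) = c * ip y x"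
  by (simp add: sym[of y] scale_left)

lemma minus_left: "x \<in> S \<Longrightarrow> y \<in> S \<Longrightarrow> ip (- x) y = - ip x y"
  using scale_left[of x y "-1"] by simp

lemma minus_right: "x \<in> S \<Longrightarrow> y \<in> S \<Longrightarrow> ip y (- x) = - ip y x"
  using scale_right[of x y "-1"] by simp

lemma diff_left: "x \<in> S \<Longrightarrow> y \<in> S \<Longrightarrow> z \<in> S \<Longrightarrow> ip (x - y) z = ip x z - ip y z"
  using add_left[of x "- y" z] by (simp add: minus_left)

lemma diff_right: "x \<in> S \<Longrightarrow> y \<in> S \<Longrightarrow> z \<in> S \<Longrightarrow> ip z (x - y) = ip z x - ip z y"
  using add_right[of x "- y" z] by (simp add: minus_right)

lemma zero_left [simp]: "x \<in> S \<Longrightarrow> ip 0 x = 0"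
  using scale_left[of x x 0] by simp

lemma zero_right [simp]: "x \<in> S \<Longrightarrow> ip x 0 = 0"
  using scale_right[of x x 0] by simp

lemmas expand = add_left add_right diff_left diff_right scale_left scale_right minus_left minus_right

lemma sum_mem: "(\<And>i. i \<in> A \<Longrightarrow> g i \<in> S) \<Longrightarrow> (\<Sum>i\<in>A. g i) \<in> S"
  using subspace by (rule subspace_sum)

lemma sum_left: "(\<And>i. i \<in> A \<Longrightarrow> g i \<in> S) \<Longrightarrow> z \<in> S \<Longrightarrow> ip (\<Sum>i\<in>A. g i) z = (\<Sum>i\<in>A. ip (g i) z)"
  by (induction A rule: infinite_finite_induct) (auto simp: add_left sum_mem)

lemma form_diff_scaled:
  assumes "x \<in> S" "y \<in> S"
  shows "ip (x - t *\<^sub>R y) (x - t *\<^sub>R y) = ip x x + t\<^sup>2 * ip y y - 2 * t * ip x y"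
  using assms sym[of x y] by (simp add: expand power2_eq_square algebra_simps)

lemma cauchy_schwarz_sq:
  assumes "x \<in> S" "y \<in> S"
  shows "(ip x y)\<^sup>2 \<le> ip x x * ip y y"
proof -
  have q: "0 \<le> ip x x + t\<^sup>2 * ip y y - 2 * t * ip x y" for t
  proof -
    have "0 \<le> ip (x - t *\<^sub>R y) (x - t *\<^sub>R y)" using assms by (intro nonneg) auto
    also have "\<dots> = ip x x + t\<^sup>2 * ip y y - 2 * t * ip x y"
      using assms by (rule form_diff_scaled)
    finally show ?thesis .
  qed
  show ?thesis
  proof (cases "ip y y = 0")
    case True
    have "ip x y = 0"
    proof (rule ccontr)
      assume "ip x y \<noteq> 0"
      \<comment> \<open>For null y the quadratic in t is affine, and at this t its value is
        -1.\<close>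
      with q[of "(ip x x + 1) / (2 * ip x y)"] True nonneg[OF assms(1)] show False
        by (simp add: field_simps)
    qed
    with True show ?thesis by simp
  next
    case False
    then have pos: "0 < ip y y" using nonneg[OF assms(2)] by simp
    have "0 \<le> ip x x - (ip x y)\<^sup>2 / ip y y"
      using q[of "ip x y / ip y y"] pos by (simp add: field_simps power2_eq_square)
    then show ?thesis using pos by (simp add: field_simps)
  qed
qed

lemma nrm_nonneg [simp]: "x \<in> S \<Longrightarrow> 0 \<le> nrm x"
  by (simp add: form_norm_def nonneg)

lemma nrm_sq: "x \<in> S \<Longrightarrow> (nrm x)\<^sup>2 = ip x x"
  by (simp add: form_norm_def nonneg)

lemma cauchy_schwarz: "x \<in> S \<Longrightarrow> y \<in> S \<Longrightarrow> \<bar>ip x y\<bar> \<le> nrm x * nrm y"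
  using real_sqrt_le_mono[OF cauchy_schwarz_sq[of x y]]
  by (simp add: form_norm_def real_sqrt_mult)

lemma nrm_scale: "x \<in> S \<Longrightarrow> nrm (c *\<^sub>R x) = \<bar>c\<bar> * nrm x"
  by (simp add: form_norm_def expand real_sqrt_mult flip: mult.assoc)

lemma nrm_triangle:
  assumes "x \<in> S" "y \<in> S"
  shows "nrm (x + y) \<le> nrm x + nrm y"
proof (rule power2_le_imp_le)
  have "(nrm (x + y))\<^sup>2 = ip x x + ip y y + 2 * ip x y"
    using assms sym[of x y] by (simp add: nrm_sq expand)
  also have "\<dots> \<le> (nrm x)\<^sup>2 + (nrm y)\<^sup>2 + 2 * (nrm x * nrm y)"
    using assms cauchy_schwarz[of x y] by (simp add: nrm_sq)
  finally show "(nrm (x + y))\<^sup>2 \<le> (nrm x + nrm y)\<^sup>2" by (simp add: power2_sum)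
qed (use assms in auto)

lemma nrm_minus: "x \<in> S \<Longrightarrow> nrm (- x) = nrm x"
  using nrm_scale[of x "-1"] by simp

lemma nrm_diff_commute: "x \<in> S \<Longrightarrow> y \<in> S \<Longrightarrow> nrm (x - y) = nrm (y - x)"
  using nrm_minus[of "x - y"] by simp

lemma nrm_triangle_diff:
  "x \<in> S \<Longrightarrow> y \<in> S \<Longrightarrow> z \<in> S \<Longrightarrow> nrm (x - z) \<le> nrm (x - y) + nrm (y - z)"
  using nrm_triangle[of "x - y" "y - z"] by simp

lemma nrm_zero [simp]: "nrm 0 = 0"
  by (simp add: form_norm_def)

lemma parallelogram:
  assumes "x \<in> S" "y \<in> S"
  shows "ip (x - y) (x - y) = 2 * ip x x + 2 * ip y y - 4 * ip ((1/2) *\<^sub>R (x + y)) ((1/2) *\<^sub>R (x + y))"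
  using assms sym[of x y] by (simp add: expand algebra_simps)

lemma semi_inner_subspace:
  assumes "subspace T" "T \<subseteq> S"
  shows "semi_inner_space T ip"
proof
  show "ip x y = ip y x" if "x \<in> T" "y \<in> T" for x y
    using that assms(2) sym[of x y] by blast
qed (use assms in \<open>simp_all add: subset_iff add_left scale_left nonneg\<close>)

lemma continuous_functional:
  assumes "\<And>n. X n \<in> S" "l \<in> S" "(\<lambda>n. nrm (X n - l)) \<longlonglongrightarrow> 0"
    and g: "\<And>x y. x \<in> S \<Longrightarrow> y \<in> S \<Longrightarrow> g (x - y) = g x - g y"
      "\<And>x. x \<in> S \<Longrightarrow> \<bar>g x\<bar> \<le> K * nrm x"
  shows "(\<lambda>n. g (X n)) \<longlonglongrightarrow> (g l :: real)"
proof -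
  have "(\<lambda>n. g (X n) - g l) \<longlonglongrightarrow> 0"
  proof (rule Lim_null_comparison)
    show "(\<lambda>n. K * nrm (X n - l)) \<longlonglongrightarrow> 0" using assms(3) by (rule tendsto_mult_right_zero)
    show "\<forall>\<^sub>F n in sequentially. norm (g (X n) - g l) \<le> K * nrm (X n - l)"
      using g(2)[of "X n - l" for n] assms(1,2) by (auto simp: g(1))
  qed
  then show ?thesis by (simp add: LIM_zero_iff)
qed

lemma tendsto_ip:
  assumes "\<And>n. X n \<in> S" "l \<in> S" "(\<lambda>n. nrm (X n - l)) \<longlonglongrightarrow> 0" "z \<in> S"
  shows "(\<lambda>n. ip (X n) z) \<longlonglongrightarrow> ip l z"
  using assms(1-3)
  by (rule continuous_functional[where K = "nrm z"])
    (use assms(4) cauchy_schwarz in \<open>auto simp: expand mult.commute\<close>)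

lemma tendsto_nrm:
  assumes "\<And>n. X n \<in> S" "l \<in> S" "(\<lambda>n. nrm (X n - l)) \<longlonglongrightarrow> 0"
  shows "(\<lambda>n. nrm (X n)) \<longlonglongrightarrow> nrm l"
proof -
  have "(\<lambda>n. nrm (X n) - nrm l) \<longlonglongrightarrow> 0"
  proof (rule Lim_null_comparison[OF _ assms(3)], intro always_eventually allI)
    fix n
    show "norm (nrm (X n) - nrm l) \<le> nrm (X n - l)"
      using nrm_triangle[of "X n - l" l] nrm_triangle[of "l - X n" "X n"] assms(1)[of n] assms(2)
        nrm_diff_commute[of "X n" l] by simp
  qed
  then show ?thesis by (simp add: LIM_zero_iff)
qed

lemma orthogonal_complement_complete:
  assumes "complete_wrt ip S" "A \<subseteq> S"
  shows "complete_wrt ip {x \<in> S. \<forall>y\<in>A. ip x y = 0}"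
  unfolding complete_wrt_def
proof (intro allI impI)
  fix X :: "nat \<Rightarrow> 'x"
  assume X: "\<forall>n. X n \<in> {x \<in> S. \<forall>y\<in>A. ip x y = 0}"
    and cau: "\<forall>e>0. \<exists>N. \<forall>m\<ge>N. \<forall>n\<ge>N. nrm (X m - X n) < e"
  have XS: "\<And>n. X n \<in> S" using X by blast
  from complete_wrtD[where X = X, OF assms(1) XS] cau
  obtain l where l: "l \<in> S" "(\<lambda>n. nrm (X n - l)) \<longlonglongrightarrow> 0"
    by blast
  have "ip l y = 0" if "y \<in> A" for y
  proof -
    have "y \<in> S" using that assms(2) by blast
    then have "(\<lambda>n. ip (X n) y) \<longlonglongrightarrow> ip l y"
      by (rule tendsto_ip[OF XS l])
    then show ?thesis using X that by (simp add: LIMSEQ_const_iff)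
  qed
  with l show "\<exists>l\<in>{x \<in> S. \<forall>y\<in>A. ip x y = 0}. (\<lambda>n. nrm (X n - l)) \<longlonglongrightarrow> 0" by auto
qed

lemma orthogonal_complement_subspace:
  assumes "A \<subseteq> S" shows "subspace {x \<in> S. \<forall>y\<in>A. ip x y = 0}"
  using assms by (auto simp: subspace_def subset_iff expand)

text \<open>A minimizing sequence for the distance to M is Cauchy by the parallelogram identity, as
  midpoints stay in M and cannot be closer than D allows. Minimality of the limit along every line m
  + t y makes the first variation vanish, which is orthogonality.\<close>

lemma projection_exists:
  assumes M: "subspace M" "M \<subseteq> S" "complete_wrt ip M" and x: "x \<in> S"
  shows "\<exists>m\<in>M. \<forall>y\<in>M. ip (x - m) y = 0"
proof -
  define D where "D = (INF m\<in>M. ip (x - m) (x - m))"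
  have "0 \<in> M" using M(1) by (rule subspace_0)
  have bdd: "bdd_below ((\<lambda>m. ip (x - m) (x - m)) ` M)"
    using M x by (auto intro!: bdd_belowI[of _ 0] nonneg)
  have D_le: "D \<le> ip (x - m) (x - m)" if "m \<in> M" for m
    unfolding D_def using bdd that by (rule cINF_lower)
  have "\<exists>m\<in>M. ip (x - m) (x - m) < D + 1 / real (Suc n)" for n
  proof (rule ccontr)
    assume "\<not> ?thesis"
    then have "D + 1 / real (Suc n) \<le> D"
      unfolding D_def using \<open>0 \<in> M\<close> by (intro cINF_greatest) (auto simp: not_less)
    then show False by simp
  qed
  then obtain X where X: "X n \<in> M" "ip (x - X n) (x - X n) < D + 1 / real (Suc n)" for n
    by metis
  have XS: "X n \<in> S" for n using X(1) M(2) by auto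
  have cau: "(nrm (X i - X j))\<^sup>2 \<le> 2 / real (Suc i) + 2 / real (Suc j)" for i j
  proof -
    have eq: "(1/2) *\<^sub>R ((x - X j) + (x - X i)) = x - (1/2) *\<^sub>R (X i + X j)"
      by (simp add: algebra_simps flip: scaleR_add_left)
    have "(1/2) *\<^sub>R (X i + X j) \<in> M"
      using M(1) X(1) by (intro subspace_scale subspace_add)
    from D_le[OF this] have "D \<le> ip ((1/2) *\<^sub>R ((x - X j) + (x - X i))) ((1/2) *\<^sub>R ((x - X j) + (x - X i)))"
      unfolding eq .
    with parallelogram[of "x - X j" "x - X i"] X(2)[of i] X(2)[of j] x XS
    show ?thesis by (simp add: nrm_sq)
  qed
  have "\<exists>N. \<forall>m\<ge>N. \<forall>n\<ge>N. nrm (X m - X n) < e" if e: "e > 0" for e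
  proof -
    obtain N where N: "1 / real (Suc N) < e\<^sup>2 / 4"
      using e by (metis nat_approx_posE zero_less_divide_iff zero_less_numeral zero_less_power)
    show ?thesis
    proof (intro exI[of _ N] allI impI)
      fix m n assume mn: "N \<le> m" "N \<le> n"
      then have "1 / real (Suc m) \<le> 1 / real (Suc N)" "1 / real (Suc n) \<le> 1 / real (Suc N)"
        by (auto simp: frac_le)
      with cau[of m n] N have "(nrm (X m - X n))\<^sup>2 < e\<^sup>2" by simp
      then show "nrm (X m - X n) < e" using e by (simp add: power2_less_imp_less)
    qed
  qed
  then obtain m where m: "m \<in> M" "(\<lambda>n. nrm (X n - m)) \<longlonglongrightarrow> 0"
    using complete_wrtD[where X = X, OF M(3) X(1)] by blast
  have mS: "m \<in> S" using m(1) M(2) by auto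
  have "(\<lambda>n. nrm (x - X n)) \<longlonglongrightarrow> nrm (x - m)"
  proof (rule tendsto_nrm)
    have "nrm (x - X n - (x - m)) = nrm (X n - m)" for n
      using XS mS nrm_diff_commute[of "X n" m] by (simp add: algebra_simps)
    then show "(\<lambda>n. nrm (x - X n - (x - m))) \<longlonglongrightarrow> 0" using m(2) by simp
  qed (use x XS mS in auto)
  then have "(\<lambda>n. (nrm (x - X n))\<^sup>2) \<longlonglongrightarrow> (nrm (x - m))\<^sup>2" by (rule tendsto_power)
  then have lim: "(\<lambda>n. ip (x - X n) (x - X n)) \<longlonglongrightarrow> ip (x - m) (x - m)"
    using x XS mS by (simp add: nrm_sq)
  have "(\<lambda>n. D + 1 / real (Suc n)) \<longlonglongrightarrow> D + 0"
    by (intro tendsto_intros LIMSEQ_Suc[OF lim_1_over_n])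
  from LIMSEQ_le[OF lim this] have le: "ip (x - m) (x - m) \<le> D"
    using X(2) by (simp add: less_imp_le)
  have "ip (x - m) y = 0" if y: "y \<in> M" for y
  proof (rule linear_coefficient_zero)
    fix t
    have yS: "y \<in> S" using y M(2) by auto
    have "m + t *\<^sub>R y \<in> M" using M(1) m(1) y by (intro subspace_add subspace_scale)
    from D_le[OF this] le have "ip (x - m) (x - m) \<le> ip ((x - m) - t *\<^sub>R y) ((x - m) - t *\<^sub>R y)"
      by (simp add: algebra_simps)
    also have "\<dots> = ip (x - m) (x - m) + t\<^sup>2 * ip y y - 2 * t * ip (x - m) y"
      using x mS yS by (intro form_diff_scaled) auto
    finally show "0 \<le> t\<^sup>2 * ip y y - 2 * t * ip (x - m) y" by simp
  qed
  with m(1) show ?thesis by blast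
qed

text \<open>The kernel of g is complete because g is continuous, so unless g vanishes some y outside
  the kernel is orthogonal to it. Subtracting a multiple of y moves any z into the kernel, which
  shows that g is a multiple of \<open>ip y\<close>.\<close>

lemma riesz:
  assumes "complete_wrt ip S"
    and add: "\<And>x y. x \<in> S \<Longrightarrow> y \<in> S \<Longrightarrow> g (x + y) = g x + g y"
    and scale: "\<And>c x. x \<in> S \<Longrightarrow> g (c *\<^sub>R x) = c * g x"
    and bnd: "\<And>x. x \<in> S \<Longrightarrow> \<bar>g x\<bar> \<le> K * nrm x"
  shows "\<exists>r\<in>S. \<forall>z\<in>S. g z = (ip r z :: real)"
proof (cases "\<forall>x\<in>S. g x = 0")
  case True
  then show ?thesis by (intro bexI[of _ 0]) auto
next
  case False
  then obtain x where x: "x \<in> S" "g x \<noteq> 0" by auto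
  have diff: "g (x - y) = g x - g y" if "x \<in> S" "y \<in> S" for x y
    using add[of x "- y"] scale[of y "-1"] that by simp
  define M where "M = {x \<in> S. g x = 0}"
  have g0: "g 0 = 0" using scale[of 0 0] by simp
  have M: "subspace M" "M \<subseteq> S"
    by (auto simp: M_def subspace_def add scale g0)
  have "complete_wrt ip M"
    unfolding complete_wrt_def
  proof (intro allI impI)
    fix X :: "nat \<Rightarrow> 'x"
    assume X: "\<forall>n. X n \<in> M" and cau: "\<forall>e>0. \<exists>N. \<forall>m\<ge>N. \<forall>n\<ge>N. nrm (X m - X n) < e"
    have XS: "\<And>n. X n \<in> S" using X M(2) by blast
    from complete_wrtD[where X = X, OF assms(1) XS] cau
    obtain l where l: "l \<in> S" "(\<lambda>n. nrm (X n - l)) \<longlonglongrightarrow> 0" by blast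
    have "(\<lambda>n. g (X n)) \<longlonglongrightarrow> g l"
      using X M(2) l diff bnd by (intro continuous_functional) auto
    then have "g l = 0" using X by (simp add: LIMSEQ_const_iff M_def)
    with l show "\<exists>l\<in>M. (\<lambda>n. nrm (X n - l)) \<longlonglongrightarrow> 0" by (auto simp: M_def)
  qed
  with projection_exists[OF M _ x(1)] obtain m where m: "m \<in> M" "\<And>y. y \<in> M \<Longrightarrow> ip (x - m) y = 0"
    by blast
  define y where "y = x - m"
  have y: "y \<in> S" "g y \<noteq> 0" using x m(1) by (auto simp: y_def M_def diff)
  \<comment> \<open>The form may be degenerate, so that \<open>ip y y\<close> is nonzero is read off
    from the bound on g and not from y being nonzero.\<close>
  have "nrm y \<noteq> 0" using bnd[of y] y by auto
  then have yy: "ip y y \<noteq> 0" by (auto simp: form_norm_def)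
  show ?thesis
  proof (intro bexI[of _ "(g y / ip y y) *\<^sub>R y"] ballI)
    fix z assume z: "z \<in> S"
    have "z - (g z / g y) *\<^sub>R y \<in> M" using y z by (auto simp: M_def diff scale)
    then have "ip y (z - (g z / g y) *\<^sub>R y) = 0" using m(2) by (simp add: y_def)
    then have "ip y z = g z / g y * ip y y" using y z by (simp add: expand)
    then show "g z = ip ((g y / ip y y) *\<^sub>R y) z" using y z yy by (simp add: scale_left)
  qed (use y in auto)
qed

text \<open>The lower bound makes preimages of Cauchy sequences Cauchy, so the range is complete and
  r can be projected onto it. The residual is orthogonal to the range, hence in the kernel of A by
  self-adjointness, and the lower bound makes the kernel trivial.\<close>

lemma selfadjoint_surjective:
  assumes compl: "complete_wrt ip S"
    and definite: "\<And>x. x \<in> S \<Longrightarrow> ip x x = 0 \<Longrightarrow> x = 0"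
    and A: "\<And>x. x \<in> S \<Longrightarrow> A x \<in> S"
    and add: "\<And>x y. x \<in> S \<Longrightarrow> y \<in> S \<Longrightarrow> A (x + y) = A x + A y"
    and scale: "\<And>c x. x \<in> S \<Longrightarrow> A (c *\<^sub>R x) = c *\<^sub>R A x"
    and selfadj: "\<And>x y. x \<in> S \<Longrightarrow> y \<in> S \<Longrightarrow> ip (A x) y = ip x (A y)"
    and upper: "\<And>x. x \<in> S \<Longrightarrow> nrm (A x) \<le> K * nrm x"
    and lower: "\<And>x. x \<in> S \<Longrightarrow> C * nrm x \<le> nrm (A x)" and "C > 0"
    and r: "r \<in> S"
  shows "\<exists>x\<in>S. A x = r"
proof -
  have Adiff: "A (x - y) = A x - A y" if "x \<in> S" "y \<in> S" for x y
    using add[of x "- y"] scale[of y "-1"] that by simp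
  have A0: "A 0 = 0" using scale[of 0 0] by simp
  have M: "subspace (A ` S)" "A ` S \<subseteq> S"
  proof -
    have "A 0 \<in> A ` S" by blast
    then have "0 \<in> A ` S" unfolding A0 .
    then show "subspace (A ` S)"
      using mem(2,5) by (auto intro!: subspaceI simp flip: add scale)
    show "A ` S \<subseteq> S" using A by auto
  qed
  have "complete_wrt ip (A ` S)"
    unfolding complete_wrt_def
  proof (intro allI impI)
    fix Y :: "nat \<Rightarrow> 'x"
    assume YA: "\<forall>n. Y n \<in> A ` S" and Y: "\<forall>e>0. \<exists>N. \<forall>m\<ge>N. \<forall>n\<ge>N. nrm (Y m - Y n) < e"
    define X where "X n = (SOME x. x \<in> S \<and> Y n = A x)" for n
    have "X n \<in> S \<and> Y n = A (X n)" for n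
      unfolding X_def by (rule someI_ex) (use YA in blast)
    then have X: "X n \<in> S" "Y n = A (X n)" for n by auto
    have "\<exists>N. \<forall>m\<ge>N. \<forall>n\<ge>N. nrm (X m - X n) < e" if "e > 0" for e
    proof -
      have "0 < C * e" using \<open>C > 0\<close> that by simp
      with Y obtain N where N: "\<And>m n. m \<ge> N \<Longrightarrow> n \<ge> N \<Longrightarrow> nrm (Y m - Y n) < C * e"
        by blast
      have "C * nrm (X m - X n) < C * e" if "m \<ge> N" "n \<ge> N" for m n
        using lower[of "X m - X n"] N[OF that] X by (simp add: Adiff)
      then show ?thesis using \<open>C > 0\<close> by auto
    qed
    then obtain l where l: "l \<in> S" "(\<lambda>n. nrm (X n - l)) \<longlonglongrightarrow> 0"
      using complete_wrtD[where X = X, OF compl X(1)] by blast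
    have "(\<lambda>n. nrm (Y n - A l)) \<longlonglongrightarrow> 0"
    proof (rule Lim_null_comparison)
      show "(\<lambda>n. K * nrm (X n - l)) \<longlonglongrightarrow> 0" using l(2) by (rule tendsto_mult_right_zero)
      show "\<forall>\<^sub>F n in sequentially. norm (nrm (Y n - A l)) \<le> K * nrm (X n - l)"
        using upper[of "X n - l" for n] X l(1) by (simp add: Adiff A nrm_nonneg)
    qed
    with l(1) show "\<exists>l\<in>A ` S. (\<lambda>n. nrm (Y n - l)) \<longlonglongrightarrow> 0" by blast
  qed
  with projection_exists[OF M _ r] obtain x
    where x: "x \<in> S" and orth: "\<And>y. y \<in> S \<Longrightarrow> ip (r - A x) (A y) = 0"
    by blast
  define z where "z = r - A x"
  have z: "z \<in> S" using r x A by (auto simp: z_def)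
  \<comment> \<open>Orthogonality to the range is used at \<open>A (A z)\<close>, from which one A
    is moved to the other side.\<close>
  have "ip (A z) (A z) = 0"
    using orth[of "A z"] z A selfadj[of z "A z"] by (simp add: z_def)
  then have "nrm (A z) = 0" by (simp add: form_norm_def)
  with lower[OF z] \<open>C > 0\<close> nrm_nonneg[OF z] have "nrm z = 0"
    by (simp add: mult_le_0_iff)
  then have "ip z z = 0" by (simp add: form_norm_def)
  then have "z = 0" using definite z by blast
  then show ?thesis using x by (auto simp: z_def)
qed

end


text \<open>The Dirichlet problem stripped of function spaces: the ambient inner product stands for
  that of \<open>L\<^sup>2\<close>, E for the Dirichlet form, and the eigenvalue equation is weak.
  \<open>eigen_complete\<close> leads from a weak eigenvector found by minimization back to the
  given list \<open>ev\<close>.\<close>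

locale compact_form = semi_inner_space H E
  for H :: "'l::real_inner set" and E :: "'l \<Rightarrow> 'l \<Rightarrow> real" +
  fixes K :: real and ev :: "nat \<Rightarrow> real" and \<phi> :: "nat \<Rightarrow> 'l"
  assumes poincare: "u \<in> H \<Longrightarrow> norm u \<le> K * nrm u"
    and complete: "complete_wrt E H"
    and compact_embedding: "(\<And>n::nat. X n \<in> H) \<Longrightarrow> (\<And>n. nrm (X n) \<le> B) \<Longrightarrow>
      \<exists>r. strict_mono r \<and> Cauchy (X \<circ> (r :: nat \<Rightarrow> nat))"
    and ev_pos: "0 < ev k"
    and eigen_mem: "\<phi> k \<in> H"
    and eigen_nz: "\<phi> k \<noteq> 0"
    and eigen: "z \<in> H \<Longrightarrow> E (\<phi> k) z = ev k * (\<phi> k \<bullet> z)"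
    and eigen_orth: "i \<noteq> j \<Longrightarrow> \<phi> i \<bullet> \<phi> j = 0"
    and eigen_complete: "u \<in> H \<Longrightarrow> (\<And>z. z \<in> H \<Longrightarrow> E u z = \<mu> * (u \<bullet> z)) \<Longrightarrow>
      u \<in> span (\<phi> ` {k. ev k = \<mu>})"
begin

section \<open>Eigenvalues and spectral gaps of a compact form\<close>

lemma definite: "u \<in> H \<Longrightarrow> E u u = 0 \<Longrightarrow> u = 0"
  using poincare[of u] by (simp add: form_norm_def)

lemma eigen_right: "z \<in> H \<Longrightarrow> E z (\<phi> k) = ev k * (z \<bullet> \<phi> k)"
  using eigen[of z k] sym[OF eigen_mem, of z k] by (simp add: inner_commute)

text \<open>Infinitely many normalized eigenvectors with eigenvalues at most b would have bounded
  energy yet mutual distance \<open>sqrt 2\<close>, against the compactness of the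
  embedding.\<close>

lemma finite_eigenvalues_le: "finite {k. ev k \<le> b}"
proof (rule ccontr)
  assume "infinite {k. ev k \<le> b}"
  then obtain s :: "nat \<Rightarrow> nat" where s: "strict_mono s" "\<And>n. ev (s n) \<le> b"
    using infinite_enumerate by blast
  define X where "X n = (1 / norm (\<phi> (s n))) *\<^sub>R \<phi> (s n)" for n
  have XH: "X n \<in> H" for n by (simp add: X_def eigen_mem)
  have "nrm (X n) \<le> sqrt b" for n
  proof -
    have "E (X n) (X n) = 1 / norm (\<phi> (s n)) * (1 / norm (\<phi> (s n)) * (ev (s n) * (norm (\<phi> (s n)))\<^sup>2))"
      by (simp add: X_def scale_left scale_right eigen_mem eigen dot_square_norm)
    also have "\<dots> = ev (s n)"
      using eigen_nz[of "s n"] by (simp add: power2_eq_square)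
    finally have "E (X n) (X n) = ev (s n)" .
    then show ?thesis using s(2) by (simp add: form_norm_def)
  qed
  from compact_embedding[where X = X, OF XH this] obtain r where r: "strict_mono r" "Cauchy (X \<circ> r)" by blast
  have "\<exists>M. \<forall>m\<ge>M. \<forall>n\<ge>M. norm (X (r m) - X (r n)) < 1"
    using CauchyD[OF r(2), of 1] by simp
  then obtain M where M: "\<And>m n. m \<ge> M \<Longrightarrow> n \<ge> M \<Longrightarrow> norm (X (r m) - X (r n)) < 1"
    by blast
  have neq: "s (r M) \<noteq> s (r (Suc M))"
    using strict_monoD[OF s(1) strict_monoD[OF r(1) lessI[of M]]] by simp
  have "(norm (X (r M) - X (r (Suc M))))\<^sup>2 = X (r M) \<bullet> X (r M) + X (r (Suc M)) \<bullet> X (r (Suc M))"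
    using eigen_orth[OF neq] eigen_orth[OF neq[symmetric]]
    by (simp add: power2_norm_eq_inner inner_diff X_def)
  also have "\<dots> = 2"
    using eigen_nz by (simp add: X_def dot_square_norm power2_eq_square)
  finally have eq2: "(norm (X (r M) - X (r (Suc M))))\<^sup>2 = 2" .
  have "norm (X (r M) - X (r (Suc M))) < 1" by (rule M) auto
  then have "(norm (X (r M) - X (r (Suc M))))\<^sup>2 < 1\<^sup>2"
    by (intro power_strict_mono) auto
  with eq2 show False by simp
qed

text \<open>Orthogonality is taken in the ambient inner product. On H it agrees with orthogonality
  in E, since \<open>E u (\<phi> k)\<close> is \<open>u \<bullet> \<phi> k\<close> times the
  positive number \<open>ev k\<close>.\<close>

definition high :: "real \<Rightarrow> 'l set" where
  "high b = {u \<in> H. \<forall>k. ev k \<le> b \<longrightarrow> u \<bullet> \<phi> k = 0}"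

text \<open>For finite N this is the ambient orthogonal projection onto the chosen eigenvectors;
  they are not normalized, hence the denominators.\<close>

definition low_part :: "nat set \<Rightarrow> 'l \<Rightarrow> 'l" where
  "low_part N u = (\<Sum>k\<in>N. ((u \<bullet> \<phi> k) / (\<phi> k \<bullet> \<phi> k)) *\<^sub>R \<phi> k)"

lemma low_part_mem: "low_part N u \<in> H"
  unfolding low_part_def by (intro sum_mem mem eigen_mem)

lemma low_part_inner:
  assumes "finite N"
  shows "low_part N u \<bullet> \<phi> j = (if j \<in> N then u \<bullet> \<phi> j else 0)"
proof -
  have "low_part N u \<bullet> \<phi> j = (\<Sum>k\<in>N. (u \<bullet> \<phi> k) / (\<phi> k \<bullet> \<phi> k) * (\<phi> k \<bullet> \<phi> j))"
    by (simp add: low_part_def inner_sum_left)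
  also have "\<dots> = (\<Sum>k\<in>N. if k = j then u \<bullet> \<phi> j else 0)"
    using eigen_nz eigen_orth by (intro sum.cong) auto
  finally show ?thesis using assms by simp
qed

lemma low_part_form:
  assumes "z \<in> H"
  shows "E (low_part N u) z = (\<Sum>k\<in>N. (u \<bullet> \<phi> k) / (\<phi> k \<bullet> \<phi> k) * (ev k * (\<phi> k \<bullet> z)))"
  unfolding low_part_def using assms
  by (simp add: sum_left eigen_mem scale_left eigen)

lemma high_subspace: "subspace (high b)"
  by (auto simp: high_def subspace_def inner_add_left)

lemma high_subset: "high b \<subseteq> H" by (auto simp: high_def)

text \<open>
  The Rayleigh quotient attains its infimum over the functions orthogonal to the low eigenspaces:
  by the parallelogram identity a minimizing sequence that converges in the ambient norm is a
  Cauchy sequence for the form. A minimizer is an eigenvector.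
\<close>

lemma rayleigh_minimizer:
  assumes "high b \<noteq> {0}"
  obtains u where "u \<in> high b" "norm u = 1" "\<And>z. z \<in> high b \<Longrightarrow> E u u * (z \<bullet> z) \<le> E z z"
proof -
  define U where "U = {u \<in> high b. norm u = 1}"
  define L where "L = (INF u\<in>U. E u u)"
  obtain u0 where u0: "u0 \<in> high b" "u0 \<noteq> 0"
    using assms subspace_0[OF high_subspace] by fastforce
  have "(1 / norm u0) *\<^sub>R u0 \<in> U"
    using u0 subspace_scale[OF high_subspace u0(1)] by (simp add: U_def)
  then have ne: "U \<noteq> {}" by auto
  have UH: "u \<in> H" if "u \<in> U" for u using that high_subset by (auto simp: U_def)
  have bdd: "bdd_below ((\<lambda>u. E u u) ` U)"
    using UH by (auto intro!: bdd_belowI[of _ 0] nonneg)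
  have L_le: "L \<le> E u u" if "u \<in> U" for u
    unfolding L_def using bdd that by (rule cINF_lower)
  have L_nonneg: "0 \<le> L"
    unfolding L_def using ne UH by (intro cINF_greatest nonneg)
  have L_high: "L * (z \<bullet> z) \<le> E z z" if z: "z \<in> high b" for z
  proof (cases "z = 0")
    case False
    have "(1 / norm z) *\<^sub>R z \<in> U"
      using False subspace_scale[OF high_subspace z] by (simp add: U_def)
    from L_le[OF this] have "L \<le> E z z / (norm z)\<^sup>2"
      using z high_subset by (simp add: expand power2_eq_square subset_iff)
    then show ?thesis using False by (simp add: field_simps power2_norm_eq_inner)
  qed (use mem(1) in simp)
  have "\<exists>u\<in>U. E u u < L + 1 / real (Suc n)" for n
  proof (rule ccontr)
    assume "\<not> ?thesis"
    then have "L + 1 / real (Suc n) \<le> L"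
      unfolding L_def using ne by (intro cINF_greatest) (auto simp: not_less)
    then show False by simp
  qed
  then obtain X where X: "X n \<in> U" "E (X n) (X n) < L + 1 / real (Suc n)" for n
    by metis
  have "nrm (X n) \<le> sqrt (L + 1)" for n
  proof -
    have "1 / real (Suc n) \<le> 1" by simp
    then show ?thesis unfolding form_norm_def using X(2)[of n] by (intro real_sqrt_le_mono) linarith
  qed
  with compact_embedding[of X] UH X(1) obtain r where r: "strict_mono r" "Cauchy (X \<circ> r)" by blast
  define Y where "Y = X \<circ> r"
  have Y: "Y n \<in> U" "E (Y n) (Y n) < L + 1 / real (Suc n)" for n
  proof -
    \<comment> \<open>A subsequence satisfies \<open>n \<le> r n\<close>, so it inherits the
      minimizing rate.\<close>
    have "1 / real (Suc (r n)) \<le> 1 / real (Suc n)"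
      using seq_suble[OF r(1), of n] by (intro divide_left_mono) auto
    then show "E (Y n) (Y n) < L + 1 / real (Suc n)" using X(2)[of "r n"] by (simp add: Y_def)
  qed (simp add: Y_def X)
  have YH: "Y n \<in> H" for n using Y(1) UH by blast
  have cau: "(nrm (Y i - Y j))\<^sup>2 \<le> 2 / real (Suc i) + 2 / real (Suc j) + L * (norm (Y i - Y j))\<^sup>2" for i j
  proof -
    have hi: "(1/2) *\<^sub>R (Y i + Y j) \<in> high b"
      using Y(1) by (intro subspace_scale subspace_add high_subspace) (auto simp: U_def)
    have nrm1: "Y i \<bullet> Y i = 1" "Y j \<bullet> Y j = 1"
      using Y(1)[of i] Y(1)[of j] by (simp_all add: U_def norm_eq_1)
    \<comment> \<open>The midpoint of two unit vectors of \<open>high b\<close> lies in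
      \<open>high b\<close>, so its energy is at least L times its squared norm. Inserted into the
      parallelogram identity for E, this leaves the minimizing errors and L times the squared
      ambient distance.\<close>
    have "4 - (norm (Y i - Y j))\<^sup>2 = (Y i + Y j) \<bullet> (Y i + Y j)"
      using nrm1 by (simp add: power2_norm_eq_inner inner_diff_left inner_diff_right
          inner_add_left inner_add_right)
    then have "L * (4 - (norm (Y i - Y j))\<^sup>2) = 4 * (L * (((1/2) *\<^sub>R (Y i + Y j)) \<bullet> ((1/2) *\<^sub>R (Y i + Y j))))"
      by simp
    also have "\<dots> \<le> 4 * E ((1/2) *\<^sub>R (Y i + Y j)) ((1/2) *\<^sub>R (Y i + Y j))"
      using L_high[OF hi] by simp
    finally show ?thesis
      using parallelogram[OF YH YH, of i j] Y(2)[of i] Y(2)[of j] YH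
      by (simp add: nrm_sq algebra_simps)
  qed
  have "\<exists>N. \<forall>m\<ge>N. \<forall>n\<ge>N. nrm (Y m - Y n) < e" if e: "e > 0" for e
  proof -
    \<comment> \<open>The tolerances split \<open>e\<^sup>2\<close> in half: four minimizing errors
      below \<open>e\<^sup>2 / 8\<close>, and L times the square of
      \<open>e / sqrt (2 * (L + 1))\<close>. Using L + 1 guards against L = 0.\<close>
    obtain N1 where N1: "1 / real (Suc N1) < e\<^sup>2 / 8"
      using e by (metis nat_approx_posE zero_less_divide_iff zero_less_numeral zero_less_power)
    have "0 < e / sqrt (2 * (L + 1))" using e L_nonneg by simp
    from CauchyD[OF r(2) this]
    obtain N2 where N2: "\<And>m n. m \<ge> N2 \<Longrightarrow> n \<ge> N2 \<Longrightarrow> norm (Y m - Y n) < e / sqrt (2 * (L + 1))"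
      unfolding Y_def by blast
    show ?thesis
    proof (intro exI[of _ "max N1 N2"] allI impI)
      fix m n assume mn: "max N1 N2 \<le> m" "max N1 N2 \<le> n"
      then have s: "1 / real (Suc m) \<le> 1 / real (Suc N1)" "1 / real (Suc n) \<le> 1 / real (Suc N1)"
        by (auto simp: frac_le)
      have "(norm (Y m - Y n))\<^sup>2 \<le> (e / sqrt (2 * (L + 1)))\<^sup>2"
        using N2[of m n] mn by (intro power_mono) auto
      also have "\<dots> = e\<^sup>2 / (2 * (L + 1))" using L_nonneg by (simp add: power_divide)
      finally have "L * (norm (Y m - Y n))\<^sup>2 \<le> L * (e\<^sup>2 / (2 * (L + 1)))"
        using L_nonneg by (intro mult_left_mono)
      also have "\<dots> \<le> e\<^sup>2 / 2" using L_nonneg by (simp add: field_simps)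
      finally have "(nrm (Y m - Y n))\<^sup>2 < e\<^sup>2" using cau[of m n] s N1 by simp
      then show "nrm (Y m - Y n) < e" using e by (simp add: power2_less_imp_less)
    qed
  qed
  then obtain u where u: "u \<in> H" "(\<lambda>n. nrm (Y n - u)) \<longlonglongrightarrow> 0"
    using complete_wrtD[where X = Y, OF complete YH] by blast
  have "(\<lambda>n. norm (Y n - u)) \<longlonglongrightarrow> 0"
    using poincare[of "Y n - u" for n] YH u
    by (intro Lim_null_comparison[OF _ tendsto_mult_right_zero[OF u(2), of K]]) auto
  then have lim: "Y \<longlonglongrightarrow> u" by (simp add: tendsto_norm_zero_iff LIM_zero_iff)
  have "norm u = 1"
    using LIMSEQ_unique[OF tendsto_norm[OF lim]] Y(1) by (simp add: U_def)
  moreover have "u \<bullet> \<phi> k = 0" if "ev k \<le> b" for k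
  proof -
    have "(\<lambda>n. Y n \<bullet> \<phi> k) \<longlonglongrightarrow> u \<bullet> \<phi> k" by (intro tendsto_inner lim tendsto_const)
    then show ?thesis using Y(1) that by (simp add: U_def high_def LIMSEQ_const_iff)
  qed
  ultimately have uU: "u \<in> U" using u by (simp add: U_def high_def)
  have "(\<lambda>n. (nrm (Y n))\<^sup>2) \<longlonglongrightarrow> (nrm u)\<^sup>2"
    using YH u by (intro tendsto_power tendsto_nrm)
  then have lim2: "(\<lambda>n. E (Y n) (Y n)) \<longlonglongrightarrow> E u u" using YH u by (simp add: nrm_sq)
  have "(\<lambda>n. L + 1 / real (Suc n)) \<longlonglongrightarrow> L + 0"
    by (intro tendsto_intros LIMSEQ_Suc[OF lim_1_over_n])
  from LIMSEQ_le[OF lim2 this] have "E u u \<le> L"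
    using Y(2) by (simp add: less_imp_le)
  with L_le[OF uU] have "E u u = L" by simp
  with that[of u] uU L_high show ?thesis by (auto simp: U_def)
qed

text \<open>The gap beyond b is strict because the infimum is attained. The minimizer u is an
  eigenvector for its Rayleigh value L, so it lies in the span of the listed eigenvectors with
  eigenvalue L; if L \<le> b it would be orthogonal to all of them, hence to itself.\<close>

lemma spectral_gap:
  obtains \<mu> where "\<mu> > b" "\<mu> > 0" "\<And>z. z \<in> high b \<Longrightarrow> \<mu> * (z \<bullet> z) \<le> E z z"
proof (cases "high b = {0}")
  case True
  then show ?thesis using mem(1) by (intro that[of "\<bar>b\<bar> + 1"]) auto
next
  case False
  then obtain u where u: "u \<in> high b" "norm u = 1" "\<And>z. z \<in> high b \<Longrightarrow> E u u * (z \<bullet> z) \<le> E z z"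
    using rayleigh_minimizer by blast
  define L where "L = E u u"
  have uH: "u \<in> H" using u(1) high_subset by blast
  have uu: "u \<bullet> u = 1" using u(2) by (simp add: norm_eq_1)
  have L0: "L > 0"
    using nonneg[OF uH] definite[OF uH] u(2) by (fastforce simp: L_def less_le)
  \<comment> \<open>Minimality says that this form is nonnegative, and u is null for it.
    Cauchy-Schwarz then makes u orthogonal to all of \<open>high b\<close> in this form, which is
    the Euler-Lagrange equation.\<close>
  interpret Q: semi_inner_space "high b" "\<lambda>x y. E x y - L * (x \<bullet> y)"
  proof
    show "subspace (high b)" by (rule high_subspace)
  next
    fix x y assume "x \<in> high b" "y \<in> high b"
    then show "E x y - L * (x \<bullet> y) = E y x - L * (y \<bullet> x)"
      using high_subset sym[of x y] by (auto simp: inner_commute)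
  next
    fix x y z assume "x \<in> high b" "y \<in> high b" "z \<in> high b"
    then have "x \<in> H" "y \<in> H" "z \<in> H" using high_subset by auto
    then show "E (x + y) z - L * ((x + y) \<bullet> z) = E x z - L * (x \<bullet> z) + (E y z - L * (y \<bullet> z))"
      by (simp add: add_left inner_add_left distrib_left)
  next
    fix x y and c :: real assume "x \<in> high b" "y \<in> high b"
    then have "x \<in> H" "y \<in> H" using high_subset by auto
    then show "E (c *\<^sub>R x) y - L * (c *\<^sub>R x \<bullet> y) = c * (E x y - L * (x \<bullet> y))"
      by (simp add: scale_left right_diff_distrib)
  next
    fix x assume "x \<in> high b"
    then show "0 \<le> E x x - L * (x \<bullet> x)" using u(3) by (simp add: L_def)
  qed
  have crit: "E u z = L * (u \<bullet> z)" if z: "z \<in> high b" for z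
    using Q.cauchy_schwarz_sq[OF u(1) z] uu by (simp add: L_def)
  \<comment> \<open>The equation extends from \<open>high b\<close> to H because u is orthogonal, in
    both products, to the finitely many eigenvectors with eigenvalue at most b.\<close>
  have "E u z = L * (u \<bullet> z)" if z: "z \<in> H" for z
  proof -
    define N where "N = {k. ev k \<le> b}"
    have fin: "finite N" unfolding N_def by (rule finite_eigenvalues_le)
    have ul: "u \<bullet> \<phi> k = 0" if "k \<in> N" for k using u(1) that by (simp add: high_def N_def)
    have 0: "u \<bullet> low_part N z = 0"
      using ul by (simp add: low_part_def inner_sum_right)
    have "E u (low_part N z) = E (low_part N z) u"
      by (intro sym uH low_part_mem)
    also have "\<dots> = 0"
      using ul by (simp add: low_part_form[OF uH] inner_commute)
    finally have 1: "E u (low_part N z) = 0" .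
    have "z - low_part N z \<in> high b"
      using z low_part_mem low_part_inner[OF fin] by (auto simp: high_def inner_diff_left N_def)
    from crit[OF this] 0 1 show ?thesis
      using uH z low_part_mem by (simp add: expand inner_diff_right)
  qed
  then have span: "u \<in> span (\<phi> ` {k. ev k = L})" using uH by (intro eigen_complete)
  have "b < L"
  proof (rule ccontr)
    assume "\<not> b < L"
    then have "\<And>y. y \<in> \<phi> ` {k. ev k = L} \<Longrightarrow> u \<bullet> y = 0" using u(1) by (auto simp: high_def)
    then have "u \<bullet> u = 0" using span
      by (metis (mono_tags, lifting) orthogonal_def orthogonal_to_span)
    with uu show False by simp
  qed
  then show ?thesis using that[of L] L0 u(3) by (simp add: L_def)
qed

text \<open>The vector \<open>h2\<close> collects the components with eigenvalue below a. Components
  with eigenvalue in the interval vanish by hypothesis, so the remainder \<open>h1\<close> is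
  orthogonal to every eigenvector with eigenvalue at most b and falls under
  \<open>spectral_gap\<close>.\<close>

lemma gap_decomposition:
  assumes "a \<le> b"
  obtains C where "C > 0"
    "\<And>h. h \<in> H \<Longrightarrow> (\<And>k. ev k \<in> {a..b} \<Longrightarrow> E h (\<phi> k) = 0) \<Longrightarrow>
      \<exists>h1\<in>H. \<exists>h2\<in>H. h = h1 + h2 \<and> E h1 h2 = 0 \<and>
        (\<forall>k. ev k \<in> {a..b} \<longrightarrow> E h1 (\<phi> k) = 0 \<and> E h2 (\<phi> k) = 0) \<and>
        C * E h1 h1 \<le> E h1 h1 - b * (h1 \<bullet> h1) \<and> C * E h2 h2 \<le> a * (h2 \<bullet> h2) - E h2 h2"
proof -
  obtain \<mu> where \<mu>: "\<mu> > b" "\<mu> > 0" "\<And>z. z \<in> high b \<Longrightarrow> \<mu> * (z \<bullet> z) \<le> E z z"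
    using spectral_gap[of b] by blast
  define N where "N = {k. ev k < a}"
  have fin: "finite N"
    unfolding N_def by (rule finite_subset[OF _ finite_eigenvalues_le[of a]]) auto
  \<comment> \<open>The largest eigenvalue below a. If there is none, the value 1 is a placeholder
    that keeps \<nu> positive.\<close>
  define \<nu> where "\<nu> = (if N = {} then 1 else Max (ev ` N))"
  have \<nu>: "\<nu> > 0" "N \<noteq> {} \<Longrightarrow> \<nu> < a" "\<And>k. k \<in> N \<Longrightarrow> ev k \<le> \<nu>"
  proof -
    show "k \<in> N \<Longrightarrow> ev k \<le> \<nu>" for k using fin by (auto simp: \<nu>_def)
    have *: "N \<noteq> {} \<Longrightarrow> \<nu> \<in> ev ` N" using fin by (simp add: \<nu>_def del: Max_in) (intro Max_in, auto)
    then show "N \<noteq> {} \<Longrightarrow> \<nu> < a" by (auto simp: N_def)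
    show "\<nu> > 0" using * ev_pos by (cases "N = {}") (auto simp: \<nu>_def)
  qed
  define C1 where "C1 = (if b \<ge> 0 then 1 - b / \<mu> else 1)"
  define C2 where "C2 = (if N = {} then 1 else a / \<nu> - 1)"
  define C where "C = min C1 C2"
  have C: "C > 0" "C \<le> C1" "C \<le> C2"
    using \<mu> \<nu> by (auto simp: C_def C1_def C2_def field_simps)
  show ?thesis
  proof (rule that[OF C(1)])
    fix h assume h: "h \<in> H" "\<And>k. ev k \<in> {a..b} \<Longrightarrow> E h (\<phi> k) = 0"
    define h2 where "h2 = low_part N h"
    define h1 where "h1 = h - h2"
    have h2: "h2 \<in> H" by (simp add: h2_def low_part_mem)
    have h1: "h1 \<in> H" using h(1) h2 by (simp add: h1_def)
    have in2: "h2 \<bullet> \<phi> k = (if k \<in> N then h \<bullet> \<phi> k else 0)" for k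
      unfolding h2_def by (rule low_part_inner[OF fin])
    have h0: "h \<bullet> \<phi> k = 0" if "ev k \<in> {a..b}" for k
      using h(2)[OF that] ev_pos[of k] eigen_right[OF h(1), of k] by simp
    have in1: "h1 \<bullet> \<phi> k = 0" if "ev k \<le> b" for k
      using h0[of k] that in2[of k] by (auto simp: h1_def inner_diff_left N_def not_less)
    have h1_high: "h1 \<in> high b" using h1 in1 by (simp add: high_def)
    have N_le: "ev k \<le> b" if "k \<in> N" for k using that assms by (simp add: N_def)
    have "E h1 h2 = E h2 h1" using h1 h2 by (rule sym)
    also have "\<dots> = 0"
      using in1 N_le by (simp add: h2_def low_part_form[OF h1] inner_commute)
    finally have orth: "E h1 h2 = 0" .
    have perp: "E h1 (\<phi> k) = 0 \<and> E h2 (\<phi> k) = 0" if "ev k \<in> {a..b}" for k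
      using that in1[of k] in2[of k] by (simp add: eigen_right h1 h2 N_def)
    have E1: "0 \<le> E h1 h1" and E2: "0 \<le> E h2 h2" using h1 h2 by (auto intro: nonneg)
    have "C * E h1 h1 \<le> C1 * E h1 h1" using C E1 by (intro mult_right_mono)
    also have "\<dots> \<le> E h1 h1 - b * (h1 \<bullet> h1)"
    proof (cases "b \<ge> 0")
      case True
      have "b / \<mu> * (\<mu> * (h1 \<bullet> h1)) \<le> b / \<mu> * E h1 h1"
        using \<mu>(3)[OF h1_high] True \<mu>(2) by (intro mult_left_mono) auto
      then show ?thesis using True \<mu>(2) by (simp add: C1_def algebra_simps)
    qed (simp add: C1_def mult_nonpos_nonneg)
    finally have c1: "C * E h1 h1 \<le> E h1 h1 - b * (h1 \<bullet> h1)" .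
    have "C * E h2 h2 \<le> C2 * E h2 h2" using C E2 by (intro mult_right_mono)
    also have "\<dots> \<le> a * (h2 \<bullet> h2) - E h2 h2"
    proof (cases "N = {}")
      case True
      then show ?thesis using mem(1) by (simp add: h2_def low_part_def)
    next
      case False
      have "E h2 h2 = (\<Sum>k\<in>N. (h \<bullet> \<phi> k) / (\<phi> k \<bullet> \<phi> k) * (ev k * (\<phi> k \<bullet> h2)))"
        using low_part_form[OF h2, of N h] by (simp add: h2_def)
      also have "\<dots> = (\<Sum>k\<in>N. ev k * ((h \<bullet> \<phi> k)\<^sup>2 / (\<phi> k \<bullet> \<phi> k)))"
        using in2 by (intro sum.cong) (auto simp: inner_commute[of _ h2] power2_eq_square)
      also have "\<dots> \<le> (\<Sum>k\<in>N. \<nu> * ((h \<bullet> \<phi> k)\<^sup>2 / (\<phi> k \<bullet> \<phi> k)))"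
        using \<nu>(3) by (intro sum_mono mult_right_mono) auto
      also have "\<dots> = \<nu> * (\<Sum>k\<in>N. (h \<bullet> \<phi> k) / (\<phi> k \<bullet> \<phi> k) * (\<phi> k \<bullet> h2))"
        unfolding sum_distrib_left using in2
        by (intro sum.cong) (auto simp: inner_commute[of _ h2] power2_eq_square)
      also have "(\<Sum>k\<in>N. (h \<bullet> \<phi> k) / (\<phi> k \<bullet> \<phi> k) * (\<phi> k \<bullet> h2)) = h2 \<bullet> h2"
        by (simp add: h2_def[unfolded low_part_def] inner_sum_left)
      finally have "E h2 h2 \<le> \<nu> * (h2 \<bullet> h2)" .
      then have "a / \<nu> * E h2 h2 \<le> a / \<nu> * (\<nu> * (h2 \<bullet> h2))"
        using \<nu>(1,2) False by (intro mult_left_mono) auto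
      then show ?thesis using False \<nu>(1) by (simp add: C2_def algebra_simps)
    qed
    finally have c2: "C * E h2 h2 \<le> a * (h2 \<bullet> h2) - E h2 h2" .
    show "\<exists>h1\<in>H. \<exists>h2\<in>H. h = h1 + h2 \<and> E h1 h2 = 0 \<and>
        (\<forall>k. ev k \<in> {a..b} \<longrightarrow> E h1 (\<phi> k) = 0 \<and> E h2 (\<phi> k) = 0) \<and>
        C * E h1 h1 \<le> E h1 h1 - b * (h1 \<bullet> h1) \<and> C * E h2 h2 \<le> a * (h2 \<bullet> h2) - E h2 h2"
      using h1 h2 orth perp c1 c2 by (intro bexI[of _ h1] bexI[of _ h2]) (auto simp: h1_def)
  qed
qed

text \<open>
  Testing \<open>E - m\<close> at \<open>h = h\<^sub>1 + h\<^sub>2\<close> against the reflected vector \<open>h\<^sub>1 - h\<^sub>2\<close> cancels the cross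
  terms, as \<open>m\<close> is symmetric.
\<close>

lemma reflected_coercivity:
  assumes "a \<le> b"
  obtains C where "C > 0"
    "\<And>h m. h \<in> H \<Longrightarrow> (\<And>k. ev k \<in> {a..b} \<Longrightarrow> E h (\<phi> k) = 0) \<Longrightarrow>
      (\<And>x y z. m (x + y) z = m x z + m y z) \<Longrightarrow> (\<And>x y. m x y = m y x) \<Longrightarrow>
      (\<And>u. u \<in> H \<Longrightarrow> a * (u \<bullet> u) \<le> m u u) \<Longrightarrow> (\<And>u. u \<in> H \<Longrightarrow> m u u \<le> b * (u \<bullet> u)) \<Longrightarrow>
      \<exists>z\<in>H. (\<forall>k. ev k \<in> {a..b} \<longrightarrow> E z (\<phi> k) = 0) \<and> nrm z = nrm h \<and>
        C * (nrm h)\<^sup>2 \<le> E h z - (m h z :: real)"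
proof (rule gap_decomposition[OF assms])
  fix C :: real
  assume C: "C > 0"
    "\<And>h. h \<in> H \<Longrightarrow> (\<And>k. ev k \<in> {a..b} \<Longrightarrow> E h (\<phi> k) = 0) \<Longrightarrow>
      \<exists>h1\<in>H. \<exists>h2\<in>H. h = h1 + h2 \<and> E h1 h2 = 0 \<and>
        (\<forall>k. ev k \<in> {a..b} \<longrightarrow> E h1 (\<phi> k) = 0 \<and> E h2 (\<phi> k) = 0) \<and>
        C * E h1 h1 \<le> E h1 h1 - b * (h1 \<bullet> h1) \<and> C * E h2 h2 \<le> a * (h2 \<bullet> h2) - E h2 h2"
  show ?thesis
  proof (rule that[OF C(1)])
    fix h :: 'l and m :: "'l \<Rightarrow> 'l \<Rightarrow> real"
    assume h: "h \<in> H" "\<And>k. ev k \<in> {a..b} \<Longrightarrow> E h (\<phi> k) = 0"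
      and m: "\<And>x y z. m (x + y) z = m x z + m y z" "\<And>x y. m x y = m y x"
        "\<And>u. u \<in> H \<Longrightarrow> a * (u \<bullet> u) \<le> m u u" "\<And>u. u \<in> H \<Longrightarrow> m u u \<le> b * (u \<bullet> u)"
    obtain h1 h2 where d: "h1 \<in> H" "h2 \<in> H" "h = h1 + h2" "E h1 h2 = 0"
        "\<And>k. ev k \<in> {a..b} \<Longrightarrow> E h1 (\<phi> k) = 0 \<and> E h2 (\<phi> k) = 0"
        "C * E h1 h1 \<le> E h1 h1 - b * (h1 \<bullet> h1)" "C * E h2 h2 \<le> a * (h2 \<bullet> h2) - E h2 h2"
      using C(2)[OF h] by blast
    have d': "E h2 h1 = 0" using d(1,2,4) sym by metis
    have mr: "m z (x + y) = m z x + m z y" for x y z using m(1,2) by metis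
    have mdiff: "m z (x - y) = m z x - m z y" for x y z using mr[of z "x - y" y] by simp
    have "C * (nrm h)\<^sup>2 = C * E h1 h1 + C * E h2 h2"
      using d(1-4) d' by (simp add: nrm_sq expand algebra_simps)
    \<comment> \<open>The upper bound on m is spent on \<open>h1\<close>, the lower bound on
      \<open>h2\<close>.\<close>
    also have "\<dots> \<le> (E h1 h1 - m h1 h1) - (E h2 h2 - m h2 h2)"
      using d(6,7) m(3)[OF d(2)] m(4)[OF d(1)] by simp
    also have "\<dots> = E h (h1 - h2) - m h (h1 - h2)"
      using d(1-4) d' m(2)[of h1 h2] by (simp add: expand m(1) mdiff)
    finally have "C * (nrm h)\<^sup>2 \<le> E h (h1 - h2) - m h (h1 - h2)" .
    moreover have "nrm (h1 - h2) = nrm h"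
      using d(1-4) d' by (simp add: form_norm_def expand)
    ultimately show "\<exists>z\<in>H. (\<forall>k. ev k \<in> {a..b} \<longrightarrow> E z (\<phi> k) = 0) \<and> nrm z = nrm h \<and>
        C * (nrm h)\<^sup>2 \<le> E h z - m h z"
      using d by (intro bexI[of _ "h1 - h2"]) (auto simp: diff_left eigen_mem)
  qed
qed

end


section \<open>Sobolev spaces\<close>

lemma inner_to_l2_test:
  "\<psi> \<in> test_functions \<Omega> \<Longrightarrow> u \<bullet> to_l2 \<psi> = (LINT x|lborel. l2_fun u x * \<psi> x)"
  by (intro inner_to_l2 test_function_square_integrable)

text \<open>Written with \<open>L\<^sup>2\<close> inner products, the identity visibly survives
  linear combinations and limits.\<close>

lemma is_weak_pderiv_iff:
  "is_weak_pderiv \<Omega> b u g \<longleftrightarrow> g \<in> L2_space \<Omega> \<and>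
     (\<forall>\<psi>\<in>test_functions \<Omega>. u \<bullet> to_l2 (dir_deriv \<psi> b) = - (g \<bullet> to_l2 \<psi>))"
proof -
  have "u \<bullet> to_l2 (dir_deriv \<psi> b) = (LINT x|lborel. l2_fun u x * frechet_derivative \<psi> (at x) b)"
    if "\<psi> \<in> test_functions \<Omega>" for \<psi>
    using inner_to_l2_test[OF dir_deriv_test_function[OF that]] by (simp add: dir_deriv_def[abs_def])
  then show ?thesis by (simp add: is_weak_pderiv_def inner_to_l2_test)
qed

lemma L2_space_subspace: "subspace (L2_space \<Omega>)"
proof (rule subspaceI)
  show "0 \<in> L2_space \<Omega>"
    using l2_fun_zero by (auto simp: L2_space_def)
  show "u + v \<in> L2_space \<Omega>" if "u \<in> L2_space \<Omega>" "v \<in> L2_space \<Omega>" for u v :: "'a l2"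
    using that l2_fun_add[of u v] unfolding L2_space_def mem_Collect_eq
    by eventually_elim simp
  show "c *\<^sub>R u \<in> L2_space \<Omega>" if "u \<in> L2_space \<Omega>" for c and u :: "'a l2"
    using that l2_fun_scaleR[of c u] unfolding L2_space_def mem_Collect_eq
    by eventually_elim simp
qed

lemma L2_space_closed:
  assumes "\<And>n::nat. X n \<in> L2_space \<Omega>" "X \<longlonglongrightarrow> u"
  shows "u \<in> L2_space \<Omega>"
proof -
  obtain r :: "nat \<Rightarrow> nat" where "AE x in lborel. (\<lambda>n. l2_fun (X (r n)) x) \<longlonglongrightarrow> l2_fun u x"
    using l2_tendsto_subseq_AE[OF assms(2)] by blast
  moreover have "AE x in lborel. \<forall>n. x \<notin> \<Omega> \<longrightarrow> l2_fun (X (r n)) x = 0"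
    unfolding AE_all_countable using assms(1) by (simp add: L2_space_def)
  ultimately show ?thesis
    unfolding L2_space_def mem_Collect_eq by eventually_elim (auto simp: LIMSEQ_const_iff)
qed

lemma test_function_L2_space: "\<psi> \<in> test_functions \<Omega> \<Longrightarrow> to_l2 \<psi> \<in> L2_space \<Omega>"
  using l2_fun_to_l2[OF test_function_square_integrable, of \<psi> \<Omega>] test_function_outside[of \<psi> \<Omega>]
  by (auto simp: L2_space_def elim!: eventually_mono)

section \<open>Weak derivatives and \<open>H\<^sup>1\<^sub>0\<close> on an open set\<close>

locale open_domain =
  fixes \<Omega> :: "'a::euclidean_space set"
  assumes open_dom: "open \<Omega>"
begin

text \<open>Test functions determine a weak derivative only on \<Omega>; the clause of
  \<open>is_weak_pderiv\<close> that it vanish outside settles the rest and makes the definite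
  description in \<open>weak_pderiv\<close> meaningful.\<close>

lemma weak_pderiv_unique:
  assumes "is_weak_pderiv \<Omega> b u g" "is_weak_pderiv \<Omega> b u g'"
  shows "g = g'"
proof -
  have "g - g' = 0"
  proof (rule fundamental_lemma[OF open_dom])
    show "g - g' \<in> L2_space \<Omega>"
      using assms L2_space_subspace by (auto simp: is_weak_pderiv_iff intro: subspace_diff)
    show "(LINT x|lborel. l2_fun (g - g') x * \<psi> x) = 0" if "\<psi> \<in> test_functions \<Omega>" for \<psi>
    proof -
      have "- (g \<bullet> to_l2 \<psi>) = - (g' \<bullet> to_l2 \<psi>)"
        using assms that by (metis is_weak_pderiv_iff)
      then show ?thesis using that by (simp add: inner_to_l2_test[symmetric] inner_diff_left)
    qed
  qed
  then show ?thesis by simp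
qed

lemma weak_pderivI: "is_weak_pderiv \<Omega> b u g \<Longrightarrow> weak_pderiv \<Omega> b u = g"
  unfolding weak_pderiv_def by (rule the_equality) (auto intro: weak_pderiv_unique)

lemma weak_pderiv_works: "u \<in> H1 \<Omega> \<Longrightarrow> b \<in> Basis \<Longrightarrow> is_weak_pderiv \<Omega> b u (weak_pderiv \<Omega> b u)"
  using weak_pderivI by (fastforce simp: H1_def)

lemma H1I: "u \<in> L2_space \<Omega> \<Longrightarrow> (\<And>b. b \<in> Basis \<Longrightarrow> is_weak_pderiv \<Omega> b u (G b)) \<Longrightarrow> u \<in> H1 \<Omega>"
  by (auto simp: H1_def)

lemma is_weak_pderiv_add:
  "is_weak_pderiv \<Omega> b u g \<Longrightarrow> is_weak_pderiv \<Omega> b v h \<Longrightarrow> is_weak_pderiv \<Omega> b (u + v) (g + h)"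
  using L2_space_subspace by (auto simp: is_weak_pderiv_iff inner_add_left intro: subspace_add)

lemma is_weak_pderiv_scaleR:
  "is_weak_pderiv \<Omega> b u g \<Longrightarrow> is_weak_pderiv \<Omega> b (c *\<^sub>R u) (c *\<^sub>R g)"
  using L2_space_subspace by (auto simp: is_weak_pderiv_iff intro: subspace_scale)

lemma H1_subspace: "subspace (H1 \<Omega>)"
proof (rule subspaceI)
  have "is_weak_pderiv \<Omega> b 0 0" for b
    using subspace_0[OF L2_space_subspace] by (simp add: is_weak_pderiv_iff)
  then show "0 \<in> H1 \<Omega>" using subspace_0[OF L2_space_subspace] by (auto simp: H1_def)
  show "u + v \<in> H1 \<Omega>" if "u \<in> H1 \<Omega>" "v \<in> H1 \<Omega>" for u v
    using that subspace_add[OF L2_space_subspace] is_weak_pderiv_add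
    unfolding H1_def by blast
  show "c *\<^sub>R u \<in> H1 \<Omega>" if "u \<in> H1 \<Omega>" for c u
    using that subspace_scale[OF L2_space_subspace] is_weak_pderiv_scaleR
    unfolding H1_def by blast
qed

lemma weak_pderiv_add:
  "u \<in> H1 \<Omega> \<Longrightarrow> v \<in> H1 \<Omega> \<Longrightarrow> b \<in> Basis \<Longrightarrow>
   weak_pderiv \<Omega> b (u + v) = weak_pderiv \<Omega> b u + weak_pderiv \<Omega> b v"
  by (intro weak_pderivI is_weak_pderiv_add weak_pderiv_works)

lemma weak_pderiv_scaleR:
  "u \<in> H1 \<Omega> \<Longrightarrow> b \<in> Basis \<Longrightarrow> weak_pderiv \<Omega> b (c *\<^sub>R u) = c *\<^sub>R weak_pderiv \<Omega> b u"
  by (intro weak_pderivI is_weak_pderiv_scaleR weak_pderiv_works)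

lemma weak_pderiv_diff:
  "u \<in> H1 \<Omega> \<Longrightarrow> v \<in> H1 \<Omega> \<Longrightarrow> b \<in> Basis \<Longrightarrow>
   weak_pderiv \<Omega> b (u - v) = weak_pderiv \<Omega> b u - weak_pderiv \<Omega> b v"
  using weak_pderiv_add[of u "(-1) *\<^sub>R v" b] weak_pderiv_scaleR[of v b "-1"]
    subspace_scale[OF H1_subspace, of v "-1"] by simp

sublocale H1: semi_inner_space "H1 \<Omega>" "h1_inner \<Omega>"
proof
  show "subspace (H1 \<Omega>)" by (rule H1_subspace)
  show "h1_inner \<Omega> u v = h1_inner \<Omega> v u" for u v :: "'a l2"
    by (simp add: h1_inner_def inner_commute)
qed (auto simp: h1_inner_def weak_pderiv_add weak_pderiv_scaleR inner_add_left
    sum.distrib sum_distrib_left intro!: sum_nonneg)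

lemma h1_norm_eq: "h1_norm \<Omega> = form_norm (h1_inner \<Omega>)"
  by (simp add: fun_eq_iff h1_norm_def form_norm_def)

lemma is_weak_pderiv_test_function:
  assumes "\<psi> \<in> test_functions \<Omega>"
  shows "is_weak_pderiv \<Omega> b (to_l2 \<psi>) (to_l2 (dir_deriv \<psi> b))"
  unfolding is_weak_pderiv_iff
proof (intro conjI ballI)
  show "to_l2 (dir_deriv \<psi> b) \<in> L2_space \<Omega>" by (intro test_function_L2_space dir_deriv_test_function assms)
  fix \<eta> assume \<eta>: "\<eta> \<in> test_functions \<Omega>"
  show "to_l2 \<psi> \<bullet> to_l2 (dir_deriv \<eta> b) = - (to_l2 (dir_deriv \<psi> b) \<bullet> to_l2 \<eta>)"
    using integration_by_parts[OF assms \<eta>]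
    by (simp add: inner_to_l2_to_l2 test_function_square_integrable[OF assms] test_function_square_integrable[OF \<eta>]
        test_function_square_integrable[OF dir_deriv_test_function[OF assms]]
        test_function_square_integrable[OF dir_deriv_test_function[OF \<eta>]])
qed

lemma weak_pderiv_test_function:
  "\<psi> \<in> test_functions \<Omega> \<Longrightarrow> weak_pderiv \<Omega> b (to_l2 \<psi>) = to_l2 (dir_deriv \<psi> b)"
  by (intro weak_pderivI is_weak_pderiv_test_function)

lemma test_function_H1: "\<psi> \<in> test_functions \<Omega> \<Longrightarrow> to_l2 \<psi> \<in> H1 \<Omega>"
  by (rule H1I[where G = "\<lambda>b. to_l2 (dir_deriv \<psi> b)"])
    (auto intro: test_function_L2_space is_weak_pderiv_test_function)

lemma norm_weak_pderiv_le: "u \<in> H1 \<Omega> \<Longrightarrow> b \<in> Basis \<Longrightarrow> norm (weak_pderiv \<Omega> b u) \<le> h1_norm \<Omega> u"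
proof -
  assume b: "b \<in> Basis"
  have "(norm (weak_pderiv \<Omega> b u))\<^sup>2 \<le> h1_inner \<Omega> u u"
    unfolding h1_inner_def power2_norm_eq_inner
    using b member_le_sum[of b Basis "\<lambda>b. weak_pderiv \<Omega> b u \<bullet> weak_pderiv \<Omega> b u"] by simp
  then show ?thesis unfolding h1_norm_def by (rule real_le_rsqrt)
qed

lemma full_H1_norm_le: "u \<in> H1 \<Omega> \<Longrightarrow> full_H1_norm \<Omega> u \<le> norm u + h1_norm \<Omega> u"
  using sqrt_add_le_add_sqrt[of "(norm u)\<^sup>2" "h1_inner \<Omega> u u"] H1.nonneg[of u]
  by (simp add: full_H1_norm_def h1_norm_def)

lemma le_full_H1_norm:
  assumes "u \<in> H1 \<Omega>"
  shows "norm u \<le> full_H1_norm \<Omega> u" "h1_norm \<Omega> u \<le> full_H1_norm \<Omega> u"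
  unfolding full_H1_norm_def h1_norm_def
  using H1.nonneg[OF assms] by (auto intro: real_le_rsqrt)

lemma H10_iff:
  "u \<in> H10 \<Omega> \<longleftrightarrow> u \<in> H1 \<Omega> \<and>
     (\<forall>e>0. \<exists>\<psi>\<in>test_functions \<Omega>. norm (u - to_l2 \<psi>) < e \<and> h1_norm \<Omega> (u - to_l2 \<psi>) < e)"
  (is "?L \<longleftrightarrow> _ \<and> ?R")
proof (cases "u \<in> H1 \<Omega>")
  case u: True
  have 1: "norm (u - to_l2 \<psi>) < e \<and> h1_norm \<Omega> (u - to_l2 \<psi>) < e"
    if "\<psi> \<in> test_functions \<Omega>" "full_H1_norm \<Omega> (u - to_l2 \<psi>) < e" for \<psi> e
    using le_full_H1_norm[OF H1.mem(3)[OF u test_function_H1[OF that(1)]]] that(2) by linarith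
  have 2: "full_H1_norm \<Omega> (u - to_l2 \<psi>) < e"
    if "\<psi> \<in> test_functions \<Omega>" "norm (u - to_l2 \<psi>) < e / 2" "h1_norm \<Omega> (u - to_l2 \<psi>) < e / 2" for \<psi> e
    using full_H1_norm_le[OF H1.mem(3)[OF u test_function_H1[OF that(1)]]] that(2,3) by linarith
  have "?L \<longleftrightarrow> (\<forall>e>0. \<exists>\<psi>\<in>test_functions \<Omega>. full_H1_norm \<Omega> (u - to_l2 \<psi>) < e)"
    using u by (simp add: H10_def)
  also have "\<dots> \<longleftrightarrow> ?R"
  proof
    assume "\<forall>e>0. \<exists>\<psi>\<in>test_functions \<Omega>. full_H1_norm \<Omega> (u - to_l2 \<psi>) < e"
    then show ?R using 1 by meson
  next
    assume R: ?R
    show "\<forall>e>0. \<exists>\<psi>\<in>test_functions \<Omega>. full_H1_norm \<Omega> (u - to_l2 \<psi>) < e"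
    proof (intro allI impI)
      fix e :: real assume "e > 0"
      then have "e / 2 > 0" by simp
      with R obtain \<psi> where "\<psi> \<in> test_functions \<Omega>"
        "norm (u - to_l2 \<psi>) < e / 2" "h1_norm \<Omega> (u - to_l2 \<psi>) < e / 2" by blast
      with 2 show "\<exists>\<psi>\<in>test_functions \<Omega>. full_H1_norm \<Omega> (u - to_l2 \<psi>) < e" by blast
    qed
  qed
  finally show ?thesis using u by simp
qed (simp add: H10_def)

lemma H10_approx:
  assumes "u \<in> H10 \<Omega>" "e > 0"
  obtains \<psi> where "\<psi> \<in> test_functions \<Omega>" "norm (u - to_l2 \<psi>) < e" "h1_norm \<Omega> (u - to_l2 \<psi>) < e"
  using assms unfolding H10_iff by blast

lemma H10_H1: "u \<in> H10 \<Omega> \<Longrightarrow> u \<in> H1 \<Omega>"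
  by (simp add: H10_def)

lemma H10I_approx:
  assumes u: "u \<in> H1 \<Omega>"
    and approx: "\<And>e. e > 0 \<Longrightarrow> \<exists>v\<in>H10 \<Omega>. norm (u - v) < e \<and> h1_norm \<Omega> (u - v) < e"
  shows "u \<in> H10 \<Omega>"
  unfolding H10_iff
proof (intro conjI u allI impI)
  fix e :: real assume "e > 0"
  then have e: "e / 2 > 0" by simp
  from approx[OF e] obtain v where v: "v \<in> H10 \<Omega>" "norm (u - v) < e / 2" "h1_norm \<Omega> (u - v) < e / 2"
    by blast
  obtain \<psi> where \<psi>: "\<psi> \<in> test_functions \<Omega>" "norm (v - to_l2 \<psi>) < e / 2" "h1_norm \<Omega> (v - to_l2 \<psi>) < e / 2"
    using H10_approx[OF v(1) e] by blast
  have "norm (u - to_l2 \<psi>) \<le> norm (u - v) + norm (v - to_l2 \<psi>)"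
    using norm_triangle_ineq[of "u - v" "v - to_l2 \<psi>"] by simp
  moreover have "h1_norm \<Omega> (u - to_l2 \<psi>) \<le> h1_norm \<Omega> (u - v) + h1_norm \<Omega> (v - to_l2 \<psi>)"
    unfolding h1_norm_eq by (intro H1.nrm_triangle_diff u H10_H1 v test_function_H1 \<psi>)
  ultimately show "\<exists>\<psi>\<in>test_functions \<Omega>. norm (u - to_l2 \<psi>) < e \<and> h1_norm \<Omega> (u - to_l2 \<psi>) < e"
    using v \<psi> by (intro bexI[of _ \<psi>]) auto
qed

lemma test_function_H10: "\<psi> \<in> test_functions \<Omega> \<Longrightarrow> to_l2 \<psi> \<in> H10 \<Omega>"
  unfolding H10_iff by (auto simp: test_function_H1 h1_norm_eq intro!: bexI[of _ \<psi>])

lemma to_l2_test_add: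
  "\<psi> \<in> test_functions \<Omega> \<Longrightarrow> \<eta> \<in> test_functions \<Omega> \<Longrightarrow> to_l2 (\<lambda>x. \<psi> x + \<eta> x) = to_l2 \<psi> + to_l2 \<eta>"
  by (intro to_l2_add[symmetric] test_function_square_integrable)

lemma to_l2_test_diff:
  "\<psi> \<in> test_functions \<Omega> \<Longrightarrow> \<eta> \<in> test_functions \<Omega> \<Longrightarrow> to_l2 (\<lambda>x. \<psi> x - \<eta> x) = to_l2 \<psi> - to_l2 \<eta>"
  by (intro to_l2_diff[symmetric] test_function_square_integrable)

lemma to_l2_test_cmult:
  "\<psi> \<in> test_functions \<Omega> \<Longrightarrow> to_l2 (\<lambda>x. c * \<psi> x) = c *\<^sub>R to_l2 \<psi>"
  by (intro to_l2_scaleR[symmetric] test_function_square_integrable)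

lemma H10_subspace: "subspace (H10 \<Omega>)"
proof (rule subspaceI)
  have "to_l2 (\<lambda>x. 0) \<in> H10 \<Omega>" by (intro test_function_H10 test_function_zero)
  then show "0 \<in> H10 \<Omega>" by (simp add: zero_l2.abs_eq)
next
  fix u v assume uv: "u \<in> H10 \<Omega>" "v \<in> H10 \<Omega>"
  show "u + v \<in> H10 \<Omega>"
  proof (rule H10I_approx)
    fix e :: real assume "e > 0"
    then have e: "e / 2 > 0" by simp
    obtain \<psi> where \<psi>: "\<psi> \<in> test_functions \<Omega>" "norm (u - to_l2 \<psi>) < e / 2" "h1_norm \<Omega> (u - to_l2 \<psi>) < e / 2"
      using H10_approx[OF uv(1) e] by blast
    obtain \<eta> where \<eta>: "\<eta> \<in> test_functions \<Omega>" "norm (v - to_l2 \<eta>) < e / 2" "h1_norm \<Omega> (v - to_l2 \<eta>) < e / 2"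
      using H10_approx[OF uv(2) e] by blast
    have eq: "u + v - (to_l2 \<psi> + to_l2 \<eta>) = (u - to_l2 \<psi>) + (v - to_l2 \<eta>)" by simp
    have "norm (u + v - (to_l2 \<psi> + to_l2 \<eta>)) < e"
      unfolding eq using norm_triangle_ineq[of "u - to_l2 \<psi>" "v - to_l2 \<eta>"] \<psi>(2) \<eta>(2) by linarith
    moreover have "h1_norm \<Omega> (u + v - (to_l2 \<psi> + to_l2 \<eta>)) < e"
      using H1.nrm_triangle[of "u - to_l2 \<psi>" "v - to_l2 \<eta>"] \<psi> \<eta> uv
      unfolding eq h1_norm_eq by (auto simp: H10_H1 test_function_H1)
    ultimately show "\<exists>w\<in>H10 \<Omega>. norm (u + v - w) < e \<and> h1_norm \<Omega> (u + v - w) < e"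
      using test_function_H10[OF test_function_add[OF \<psi>(1) \<eta>(1)]] \<psi>(1) \<eta>(1)
      by (intro bexI[of _ "to_l2 \<psi> + to_l2 \<eta>"]) (auto simp: to_l2_test_add)
  qed (use uv H10_H1 in auto)
next
  fix u and c :: real assume u: "u \<in> H10 \<Omega>"
  show "c *\<^sub>R u \<in> H10 \<Omega>"
  proof (rule H10I_approx)
    fix e :: real assume "e > 0"
    define e' where "e' = e / (\<bar>c\<bar> + 1)"
    have e': "e' > 0" using \<open>e > 0\<close> by (simp add: e'_def)
    have ce: "\<bar>c\<bar> * t < e" if "t < e'" "0 \<le> t" for t
    proof -
      have "\<bar>c\<bar> * t \<le> \<bar>c\<bar> * e'" using that by (intro mult_left_mono) auto
      also have "\<dots> < (\<bar>c\<bar> + 1) * e'" using e' by (intro mult_strict_right_mono) auto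
      also have "\<dots> = e" by (simp add: e'_def)
      finally show ?thesis .
    qed
    obtain \<psi> where \<psi>: "\<psi> \<in> test_functions \<Omega>" "norm (u - to_l2 \<psi>) < e'" "h1_norm \<Omega> (u - to_l2 \<psi>) < e'"
      using H10_approx[OF u e'] by blast
    have d: "u - to_l2 \<psi> \<in> H1 \<Omega>" using u \<psi> by (auto simp: H10_H1 test_function_H1)
    have "norm (c *\<^sub>R u - c *\<^sub>R to_l2 \<psi>) < e"
      using ce[OF \<psi>(2)] by (simp flip: scaleR_diff_right)
    moreover have "h1_norm \<Omega> (c *\<^sub>R u - c *\<^sub>R to_l2 \<psi>) < e"
      using ce[OF \<psi>(3)] H1.nrm_nonneg[OF d] H1.nrm_scale[OF d, of c]
      by (simp add: h1_norm_eq flip: scaleR_diff_right)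
    ultimately show "\<exists>w\<in>H10 \<Omega>. norm (c *\<^sub>R u - w) < e \<and> h1_norm \<Omega> (c *\<^sub>R u - w) < e"
      using test_function_H10[OF test_function_cmult[OF \<psi>(1)], of c] \<psi>(1)
      by (intro bexI[of _ "c *\<^sub>R to_l2 \<psi>"]) (auto simp: to_l2_test_cmult)
  qed (use u H10_H1 in auto)
qed

sublocale H10: semi_inner_space "H10 \<Omega>" "h1_inner \<Omega>"
  using H1.semi_inner_subspace[OF H10_subspace] H10_H1 by blast

end

section \<open>The Poincare inequality and completeness on a bounded domain\<close>

locale bounded_domain = open_domain +
  assumes bounded_dom: "bounded \<Omega>"
begin

definition poincare_const :: real where
  "poincare_const = 2 * (SOME R. 0 < R \<and> (\<forall>x\<in>\<Omega>. norm x \<le> R))"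

lemma poincare_const_pos: "0 < poincare_const"
  and poincare_const_bound: "x \<in> \<Omega> \<Longrightarrow> 2 * norm x \<le> poincare_const"
proof -
  have "\<exists>R. 0 < R \<and> (\<forall>x\<in>\<Omega>. norm x \<le> R)"
    using bounded_dom by (simp add: bounded_pos)
  from someI_ex[OF this]
  show "0 < poincare_const" "x \<in> \<Omega> \<Longrightarrow> 2 * norm x \<le> poincare_const"
    unfolding poincare_const_def by auto
qed

lemma poincare:
  assumes u: "u \<in> H10 \<Omega>"
  shows "norm u \<le> poincare_const * h1_norm \<Omega> u"
proof (rule field_le_epsilon)
  fix e :: real assume "e > 0"
  \<comment> \<open>Passing from u to \<psi> costs d in the ambient norm and
    \<open>poincare_const * d\<close> through the energy norm.\<close>
  define d where "d = e / (1 + poincare_const)"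
  have d: "d > 0" "(1 + poincare_const) * d = e"
    using \<open>e > 0\<close> poincare_const_pos by (auto simp: d_def)
  obtain \<psi> where \<psi>: "\<psi> \<in> test_functions \<Omega>" "norm (u - to_l2 \<psi>) < d" "h1_norm \<Omega> (u - to_l2 \<psi>) < d"
    using H10_approx[OF u d(1)] by blast
  obtain b :: 'a where b: "b \<in> Basis" using nonempty_Basis by blast
  have h: "to_l2 \<psi> \<in> H1 \<Omega>" "u \<in> H1 \<Omega>" using test_function_H1[OF \<psi>(1)] H10_H1[OF u] by auto
  have "norm (to_l2 \<psi>) \<le> 2 * \<bar>poincare_const / 2\<bar> * norm (to_l2 (dir_deriv \<psi> b))"
    by (rule poincare_test_function[OF \<psi>(1) b]) (use poincare_const_bound in force)
  also have "\<dots> \<le> poincare_const * h1_norm \<Omega> (to_l2 \<psi>)"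
    using norm_weak_pderiv_le[OF h(1) b] poincare_const_pos
    by (simp add: weak_pderiv_test_function[OF \<psi>(1)])
  also have "\<dots> \<le> poincare_const * (h1_norm \<Omega> u + d)"
  proof (intro mult_left_mono)
    show "h1_norm \<Omega> (to_l2 \<psi>) \<le> h1_norm \<Omega> u + d"
      using H1.nrm_triangle_diff[of "to_l2 \<psi>" u 0] h \<psi>(3) H1.nrm_diff_commute[of u "to_l2 \<psi>"]
      unfolding h1_norm_eq by simp
  qed (use poincare_const_pos in simp)
  finally have "norm (to_l2 \<psi>) \<le> poincare_const * h1_norm \<Omega> u + poincare_const * d"
    by (simp add: distrib_left)
  moreover have "norm u \<le> norm (u - to_l2 \<psi>) + norm (to_l2 \<psi>)"
    using norm_triangle_ineq[of "u - to_l2 \<psi>" "to_l2 \<psi>"] by simp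
  ultimately show "norm u \<le> poincare_const * h1_norm \<Omega> u + e"
    using \<psi>(2) d(2) by (simp add: distrib_right)
qed

lemma H10_definite: "u \<in> H10 \<Omega> \<Longrightarrow> h1_inner \<Omega> u u = 0 \<Longrightarrow> u = 0"
  using poincare[of u] by (simp add: h1_norm_def)

text \<open>By the Poincare inequality a Cauchy sequence for the Dirichlet norm is Cauchy in
  \<open>L\<^sup>2\<close>, and so is each sequence of weak partial derivatives. The identity
  defining weak derivatives passes to the limits, and approximability by test functions is inherited
  from the sequence.\<close>

lemma H10_complete: "complete_wrt (h1_inner \<Omega>) (H10 \<Omega>)"
  unfolding complete_wrt_def h1_norm_eq[symmetric]
proof (intro allI impI)
  fix X :: "nat \<Rightarrow> 'a l2"
  assume X: "\<forall>n. X n \<in> H10 \<Omega>" and cau: "\<forall>e>0. \<exists>N. \<forall>m\<ge>N. \<forall>n\<ge>N. h1_norm \<Omega> (X m - X n) < e"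
  have XH: "X n \<in> H1 \<Omega>" for n using X H10_H1 by blast
  have cauchyI: "Cauchy Y" if bnd: "\<And>m n. norm (Y m - Y n) \<le> K * h1_norm \<Omega> (X m - X n)" and "K > 0"
    for Y :: "nat \<Rightarrow> 'a l2" and K
  proof (rule CauchyI)
    fix e :: real assume "e > 0"
    then have "e / K > 0" using \<open>K > 0\<close> by simp
    with cau obtain N where N: "\<And>m n. m \<ge> N \<Longrightarrow> n \<ge> N \<Longrightarrow> h1_norm \<Omega> (X m - X n) < e / K" by blast
    have "norm (Y m - Y n) < e" if "m \<ge> N" "n \<ge> N" for m n
    proof -
      have "K * h1_norm \<Omega> (X m - X n) < e"
        using N[OF that] \<open>K > 0\<close> by (simp add: pos_less_divide_eq mult.commute)
      with bnd[of m n] show ?thesis by linarith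
    qed
    then show "\<exists>N. \<forall>m\<ge>N. \<forall>n\<ge>N. norm (Y m - Y n) < e" by blast
  qed
  have "Cauchy X"
    using X by (intro cauchyI[OF _ poincare_const_pos] poincare H10.mem) auto
  then obtain u where u: "X \<longlonglongrightarrow> u" using l2_complete convergent_def by blast
  have "\<exists>g. (\<lambda>n. weak_pderiv \<Omega> b (X n)) \<longlonglongrightarrow> g" if b: "b \<in> Basis" for b
  proof -
    have "Cauchy (\<lambda>n. weak_pderiv \<Omega> b (X n))"
      using norm_weak_pderiv_le[OF H1.mem(3)[OF XH XH] b] XH b
      by (intro cauchyI[of _ 1]) (auto simp: weak_pderiv_diff)
    then show ?thesis using l2_complete convergent_def by blast
  qed
  then obtain g where g: "\<And>b. b \<in> Basis \<Longrightarrow> (\<lambda>n. weak_pderiv \<Omega> b (X n)) \<longlonglongrightarrow> g b" by metis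
  have weak: "is_weak_pderiv \<Omega> b u (g b)" if b: "b \<in> Basis" for b
    unfolding is_weak_pderiv_iff
  proof (intro conjI ballI)
    have w: "is_weak_pderiv \<Omega> b (X n) (weak_pderiv \<Omega> b (X n))" for n
      by (rule weak_pderiv_works[OF XH b])
    show "g b \<in> L2_space \<Omega>"
      by (rule L2_space_closed[OF _ g[OF b]]) (use w in \<open>simp add: is_weak_pderiv_iff\<close>)
    fix \<psi> assume \<psi>: "\<psi> \<in> test_functions \<Omega>"
    have "(\<lambda>n. X n \<bullet> to_l2 (dir_deriv \<psi> b)) \<longlonglongrightarrow> u \<bullet> to_l2 (dir_deriv \<psi> b)"
      by (intro tendsto_inner u tendsto_const)
    moreover have "(\<lambda>n. - (weak_pderiv \<Omega> b (X n) \<bullet> to_l2 \<psi>)) \<longlonglongrightarrow> - (g b \<bullet> to_l2 \<psi>)"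
      by (intro tendsto_minus tendsto_inner g b tendsto_const)
    moreover have "X n \<bullet> to_l2 (dir_deriv \<psi> b) = - (weak_pderiv \<Omega> b (X n) \<bullet> to_l2 \<psi>)" for n
      using w \<psi> by (simp add: is_weak_pderiv_iff)
    ultimately show "u \<bullet> to_l2 (dir_deriv \<psi> b) = - (g b \<bullet> to_l2 \<psi>)"
      by (simp add: LIMSEQ_unique)
  qed
  have "u \<in> L2_space \<Omega>"
    by (rule L2_space_closed[OF _ u]) (use XH in \<open>simp add: H1_def\<close>)
  then have uH1: "u \<in> H1 \<Omega>" using weak by (rule H1I)
  have "(\<lambda>n. h1_inner \<Omega> (X n - u) (X n - u)) \<longlonglongrightarrow> (\<Sum>b\<in>(Basis::'a set). 0 \<bullet> (0::'a l2))"
    unfolding h1_inner_def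
  proof (intro tendsto_sum tendsto_inner)
    fix b :: 'a assume b: "b \<in> Basis"
    have "weak_pderiv \<Omega> b (X n - u) = weak_pderiv \<Omega> b (X n) - g b" for n
      using XH uH1 b weak_pderivI[OF weak[OF b]] by (simp add: weak_pderiv_diff)
    then show "(\<lambda>n. weak_pderiv \<Omega> b (X n - u)) \<longlonglongrightarrow> 0" "(\<lambda>n. weak_pderiv \<Omega> b (X n - u)) \<longlonglongrightarrow> 0"
      using g[OF b] by (simp_all add: LIM_zero_iff)
  qed
  then have "(\<lambda>n. h1_inner \<Omega> (X n - u) (X n - u)) \<longlonglongrightarrow> 0" by simp
  from tendsto_real_sqrt[OF this] have lim: "(\<lambda>n. h1_norm \<Omega> (X n - u)) \<longlonglongrightarrow> 0"
    by (simp add: h1_norm_def)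
  have "u \<in> H10 \<Omega>"
  proof (rule H10I_approx[OF uH1])
    fix e :: real assume e: "e > 0"
    have "\<forall>\<^sub>F n in sequentially. h1_norm \<Omega> (X n - u) < e" using order_tendstoD(2)[OF lim e] .
    moreover have "\<forall>\<^sub>F n in sequentially. norm (X n - u) < e"
      using u e by (simp add: tendsto_iff dist_norm)
    ultimately have "\<forall>\<^sub>F n in sequentially. h1_norm \<Omega> (X n - u) < e \<and> norm (X n - u) < e"
      by (rule eventually_conj)
    then obtain n where "h1_norm \<Omega> (X n - u) < e" "norm (X n - u) < e"
      by (auto simp: eventually_sequentially)
    then show "\<exists>v\<in>H10 \<Omega>. norm (u - v) < e \<and> h1_norm \<Omega> (u - v) < e"
      using X H1.nrm_diff_commute[OF uH1 XH[of n]]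
      by (intro bexI[of _ "X n"]) (auto simp: norm_minus_commute h1_norm_eq)
  qed
  with lim show "\<exists>l\<in>H10 \<Omega>. (\<lambda>n. h1_norm \<Omega> (X n - l)) \<longlonglongrightarrow> 0" by blast
qed

end


section \<open>Compactness of the embedding\<close>

lemma subspace_closure:
  fixes S :: "'x::real_normed_vector set"
  assumes "subspace S"
  shows "subspace (closure S)"
proof (rule subspaceI)
  show "0 \<in> closure S" using subspace_0[OF assms] closure_subset by blast
next
  fix x y assume "x \<in> closure S" "y \<in> closure S"
  then obtain X Y where "\<forall>n. X n \<in> S" "X \<longlonglongrightarrow> x" "\<forall>n. Y n \<in> S" "Y \<longlonglongrightarrow> y"
    unfolding closure_sequential by blast
  then show "x + y \<in> closure S"
    unfolding closure_sequential using subspace_add[OF assms]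
    by (intro exI[of _ "\<lambda>n. X n + Y n"]) (auto intro: tendsto_add)
next
  fix c x assume "x \<in> closure S"
  then obtain X where "\<forall>n. X n \<in> S" "X \<longlonglongrightarrow> x" unfolding closure_sequential by blast
  then show "c *\<^sub>R x \<in> closure S"
    unfolding closure_sequential using subspace_scale[OF assms]
    by (intro exI[of _ "\<lambda>n. c *\<^sub>R X n"]) (auto intro: tendsto_scaleR)
qed

text \<open>The diagonal argument tests against the terms of the sequence themselves. Convergence
  extends to their closed span by linearity and boundedness, and to arbitrary e by projection onto
  that span, since the projection has the same inner product with every term.\<close>

lemma bounded_sequence_weak_subsequence:
  fixes u :: "nat \<Rightarrow> 'a::euclidean_space l2"
  assumes bnd: "\<And>n. norm (u n) \<le> B"
  obtains r :: "nat \<Rightarrow> nat" where "strict_mono r" "\<And>e. convergent (\<lambda>n. u (r n) \<bullet> e)"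
proof -
  define P where "P n s = convergent (\<lambda>k. u (s k) \<bullet> u n)" for n and s :: "nat \<Rightarrow> nat"
  interpret subseqs P
  proof
    fix n and s :: "nat \<Rightarrow> nat"
    have "\<bar>u (s k) \<bullet> u n\<bar> \<le> B * norm (u n)" for k
      using Cauchy_Schwarz_ineq2[of "u (s k)" "u n"] mult_right_mono[OF bnd[of "s k"] norm_ge_zero[of "u n"]]
      by linarith
    then have "bounded (range (\<lambda>k. u (s k) \<bullet> u n))" by (auto simp: bounded_iff)
    then obtain l r where "strict_mono (r::nat\<Rightarrow>nat)" "((\<lambda>k. u (s k) \<bullet> u n) \<circ> r) \<longlonglongrightarrow> l"
      using bounded_imp_convergent_subsequence by blast
    then show "\<exists>r. strict_mono r \<and> P n (s \<circ> r)"
      by (auto simp: P_def o_def convergent_def)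
  qed
  define r where "r = diagseq"
  have conv_u: "convergent (\<lambda>k. u (r k) \<bullet> u n)" for n
  proof -
    have "P n (diagseq \<circ> (+) (Suc n))"
    proof (rule diagseq_holds)
      show "P n (s \<circ> r)" if "strict_mono r" "P n s" for r s n
        using that convergent_subseq_convergent[of "\<lambda>k. u (s k) \<bullet> u n" r] by (simp add: P_def o_def)
    qed
    then have "convergent (\<lambda>k. u (r (k + Suc n)) \<bullet> u n)"
      by (simp add: P_def o_def r_def add.commute)
    then show ?thesis
      using convergent_ignore_initial_segment[of "\<lambda>k. u (r k) \<bullet> u n" "Suc n"] by simp
  qed
  have conv_span: "convergent (\<lambda>k. u (r k) \<bullet> s)" if "s \<in> span (range u)" for s
    using that
  proof (induction rule: span_induct_alt)
    case base
    then show ?case by (simp add: convergent_const)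
  next
    case (step c x y)
    then show ?case
      using conv_u by (auto simp: inner_add_right intro!: convergent_add convergent_mult convergent_const)
  qed
  have conv_cl: "convergent (\<lambda>k. u (r k) \<bullet> m)" if m: "m \<in> closure (span (range u))" for m
  proof (rule Cauchy_convergent, rule CauchyI)
    fix e :: real assume e: "e > 0"
    have B: "B \<ge> 0" using bnd[of 0] norm_ge_zero order_trans by blast
    \<comment> \<open>Replacing m by s changes each inner product by at most e / 4, which leaves e /
      2 for the Cauchy estimate at s. Using B + 1 avoids a zero denominator.\<close>
    define d where "d = e / (4 * (B + 1))"
    have d: "d > 0" using e B by (simp add: d_def)
    obtain s where s: "s \<in> span (range u)" "norm (s - m) < d"
      using m d by (auto simp: closure_approachable dist_norm)
    obtain N where N: "\<And>i j. i \<ge> N \<Longrightarrow> j \<ge> N \<Longrightarrow> norm (u (r i) \<bullet> s - u (r j) \<bullet> s) < e / 2"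
      using CauchyD[OF convergent_Cauchy[OF conv_span[OF s(1)]], of "e / 2"] e by auto
    have near: "\<bar>u k \<bullet> m - u k \<bullet> s\<bar> \<le> e / 4" for k
    proof -
      have "\<bar>u k \<bullet> (m - s)\<bar> \<le> norm (u k) * norm (m - s)" by (rule Cauchy_Schwarz_ineq2)
      also have "\<dots> \<le> (B + 1) * d"
        using bnd[of k] s(2) B by (intro mult_mono) (auto simp: norm_minus_commute)
      also have "\<dots> = e / 4" using B by (simp add: d_def field_simps)
      finally show ?thesis by (simp add: inner_diff_right)
    qed
    have "norm (u (r i) \<bullet> m - u (r j) \<bullet> m) < e" if "i \<ge> N" "j \<ge> N" for i j
      using N[OF that] near[of "r i"] near[of "r j"] by (auto simp: abs_if split: if_splits)
    then show "\<exists>M. \<forall>i\<ge>M. \<forall>j\<ge>M. norm (u (r i) \<bullet> m - u (r j) \<bullet> m) < e" by blast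
  qed
  have "convergent (\<lambda>k. u (r k) \<bullet> e)" for e
  proof -
    interpret L: semi_inner_space UNIV "(\<bullet>) :: 'a l2 \<Rightarrow> 'a l2 \<Rightarrow> real"
    proof
      show "x \<bullet> y = y \<bullet> x" for x y :: "'a l2" by (rule inner_commute)
    qed (auto simp: inner_add_left)
    have fn: "form_norm (\<bullet>) = (norm :: 'a l2 \<Rightarrow> real)"
      by (simp add: fun_eq_iff form_norm_def norm_eq_sqrt_inner)
    let ?M = "closure (span (range u))"
    have compl: "complete_wrt (\<bullet>) ?M"
      unfolding complete_wrt_def fn
    proof (intro allI impI)
      fix X :: "nat \<Rightarrow> 'a l2"
      assume X: "\<forall>n. X n \<in> ?M" and "\<forall>e>0. \<exists>N. \<forall>m\<ge>N. \<forall>n\<ge>N. norm (X m - X n) < e"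
      then have "Cauchy X" by (intro CauchyI) blast
      then obtain l where l: "X \<longlonglongrightarrow> l" using l2_complete convergent_def by blast
      then have "l \<in> ?M" using X closed_sequentially[OF closed_closure] by blast
      with l show "\<exists>l\<in>?M. (\<lambda>n. norm (X n - l)) \<longlonglongrightarrow> 0"
        by (auto simp: tendsto_norm_zero_iff LIM_zero_iff)
    qed
    have "subspace ?M" by (intro subspace_closure subspace_span)
    then obtain m where m: "m \<in> ?M" "\<And>y. y \<in> ?M \<Longrightarrow> (e - m) \<bullet> y = 0"
      using L.projection_exists[OF _ _ compl, of e] by auto
    have "u (r k) \<bullet> e = u (r k) \<bullet> m" for k
    proof -
      have "u (r k) \<in> ?M" by (intro subsetD[OF closure_subset] span_base) simp
      from m(2)[OF this] show ?thesis by (simp add: inner_diff_left inner_commute)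
    qed
    then show ?thesis using conv_cl[OF m(1)] by simp
  qed
  moreover have "strict_mono r" unfolding r_def by (rule subseq_diagseq)
  ultimately show ?thesis using that by blast
qed

section \<open>Translates of test functions\<close>

context open_domain
begin

lemma norm_dir_deriv_le:
  assumes \<psi>: "\<psi> \<in> test_functions \<Omega>"
  shows "norm (to_l2 (dir_deriv \<psi> y)) \<le> real DIM('a) * norm y * h1_norm \<Omega> (to_l2 \<psi>)"
proof -
  have si: "square_integrable (dir_deriv \<psi> z)" for z
    by (rule test_function_square_integrable[OF dir_deriv_test_function[OF \<psi>]])
  have sum: "square_integrable (\<lambda>x. \<Sum>b\<in>A. (y \<bullet> b) * dir_deriv \<psi> b x) \<and>
      to_l2 (\<lambda>x. \<Sum>b\<in>A. (y \<bullet> b) * dir_deriv \<psi> b x) = (\<Sum>b\<in>A. (y \<bullet> b) *\<^sub>R to_l2 (dir_deriv \<psi> b))"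
    if "finite A" for A
    using that
  proof induction
    case empty
    show ?case by (simp add: square_integrable_zero zero_l2.abs_eq)
  next
    case (insert b A)
    then have "to_l2 (\<lambda>x. (y \<bullet> b) * dir_deriv \<psi> b x + (\<Sum>b\<in>A. (y \<bullet> b) * dir_deriv \<psi> b x)) =
        to_l2 (\<lambda>x. (y \<bullet> b) * dir_deriv \<psi> b x) + to_l2 (\<lambda>x. \<Sum>b\<in>A. (y \<bullet> b) * dir_deriv \<psi> b x)"
      by (intro to_l2_add[symmetric] square_integrable_cmult si) auto
    with insert show ?case
      by (simp add: square_integrable_add square_integrable_cmult si to_l2_scaleR)
  qed
  have "dir_deriv \<psi> y = (\<lambda>x. \<Sum>b\<in>Basis. (y \<bullet> b) * dir_deriv \<psi> b x)"
    by (intro ext dir_deriv_sum_Basis[OF \<psi>])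
  then have "norm (to_l2 (dir_deriv \<psi> y)) = norm (\<Sum>b\<in>Basis. (y \<bullet> b) *\<^sub>R to_l2 (dir_deriv \<psi> b))"
    using sum[OF finite_Basis] by simp
  also have "\<dots> \<le> (\<Sum>b\<in>Basis. norm ((y \<bullet> b) *\<^sub>R to_l2 (dir_deriv \<psi> b)))" by (rule norm_sum)
  also have "\<dots> \<le> (\<Sum>b\<in>(Basis::'a set). norm y * h1_norm \<Omega> (to_l2 \<psi>))"
  proof (rule sum_mono)
    fix b :: 'a assume b: "b \<in> Basis"
    have "norm (to_l2 (dir_deriv \<psi> b)) \<le> h1_norm \<Omega> (to_l2 \<psi>)"
      using norm_weak_pderiv_le[OF test_function_H1[OF \<psi>] b] by (simp add: weak_pderiv_test_function[OF \<psi>])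
    then show "norm ((y \<bullet> b) *\<^sub>R to_l2 (dir_deriv \<psi> b)) \<le> norm y * h1_norm \<Omega> (to_l2 \<psi>)"
      unfolding norm_scaleR using Basis_le_norm[OF b, of y]
      by (intro mult_mono norm_ge_zero) simp_all
  qed
  finally show ?thesis by (simp add: mult.assoc)
qed

text \<open>
  The translate by \<open>y\<close> is reached in \<open>m\<close> equal steps; each has the norm of the first one, and the
  difference quotients converge in \<open>L\<^sup>2\<close>.
\<close>

lemma translation_estimate:
  assumes \<psi>: "\<psi> \<in> test_functions \<Omega>"
  shows "norm (to_l2 (\<lambda>x. \<psi> (x + y)) - to_l2 \<psi>) \<le> norm (to_l2 (dir_deriv \<psi> y))"
proof -
  define q where "q m x = real (Suc m) * (\<psi> (x + (1 / real (Suc m)) *\<^sub>R y) - \<psi> x)" for m x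
  obtain M R where b: "\<And>m x. \<bar>q m x\<bar> \<le> M * indicator (cball 0 R) x"
    and l: "\<And>x. (\<lambda>m. q m x) \<longlonglongrightarrow> dir_deriv \<psi> y x"
    using test_function_difference_quotient[OF \<psi>, of y] unfolding q_def by metis
  note si = test_function_square_integrable[OF \<psi>]
  have si_t: "square_integrable (\<lambda>x. \<psi> (x + c))" for c by (rule square_integrable_translate[OF si])
  have siq: "square_integrable (q m)" for m
    unfolding q_def by (intro square_integrable_cmult square_integrable_diff si_t si)
  have [measurable]: "dir_deriv \<psi> y \<in> borel_measurable borel" "q m \<in> borel_measurable borel" for m
    using test_function_measurable[OF dir_deriv_test_function[OF \<psi>]] square_integrable_measurable[OF siq] by auto
  have step: "norm (to_l2 (\<lambda>x. \<psi> (x + y)) - to_l2 \<psi>) \<le> norm (to_l2 (q m))" for m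
  proof -
    define T where "T k = to_l2 (\<lambda>x. \<psi> (x + (real k / real (Suc m)) *\<^sub>R y))" for k
    have "norm (T (Suc k) - T k) = norm (to_l2 (q m)) / real (Suc m)" for k
    proof -
      let ?c = "(real k / real (Suc m)) *\<^sub>R y"
      have "x + (real (Suc k) / real (Suc m)) *\<^sub>R y = x + ?c + (1 / real (Suc m)) *\<^sub>R y" for x
        by (simp add: add_divide_distrib scaleR_add_left[symmetric] add.assoc del: of_nat_Suc)
          (simp add: add_divide_distrib add.commute)
      then have "T (Suc k) - T k = to_l2 (\<lambda>x. (\<lambda>x. (1 / real (Suc m)) * q m x) (x + ?c))"
        unfolding T_def q_def by (simp add: to_l2_diff si_t add.assoc del: of_nat_Suc)
      then have "norm (T (Suc k) - T k) = norm (to_l2 (\<lambda>x. (1 / real (Suc m)) * q m x))"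
        by (simp only: norm_to_l2_translate[OF square_integrable_cmult[OF siq]])
      also have "\<dots> = norm ((1 / real (Suc m)) *\<^sub>R to_l2 (q m))" by (simp add: to_l2_scaleR siq)
      finally show ?thesis by simp
    qed
    moreover have "T (Suc m) - T 0 = (\<Sum>k<Suc m. T (Suc k) - T k)"
      by (rule sum_lessThan_telescope[symmetric])
    ultimately have "norm (T (Suc m) - T 0) \<le> (\<Sum>k<Suc m. norm (to_l2 (q m)) / real (Suc m))"
      by (metis (no_types, lifting) norm_sum sum.cong)
    also have "\<dots> = norm (to_l2 (q m))" by simp
    finally show ?thesis by (simp add: T_def)
  qed
  have "(\<lambda>m. LINT x|lborel. (q m x)\<^sup>2) \<longlonglongrightarrow> (LINT x|lborel. (dir_deriv \<psi> y x)\<^sup>2)"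
  proof (rule integral_dominated_convergence)
    show "integrable lborel (\<lambda>x. M\<^sup>2 * indicat_real (cball (0::'a) R) x)" by (rule integrable_indicator_cball)
    show "AE x in lborel. (\<lambda>m. (q m x)\<^sup>2) \<longlonglongrightarrow> (dir_deriv \<psi> y x)\<^sup>2" by (intro AE_I2 tendsto_power l)
    show "AE x in lborel. norm ((q m x)\<^sup>2) \<le> M\<^sup>2 * indicat_real (cball 0 R) x" for m
    proof (rule AE_I2)
      fix x
      have "\<bar>q m x\<bar>\<^sup>2 \<le> (M * indicator (cball 0 R) x)\<^sup>2" by (intro power_mono b) simp
      then show "norm ((q m x)\<^sup>2) \<le> M\<^sup>2 * indicat_real (cball 0 R) x"
        by (cases "x \<in> cball 0 R") simp_all
    qed
  qed measurable
  then have "(\<lambda>m. (norm (to_l2 (q m)))\<^sup>2) \<longlonglongrightarrow> (norm (to_l2 (dir_deriv \<psi> y)))\<^sup>2"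
    by (simp add: norm_to_l2_square siq test_function_square_integrable[OF dir_deriv_test_function[OF \<psi>]])
  from tendsto_real_sqrt[OF this] have "(\<lambda>m. norm (to_l2 (q m))) \<longlonglongrightarrow> norm (to_l2 (dir_deriv \<psi> y))" by simp
  then show ?thesis by (rule LIMSEQ_le_const) (use step in auto)
qed

end

section \<open>Rellich's theorem\<close>

context bounded_domain
begin

text \<open>
  Averaging \<open>v\<close> against its translates \<open>v (x + y)\<close> over a small ball of shifts changes \<open>\<parallel>v\<parallel>\<^sup>2\<close> little
  by the translation estimate, while the averages of \<open>v\<close> over balls tend to zero pointwise by weak
  convergence.
\<close>

lemma ball_average_bound:
  assumes v: "v \<in> test_functions \<Omega>" and r: "r > 0"
  defines "S \<equiv> indicat_real (ball (0::'a) r)"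
  defines "A \<equiv> \<lambda>x. LINT y|lborel. v (x + y) * S y"
  shows "measure lborel (ball (0::'a) r) * (norm (to_l2 v))\<^sup>2 \<le>
      (LINT x|lborel. v x * A x) +
      measure lborel (ball (0::'a) r) * (real DIM('a) * poincare_const * r * (h1_norm \<Omega> (to_l2 v))\<^sup>2)"
proof -
  \<comment> \<open>The product of the Poincare bound for v and the translation bound for shifts
    shorter than r. It bounds the loss when the squared norm of v is replaced by the inner product
    of v with a translate.\<close>
  define D where "D = real DIM('a) * poincare_const * r * (h1_norm \<Omega> (to_l2 v))\<^sup>2"
  let ?\<mu> = "measure lborel (ball (0::'a) r)"
  note si = test_function_square_integrable[OF v]
  have cont: "continuous_on UNIV v" by (rule test_function_continuous[OF v])
  have [measurable]: "v \<in> borel_measurable borel" by (rule test_function_measurable[OF v])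
  have [measurable]: "S \<in> borel_measurable borel"
    unfolding S_def by (intro borel_measurable_indicator) auto
  obtain M R where b: "0 \<le> M" "\<And>x. \<bar>v x\<bar> \<le> M" "\<And>x. v x \<noteq> 0 \<Longrightarrow> norm x \<le> R"
    using test_function_bounds[OF v] by metis
  let ?f = "\<lambda>x y. v x * (v (x + y) * S y)"
  \<comment> \<open>For Fubini: the integrand is bounded and supported in a product of two balls, as
    v restricts x and S restricts y.\<close>
  have int: "integrable (lborel \<Otimes>\<^sub>M lborel) (case_prod ?f)"
  proof (rule Bochner_Integration.integrable_bound)
    have "emeasure (lborel \<Otimes>\<^sub>M lborel) (cball (0::'a) R \<times> ball (0::'a) r) =
        emeasure lborel (cball (0::'a) R) * emeasure lborel (ball (0::'a) r)"
      by (rule sigma_finite_measure.emeasure_pair_measure_Times[OF sigma_finite_lborel]) auto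
    also have "\<dots> < \<infinity>"
      using emeasure_lborel_cball_finite[of "0::'a" R] emeasure_lborel_ball_finite[of "0::'a" r]
      by (simp add: ennreal_mult_less_top)
    finally show "integrable (lborel \<Otimes>\<^sub>M lborel) (\<lambda>p. M\<^sup>2 * indicat_real (cball (0::'a) R \<times> ball (0::'a) r) p)"
      by (intro integrable_mult_right integrable_real_indicator) auto
    have "\<bar>v x * (v (x + y) * S y)\<bar> \<le> M\<^sup>2 * indicat_real (cball (0::'a) R \<times> ball 0 r) (x, y)" for x y
    proof (cases "v x = 0 \<or> S y = 0")
      case False
      then have "x \<in> cball 0 R" "y \<in> ball 0 r" using b(3)[of x] by (auto simp: S_def indicator_def)
      moreover have "\<bar>v x\<bar> * \<bar>v (x + y)\<bar> \<le> M * M" using b by (intro mult_mono) auto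
      ultimately show ?thesis by (simp add: S_def abs_mult power2_eq_square)
    qed auto
    then show "AE p in lborel \<Otimes>\<^sub>M lborel. norm (case_prod ?f p) \<le> norm (M\<^sup>2 * indicat_real (cball (0::'a) R \<times> ball 0 r) p)"
      by (auto simp: abs_mult)
  qed measurable
  have "(LINT y|lborel. LINT x|lborel. ?f x y) = (LINT x|lborel. v x * A x)"
    unfolding lborel_pair.Fubini_integral[OF int] A_def by simp
  moreover have "(LINT y|lborel. ((norm (to_l2 v))\<^sup>2 - D) * S y) \<le> (LINT y|lborel. LINT x|lborel. ?f x y)"
  proof (rule integral_mono)
    show "integrable lborel (\<lambda>y. ((norm (to_l2 v))\<^sup>2 - D) * S y)"
      using emeasure_lborel_ball_finite[of "0::'a" r] unfolding S_def by (intro integrable_mult_right) simp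
    show "integrable lborel (\<lambda>y. LINT x|lborel. ?f x y)" by (rule lborel_pair.integrable_snd[OF int])
    fix y
    have eq: "(LINT x|lborel. ?f x y) = (to_l2 v \<bullet> to_l2 (\<lambda>x. v (x + y))) * S y"
      by (simp add: inner_to_l2_to_l2 si square_integrable_translate mult.assoc[symmetric])
    show "((norm (to_l2 v))\<^sup>2 - D) * S y \<le> (LINT x|lborel. ?f x y)"
    proof (cases "y \<in> ball 0 r")
      case True
      have "norm (to_l2 (\<lambda>x. v (x + y)) - to_l2 v) \<le> real DIM('a) * r * h1_norm \<Omega> (to_l2 v)"
      proof -
        have "norm (to_l2 (\<lambda>x. v (x + y)) - to_l2 v) \<le> real DIM('a) * norm y * h1_norm \<Omega> (to_l2 v)"
          using translation_estimate[OF v] norm_dir_deriv_le[OF v] by (rule order_trans)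
        also have "\<dots> \<le> real DIM('a) * r * h1_norm \<Omega> (to_l2 v)"
          using True H1.nrm_nonneg[OF test_function_H1[OF v]]
          by (intro mult_right_mono mult_left_mono) (auto simp: h1_norm_eq)
        finally show ?thesis .
      qed
      then have "norm (to_l2 v) * norm (to_l2 (\<lambda>x. v (x + y)) - to_l2 v) \<le>
          (poincare_const * h1_norm \<Omega> (to_l2 v)) * (real DIM('a) * r * h1_norm \<Omega> (to_l2 v))"
        using poincare[OF test_function_H10[OF v]] poincare_const_pos H1.nrm_nonneg[OF test_function_H1[OF v]]
        by (intro mult_mono) (auto simp: h1_norm_eq)
      also have "\<dots> = D" by (simp add: D_def power2_eq_square mult_ac)
      finally have "- D \<le> to_l2 v \<bullet> (to_l2 (\<lambda>x. v (x + y)) - to_l2 v)"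
        using Cauchy_Schwarz_ineq2[of "to_l2 v" "to_l2 (\<lambda>x. v (x + y)) - to_l2 v"] by linarith
      then show ?thesis
        using True unfolding eq by (simp add: S_def inner_diff_right power2_norm_eq_inner)
    qed (simp add: S_def)
  qed
  ultimately have "?\<mu> * ((norm (to_l2 v))\<^sup>2 - D) \<le> (LINT x|lborel. v x * A x)"
    by (simp add: S_def mult.commute)
  then show ?thesis by (simp add: D_def algebra_simps)
qed

text \<open>In \<open>ball_average_bound\<close> the radius is fixed first, so small that the
  translation error is at most e for every n. Only then is n taken large, so that the integral of
  \<open>v n\<close> against its ball averages falls below \<mu> times e.\<close>

lemma weakly_null_imp_null:
  assumes v: "\<And>n. v n \<in> test_functions \<Omega>"
    and bnd: "\<And>n. h1_norm \<Omega> (to_l2 (v n)) \<le> B"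
    and weak: "\<And>e. (\<lambda>n. to_l2 (v n) \<bullet> e) \<longlonglongrightarrow> 0"
  shows "(\<lambda>n. norm (to_l2 (v n))) \<longlonglongrightarrow> 0"
proof -
  have B: "0 \<le> B" using bnd[of 0] H1.nrm_nonneg[OF test_function_H1[OF v[of 0]]] by (simp add: h1_norm_eq)
  have vP: "norm (to_l2 (v n)) \<le> poincare_const * B" for n
    using poincare[OF test_function_H10[OF v[of n]]] bnd[of n] poincare_const_pos
    by (meson mult_left_mono less_imp_le order_trans)
  have [measurable]: "v n \<in> borel_measurable borel" for n by (rule test_function_measurable[OF v])
  obtain R0 where R0: "\<And>x. x \<in> \<Omega> \<Longrightarrow> norm x \<le> R0" using bounded_dom by (auto simp: bounded_iff)
  have key: "\<forall>\<^sub>F n in sequentially. (norm (to_l2 (v n)))\<^sup>2 < 2 * e" if e: "e > 0" for e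
  proof -
    define D where "D = real DIM('a) * poincare_const * B\<^sup>2"
    have D: "0 \<le> D" using poincare_const_pos by (simp add: D_def)
    define r where "r = e / (D + 1)"
    have r: "r > 0" using e D by (simp add: r_def)
    have Dr: "D * r \<le> e" using e D by (simp add: r_def field_simps)
    define S where "S = indicat_real (ball (0::'a) r)"
    have [measurable]: "S \<in> borel_measurable borel"
    unfolding S_def by (intro borel_measurable_indicator) auto
    define \<mu> where "\<mu> = measure lborel (ball (0::'a) r)"
    have \<mu>: "\<mu> > 0" using r by (simp add: \<mu>_def content_ball_pos)
    define A where "A n x = (LINT y|lborel. v n (x + y) * S y)" for n x
    have siS: "square_integrable S"
      by (rule square_integrable_bounded_support[of _ 1 r], measurable)
        (simp add: S_def indicator_def)
    \<comment> \<open>The average at x is an \<open>L\<^sup>2\<close> inner product with a fixed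
      translate of the indicator. Weak convergence therefore applies at each point, and
      Cauchy-Schwarz gives a bound uniform in x and n.\<close>
    have A_eq: "A n x = to_l2 (v n) \<bullet> to_l2 (\<lambda>z. S (z + (- x)))" for n x
    proof -
      have "A n x = (LINT y|lborel. (\<lambda>z. v n z * S (z + (- x))) (y + x))"
        by (simp add: A_def add.commute)
      also have "\<dots> = (LINT z|lborel. v n z * S (z + (- x)))"
        by (rule integral_translate) measurable
      also have "\<dots> = to_l2 (v n) \<bullet> to_l2 (\<lambda>z. S (z + (- x)))"
        by (subst inner_to_l2_to_l2[OF test_function_square_integrable[OF v] square_integrable_translate[OF siS]]) simp
      finally show ?thesis .
    qed
    have A_lim: "(\<lambda>n. A n x) \<longlonglongrightarrow> 0" for x unfolding A_eq by (rule weak)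
    define K where "K = poincare_const * B * norm (to_l2 S)"
    have A_bnd: "\<bar>A n x\<bar> \<le> K" for n x
    proof -
      have "\<bar>A n x\<bar> \<le> norm (to_l2 (v n)) * norm (to_l2 S)"
        unfolding A_eq using Cauchy_Schwarz_ineq2[of "to_l2 (v n)" "to_l2 (\<lambda>z. S (z + (- x)))"]
        by (simp only: norm_to_l2_translate[OF siS])
      also have "\<dots> \<le> K" unfolding K_def by (intro mult_right_mono vP) simp
      finally show ?thesis .
    qed
    have [measurable]: "A n \<in> borel_measurable borel" for n
      unfolding A_def by measurable
    \<comment> \<open>The averages spread beyond \<Omega>. Cutting them off at a ball containing
      \<Omega> leaves their product with \<open>v n\<close> unchanged and provides an integrable
      majorant.\<close>
    have siA: "square_integrable (\<lambda>x. indicator (cball 0 R0) x * A n x)" for n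
      by (rule square_integrable_bounded_support[of _ K R0]) (use A_bnd in \<open>auto simp: indicator_def\<close>)
    have I_eq: "(LINT x|lborel. v n x * A n x) = to_l2 (v n) \<bullet> to_l2 (\<lambda>x. indicator (cball 0 R0) x * A n x)" for n
      unfolding inner_to_l2_to_l2[OF test_function_square_integrable[OF v] siA]
      using test_function_outside[OF v] R0
      by (intro Bochner_Integration.integral_cong) (auto simp: indicator_def)
    have "(\<lambda>n. LINT x|lborel. (indicator (cball 0 R0) x * A n x)\<^sup>2) \<longlonglongrightarrow> (LINT x|(lborel::'a measure). 0)"
    proof (rule integral_dominated_convergence)
      show "integrable lborel (\<lambda>x. K\<^sup>2 * indicat_real (cball (0::'a) R0) x)" by (rule integrable_indicator_cball)
      have "(\<lambda>n. (indicator (cball 0 R0) x * A n x)\<^sup>2) \<longlonglongrightarrow> (indicator (cball 0 R0) x * 0)\<^sup>2" for x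
        by (intro tendsto_intros A_lim)
      then show "AE x in lborel. (\<lambda>n. (indicator (cball 0 R0) x * A n x)\<^sup>2) \<longlonglongrightarrow> 0" by simp
      show "AE x in lborel. norm ((indicator (cball 0 R0) x * A n x)\<^sup>2) \<le> K\<^sup>2 * indicat_real (cball 0 R0) x" for n
        using power_mono[OF A_bnd abs_ge_zero, of n _ 2] by (auto simp: indicator_def)
    qed (use square_integrable_measurable[OF siA] in \<open>auto intro!: borel_measurable_power\<close>)
    then have "(\<lambda>n. (norm (to_l2 (\<lambda>x. indicator (cball 0 R0) x * A n x)))\<^sup>2) \<longlonglongrightarrow> 0"
      by (simp add: norm_to_l2_square siA)
    from tendsto_real_sqrt[OF this]
    have lim: "(\<lambda>n. norm (to_l2 (\<lambda>x. indicator (cball 0 R0) x * A n x))) \<longlonglongrightarrow> 0" by simp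
    have "(\<lambda>n. LINT x|lborel. v n x * A n x) \<longlonglongrightarrow> 0"
    proof (rule Lim_null_comparison)
      show "(\<lambda>n. poincare_const * B * norm (to_l2 (\<lambda>x. indicator (cball 0 R0) x * A n x))) \<longlonglongrightarrow> 0"
        using lim by (rule tendsto_mult_right_zero)
      have "norm (LINT x|lborel. v n x * A n x) \<le> poincare_const * B * norm (to_l2 (\<lambda>x. indicator (cball 0 R0) x * A n x))" for n
        unfolding I_eq
        using Cauchy_Schwarz_ineq2[of "to_l2 (v n)"] mult_right_mono[OF vP norm_ge_zero]
        by (metis order_trans real_norm_def)
      then show "\<forall>\<^sub>F n in sequentially. norm (LINT x|lborel. v n x * A n x) \<le>
          poincare_const * B * norm (to_l2 (\<lambda>x. indicator (cball 0 R0) x * A n x))" by simp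
    qed
    then have "\<forall>\<^sub>F n in sequentially. (LINT x|lborel. v n x * A n x) < \<mu> * e"
      using \<mu> e by (intro order_tendstoD(2)) auto
    then show ?thesis
    proof eventually_elim
      case (elim n)
      have "\<mu> * (norm (to_l2 (v n)))\<^sup>2 \<le> (LINT x|lborel. v n x * A n x) +
          \<mu> * (real DIM('a) * poincare_const * r * (h1_norm \<Omega> (to_l2 (v n)))\<^sup>2)"
        using ball_average_bound[OF v r, of n] unfolding A_def S_def \<mu>_def .
      moreover have "real DIM('a) * poincare_const * r * (h1_norm \<Omega> (to_l2 (v n)))\<^sup>2 \<le>
          real DIM('a) * poincare_const * r * B\<^sup>2"
        using bnd[of n] H1.nrm_nonneg[OF test_function_H1[OF v[of n]]] r poincare_const_pos
        by (intro mult_left_mono power_mono) (auto simp: h1_norm_eq)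
      moreover have "real DIM('a) * poincare_const * r * B\<^sup>2 = D * r" by (simp add: D_def mult_ac)
      ultimately have "\<mu> * (norm (to_l2 (v n)))\<^sup>2 < \<mu> * e + \<mu> * e"
        using elim Dr \<mu> by (smt (verit) mult_left_mono)
      then have "\<mu> * (norm (to_l2 (v n)))\<^sup>2 < \<mu> * (2 * e)" by simp
      then show ?case using \<mu> by (simp add: mult_less_cancel_left_pos)
    qed
  qed
  have "(\<lambda>n. (norm (to_l2 (v n)))\<^sup>2) \<longlonglongrightarrow> 0"
  proof (rule order_tendstoI)
    fix a :: real assume "a < 0"
    then have "a < (norm (to_l2 (v n)))\<^sup>2" for n by (meson less_le_trans zero_le_power2)
    then show "\<forall>\<^sub>F n in sequentially. a < (norm (to_l2 (v n)))\<^sup>2" by simp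
  next
    fix a :: real assume "0 < a"
    then show "\<forall>\<^sub>F n in sequentially. (norm (to_l2 (v n)))\<^sup>2 < a" using key[of "a / 2"] by simp
  qed
  from tendsto_real_sqrt[OF this] show ?thesis by simp
qed

text \<open>Test functions at distances tending to zero replace X. If a weakly convergent
  subsequence of them were not Cauchy, far-out pairs would stay d apart, yet their differences are
  test functions of bounded energy that converge weakly to zero. Taking differences makes the weak
  limit cancel.\<close>

theorem rellich:
  fixes X :: "nat \<Rightarrow> 'a l2"
  assumes X: "\<And>n. X n \<in> H10 \<Omega>" and bnd: "\<And>n. h1_norm \<Omega> (X n) \<le> B"
  shows "\<exists>r. strict_mono r \<and> Cauchy (X \<circ> (r :: nat \<Rightarrow> nat))"
proof -
  have "\<exists>\<psi>. \<psi> \<in> test_functions \<Omega> \<and> norm (X n - to_l2 \<psi>) < 1 / real (Suc n) \<and>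
      h1_norm \<Omega> (X n - to_l2 \<psi>) < 1 / real (Suc n)" for n
    using H10_approx[OF X[of n], of "1 / real (Suc n)"] by (metis of_nat_0_less_iff zero_less_Suc zero_less_divide_1_iff)
  then obtain \<psi> where \<psi>: "\<And>n. \<psi> n \<in> test_functions \<Omega>" "\<And>n. norm (X n - to_l2 (\<psi> n)) < 1 / real (Suc n)"
      "\<And>n. h1_norm \<Omega> (X n - to_l2 (\<psi> n)) < 1 / real (Suc n)" by metis
  define u where "u n = to_l2 (\<psi> n)" for n
  have XH: "X n \<in> H1 \<Omega>" for n using X H10_H1 by blast
  have uH: "u n \<in> H1 \<Omega>" for n using test_function_H1[OF \<psi>(1)] by (simp add: u_def)
  have u_bnd: "h1_norm \<Omega> (u n) \<le> B + 1" for n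
  proof -
    have "h1_norm \<Omega> (u n) \<le> h1_norm \<Omega> (X n) + h1_norm \<Omega> (X n - u n)"
      using H1.nrm_triangle_diff[OF uH[of n] XH[of n] H1.mem(1)] H1.nrm_diff_commute[OF uH[of n] XH[of n]]
      by (simp add: h1_norm_eq)
    moreover have "1 / real (Suc n) \<le> 1" by simp
    ultimately show ?thesis using bnd[of n] \<psi>(3)[of n] unfolding u_def by linarith
  qed
  have u_norm: "norm (u n) \<le> poincare_const * (B + 1)" for n
    using poincare[OF test_function_H10[OF \<psi>(1)[of n]]] mult_left_mono[OF u_bnd[of n] less_imp_le[OF poincare_const_pos]]
    by (simp add: u_def)
  obtain r :: "nat \<Rightarrow> nat" where r: "strict_mono r" "\<And>e. convergent (\<lambda>n. u (r n) \<bullet> e)"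
    using bounded_sequence_weak_subsequence[of u, OF u_norm] by blast
  have "Cauchy (u \<circ> r)"
  proof (rule ccontr)
    assume "\<not> Cauchy (u \<circ> r)"
    then obtain d where d: "d > 0" "\<And>N. \<exists>m\<ge>N. \<exists>n\<ge>N. d \<le> norm (u (r m) - u (r n))"
      unfolding Cauchy_iff by (auto simp: not_less)
    then obtain m n where mn: "\<And>N. m N \<ge> N" "\<And>N. n N \<ge> N" "\<And>N. d \<le> norm (u (r (m N)) - u (r (n N)))"
      by metis
    define v where "v N = (\<lambda>x. \<psi> (r (m N)) x - \<psi> (r (n N)) x)" for N
    have v: "v N \<in> test_functions \<Omega>" for N
      unfolding v_def by (intro test_function_diff \<psi>)
    have vu: "to_l2 (v N) = u (r (m N)) - u (r (n N))" for N
      unfolding v_def u_def by (intro to_l2_test_diff \<psi>)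
    have "(\<lambda>N. norm (to_l2 (v N))) \<longlonglongrightarrow> 0"
    proof (rule weakly_null_imp_null[OF v])
      show "h1_norm \<Omega> (to_l2 (v N)) \<le> (B + 1) + (B + 1)" for N
        using H1.nrm_triangle_diff[OF uH[of "r (m N)"] H1.mem(1) uH[of "r (n N)"]]
          u_bnd[of "r (m N)"] u_bnd[of "r (n N)"] H1.nrm_minus[OF uH[of "r (n N)"]]
        unfolding vu h1_norm_eq by simp
      fix e :: "'a l2"
      obtain l where l: "(\<lambda>n. u (r n) \<bullet> e) \<longlonglongrightarrow> l" using r(2) by (auto simp: convergent_def)
      have "filterlim m at_top sequentially" "filterlim n at_top sequentially"
        using mn(1,2) by (auto intro!: filterlim_at_top_mono[OF filterlim_ident])
      then have "(\<lambda>N. u (r (m N)) \<bullet> e - u (r (n N)) \<bullet> e) \<longlonglongrightarrow> l - l"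
        by (intro tendsto_diff filterlim_compose[OF l])
      then show "(\<lambda>N. to_l2 (v N) \<bullet> e) \<longlonglongrightarrow> 0" by (simp add: vu inner_diff_left)
    qed
    then have "\<forall>\<^sub>F N in sequentially. norm (to_l2 (v N)) < d" using d(1) by (intro order_tendstoD(2)) auto
    then obtain N where "norm (to_l2 (v N)) < d" by (auto simp: eventually_sequentially)
    with mn(3)[of N] show False by (simp add: vu)
  qed
  then obtain w where w: "(u \<circ> r) \<longlonglongrightarrow> w" using l2_complete convergent_def by blast
  have "(\<lambda>n. X n - u n) \<longlonglongrightarrow> 0"
    by (rule Lim_null_comparison[OF _ LIMSEQ_Suc[OF lim_1_over_n]])
      (use \<psi>(2) in \<open>auto simp: u_def intro!: always_eventually less_imp_le\<close>)
  from tendsto_add[OF LIMSEQ_subseq_LIMSEQ[OF this r(1)] w]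
  have "(X \<circ> r) \<longlonglongrightarrow> w" by (simp add: o_def)
  then show ?thesis using r(1) LIMSEQ_imp_Cauchy by blast
qed

end


section \<open>The superposition operator\<close>

locale nemytskii = bounded_domain \<Omega> for \<Omega> :: "'a::euclidean_space set" +
  fixes f :: "'a \<times> real \<Rightarrow> real" and M :: real
  assumes C1: "C1_on (\<Omega> \<times> UNIV) f"
    and f_zero: "square_integrable (\<lambda>x. indicator \<Omega> x * f (x, 0))"
    and M_bound: "x \<in> \<Omega> \<Longrightarrow> \<bar>pderiv2 f (x, t)\<bar> \<le> M"
    and M_nonneg: "0 \<le> M"
begin

section \<open>Pointwise properties of the nonlinearity\<close>

lemma f_has_derivative:
  assumes "x \<in> \<Omega>"
  shows "((\<lambda>s. f (x, s)) has_real_derivative pderiv2 f (x, t)) (at t)"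
proof -
  obtain f' where f': "\<And>p. p \<in> \<Omega> \<times> UNIV \<Longrightarrow> (f has_derivative blinfun_apply (f' p)) (at p)"
    using C1 unfolding C1_on_def by blast
  have "((\<lambda>s. f (x, s)) has_derivative (\<lambda>h. blinfun_apply (f' (x, t)) (0, h))) (at t)"
    by (rule has_derivative_compose[OF _ f']) (use assms in \<open>auto intro!: derivative_eq_intros\<close>)
  moreover have "(\<lambda>h. blinfun_apply (f' (x, t)) (0, h)) = (*) (blinfun_apply (f' (x, t)) (0, 1))"
  proof
    fix h :: real
    have "(0, h) = h *\<^sub>R (0 :: 'a, 1 :: real)" by simp
    then show "blinfun_apply (f' (x, t)) (0, h) = blinfun_apply (f' (x, t)) (0, 1) * h"
      by (simp only: blinfun.scaleR_right) simp
  qed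
  ultimately have "((\<lambda>s. f (x, s)) has_real_derivative blinfun_apply (f' (x, t)) (0, 1)) (at t)"
    by (simp add: has_field_derivative_def)
  then show ?thesis by (simp add: pderiv2_def DERIV_imp_deriv)
qed

lemma continuous_f: "continuous_on (\<Omega> \<times> UNIV) f"
proof -
  obtain f' where f': "\<And>p. p \<in> \<Omega> \<times> UNIV \<Longrightarrow> (f has_derivative blinfun_apply (f' p)) (at p)"
    using C1 unfolding C1_on_def by blast
  show ?thesis
    by (intro continuous_at_imp_continuous_on ballI has_derivative_continuous[OF f'])
qed

lemma continuous_pderiv2: "continuous_on (\<Omega> \<times> UNIV) (pderiv2 f)"
proof -
  obtain f' where f': "\<And>p. p \<in> \<Omega> \<times> UNIV \<Longrightarrow> (f has_derivative blinfun_apply (f' p)) (at p)"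
    and cont: "continuous_on (\<Omega> \<times> UNIV) f'"
    using C1 unfolding C1_on_def by blast
  have "pderiv2 f p = blinfun_apply (f' p) (0, 1)" if "p \<in> \<Omega> \<times> UNIV" for p
  proof (cases p)
    case (Pair x t)
    then have x: "x \<in> \<Omega>" using that by simp
    have "((\<lambda>s. f (x, s)) has_derivative (\<lambda>h. blinfun_apply (f' (x, t)) (0, h))) (at t)"
      by (rule has_derivative_compose[OF _ f']) (use x in \<open>auto intro!: derivative_eq_intros\<close>)
    from has_derivative_unique[OF this f_has_derivative[OF x, unfolded has_field_derivative_def]]
    show ?thesis using Pair by (metis mult.right_neutral)
  qed
  then show ?thesis
    by (subst continuous_on_cong[OF refl]) (auto intro!: continuous_intros cont)
qed

text \<open>Continuity of g is known only over \<Omega>, so g is first extended by zero to the whole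
  product. The extension is Borel because \<Omega> is open.\<close>

lemma measurable_superposition:
  assumes g: "continuous_on (\<Omega> \<times> UNIV) (g :: 'a \<times> real \<Rightarrow> real)" and [measurable]: "u \<in> borel_measurable borel"
  shows "(\<lambda>x. indicator \<Omega> x * g (x, u x)) \<in> borel_measurable borel"
proof -
  have "open (\<Omega> \<times> (UNIV :: real set))" by (intro open_Times open_dom open_UNIV)
  then have "(\<lambda>p. indicator (\<Omega> \<times> UNIV) p *\<^sub>R g p) \<in> borel_measurable borel"
    by (intro borel_measurable_continuous_on_indicator g) auto
  then have [measurable]: "(\<lambda>p. indicator (\<Omega> \<times> UNIV) p *\<^sub>R g p) \<in> borel_measurable (borel \<Otimes>\<^sub>M borel)"
    by (simp add: borel_prod)
  have "(\<lambda>x. (\<lambda>p. indicator (\<Omega> \<times> UNIV) p *\<^sub>R g p) (x, u x)) \<in> borel_measurable borel"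
    by measurable
  then show ?thesis by (simp add: indicator_times)
qed

lemma lipschitz_f:
  assumes "x \<in> \<Omega>"
  shows "\<bar>f (x, t) - f (x, s)\<bar> \<le> M * \<bar>t - s\<bar>"
  using field_differentiable_bound[of UNIV "\<lambda>s. f (x, s)" "\<lambda>t. pderiv2 f (x, t)" M t s]
    f_has_derivative[OF assms] M_bound[OF assms] by auto

definition superpos_fun :: "('a \<Rightarrow> real) \<Rightarrow> 'a \<Rightarrow> real" where
  "superpos_fun u x = indicator \<Omega> x * f (x, u x)"

definition superpos_deriv_fun :: "('a \<Rightarrow> real) \<Rightarrow> 'a \<Rightarrow> real" where
  "superpos_deriv_fun u x = indicator \<Omega> x * pderiv2 f (x, u x)"

lemma measurable_superpos [measurable]:
  assumes [measurable]: "u \<in> borel_measurable borel"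
  shows "superpos_fun u \<in> borel_measurable borel" "superpos_deriv_fun u \<in> borel_measurable borel"
  unfolding superpos_fun_def[abs_def] superpos_deriv_fun_def[abs_def]
  by (rule measurable_superposition continuous_f continuous_pderiv2 assms)+

lemma superpos_deriv_fun_bound: "\<bar>superpos_deriv_fun u x\<bar> \<le> M"
  using M_bound M_nonneg by (simp add: superpos_deriv_fun_def indicator_def)

lemma superpos_fun_lipschitz: "\<bar>superpos_fun u x - superpos_fun v x\<bar> \<le> M * \<bar>u x - v x\<bar>"
  using lipschitz_f M_nonneg by (simp add: superpos_fun_def indicator_def)

text \<open>A bounded slope gives linear growth: the difference from f(x, 0), which is square
  integrable over \<Omega> by assumption, is dominated by M times u.\<close>

lemma square_integrable_superpos_fun:
  assumes u: "square_integrable u"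
  shows "square_integrable (superpos_fun u)"
proof -
  note [measurable] = square_integrable_measurable[OF u]
  have "square_integrable (\<lambda>x. superpos_fun u x - superpos_fun (\<lambda>x. 0) x)"
    by (rule square_integrable_dominated[OF u, of _ M])
      (use superpos_fun_lipschitz[of u _ "\<lambda>x. 0"] in auto)
  from square_integrable_add[OF this, of "superpos_fun (\<lambda>x. 0)"] f_zero
  show ?thesis by (simp add: superpos_fun_def[abs_def])
qed

lemma square_integrable_superpos_deriv_fun:
  assumes "u \<in> borel_measurable borel" "square_integrable h"
  shows "square_integrable (\<lambda>x. superpos_deriv_fun u x * h x)"
proof (rule square_integrable_dominated[OF assms(2), of _ M])
  note [measurable] = assms(1) square_integrable_measurable[OF assms(2)]
  show "(\<lambda>x. superpos_deriv_fun u x * h x) \<in> borel_measurable borel" by measurable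
  show "AE x in lborel. \<bar>superpos_deriv_fun u x * h x\<bar> \<le> M * \<bar>h x\<bar>"
    using superpos_deriv_fun_bound by (auto simp: abs_mult intro!: mult_right_mono)
qed

section \<open>Superposition on classes modulo almost everywhere equality\<close>

definition superpos :: "'a l2 \<Rightarrow> 'a l2" where
  "superpos u = to_l2 (superpos_fun (l2_fun u))"

definition superpos_deriv :: "'a l2 \<Rightarrow> 'a l2 \<Rightarrow> 'a l2" where
  "superpos_deriv u h = to_l2 (\<lambda>x. superpos_deriv_fun (l2_fun u) x * l2_fun h x)"

lemma superpos_inner: "superpos u \<bullet> z = (LINT x:\<Omega>|lborel. f (x, l2_fun u x) * l2_fun z x)"
proof -
  have "superpos u \<bullet> z = (LINT x|lborel. l2_fun z x * superpos_fun (l2_fun u) x)"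
    unfolding superpos_def inner_commute[of _ z] by (intro inner_to_l2 square_integrable_superpos_fun square_integrable_l2_fun)
  then show ?thesis by (simp add: set_lebesgue_integral_def superpos_fun_def mult_ac)
qed

lemma si_superpos_deriv: "square_integrable (\<lambda>x. superpos_deriv_fun (l2_fun u) x * l2_fun h x)"
  by (rule square_integrable_superpos_deriv_fun) auto

lemma superpos_deriv_fun: "AE x in lborel. l2_fun (superpos_deriv u h) x = superpos_deriv_fun (l2_fun u) x * l2_fun h x"
  unfolding superpos_deriv_def by (rule l2_fun_to_l2[OF si_superpos_deriv])

lemma superpos_deriv_add: "superpos_deriv u (h + k) = superpos_deriv u h + superpos_deriv u k"
proof (rule l2_eqI)
  show "AE x in lborel. l2_fun (superpos_deriv u (h + k)) x = l2_fun (superpos_deriv u h + superpos_deriv u k) x"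
    using superpos_deriv_fun[of u "h + k"] superpos_deriv_fun[of u h] superpos_deriv_fun[of u k] l2_fun_add[of h k]
      l2_fun_add[of "superpos_deriv u h" "superpos_deriv u k"]
    by eventually_elim (simp add: distrib_left)
qed

lemma superpos_deriv_scaleR: "superpos_deriv u (c *\<^sub>R h) = c *\<^sub>R superpos_deriv u h"
proof (rule l2_eqI)
  show "AE x in lborel. l2_fun (superpos_deriv u (c *\<^sub>R h)) x = l2_fun (c *\<^sub>R superpos_deriv u h) x"
    using superpos_deriv_fun[of u "c *\<^sub>R h"] superpos_deriv_fun[of u h] l2_fun_scaleR[of c h]
      l2_fun_scaleR[of c "superpos_deriv u h"]
    by eventually_elim simp
qed

lemma superpos_deriv_inner: "superpos_deriv u h \<bullet> k = (LINT x|lborel. superpos_deriv_fun (l2_fun u) x * (l2_fun h x * l2_fun k x))"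
proof -
  have "superpos_deriv u h \<bullet> k = (LINT x|lborel. l2_fun k x * (superpos_deriv_fun (l2_fun u) x * l2_fun h x))"
    unfolding superpos_deriv_def inner_commute[of _ k] by (intro inner_to_l2 si_superpos_deriv)
  then show ?thesis by (simp add: mult_ac)
qed

lemma superpos_deriv_sym: "superpos_deriv u h \<bullet> k = superpos_deriv u k \<bullet> h"
  by (simp add: superpos_deriv_inner mult_ac)

lemma norm_superpos_deriv_le: "norm (superpos_deriv u h) \<le> M * norm h"
proof -
  have "norm (to_l2 (\<lambda>x. superpos_deriv_fun (l2_fun u) x * l2_fun h x)) \<le> M * norm (to_l2 (l2_fun h))"
    by (rule norm_to_l2_le[OF square_integrable_l2_fun _ M_nonneg])
      (auto simp: abs_mult intro!: mult_right_mono superpos_deriv_fun_bound)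
  then show ?thesis by (simp add: superpos_deriv_def)
qed

text \<open>Outside \<Omega> the coefficient is set to 0, which may lie outside the interval; there
  the inequalities hold because h vanishes.\<close>

lemma superpos_deriv_bounds:
  assumes h: "h \<in> L2_space \<Omega>" and I: "\<And>x t. x \<in> \<Omega> \<Longrightarrow> pderiv2 f (x, t) \<in> {a..b}"
  shows "a * (h \<bullet> h) \<le> superpos_deriv u h \<bullet> h" "superpos_deriv u h \<bullet> h \<le> b * (h \<bullet> h)"
proof -
  have sq: "integrable lborel (\<lambda>x. l2_fun h x * l2_fun h x)"
    by (intro square_integrable_mult square_integrable_l2_fun)
  have int: "integrable lborel (\<lambda>x. superpos_deriv_fun (l2_fun u) x * (l2_fun h x * l2_fun h x))"
    using square_integrable_mult[OF si_superpos_deriv square_integrable_l2_fun, of u h h] by (simp add: mult.assoc)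
  have hh: "c * (h \<bullet> h) = (LINT x|lborel. c * (l2_fun h x * l2_fun h x))" for c
    by (simp add: inner_l2.rep_eq)
  have out: "AE x in lborel. x \<notin> \<Omega> \<longrightarrow> l2_fun h x = 0" using h by (simp add: L2_space_def)
  show "a * (h \<bullet> h) \<le> superpos_deriv u h \<bullet> h"
    unfolding hh superpos_deriv_inner
  proof (rule integral_mono_AE[OF integrable_mult_right[OF sq] int])
    show "AE x in lborel. a * (l2_fun h x * l2_fun h x) \<le> superpos_deriv_fun (l2_fun u) x * (l2_fun h x * l2_fun h x)"
      using out
    proof eventually_elim
      case (elim x)
      then show ?case using I[of x "l2_fun u x"]
        by (cases "x \<in> \<Omega>") (auto simp: superpos_deriv_fun_def intro!: mult_right_mono)
    qed
  qed
  show "superpos_deriv u h \<bullet> h \<le> b * (h \<bullet> h)"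
    unfolding hh superpos_deriv_inner
  proof (rule integral_mono_AE[OF int integrable_mult_right[OF sq]])
    show "AE x in lborel. superpos_deriv_fun (l2_fun u) x * (l2_fun h x * l2_fun h x) \<le> b * (l2_fun h x * l2_fun h x)"
      using out
    proof eventually_elim
      case (elim x)
      then show ?case using I[of x "l2_fun u x"]
        by (cases "x \<in> \<Omega>") (auto simp: superpos_deriv_fun_def intro!: mult_right_mono)
    qed
  qed
qed

text \<open>
  The remainder of the linearization divided by the increment. Where the increment vanishes, so
  does the first quotient, and the case distinction makes the second term vanish as well.
\<close>

definition remainder_quotient :: "('a \<Rightarrow> real) \<Rightarrow> ('a \<Rightarrow> real) \<Rightarrow> 'a \<Rightarrow> real" where
  "remainder_quotient u h x = (superpos_fun (\<lambda>x. u x + h x) x - superpos_fun u x) / h x - (if h x = 0 then 0 else superpos_deriv_fun u x)"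

lemma measurable_remainder_quotient [measurable]:
  assumes [measurable]: "u \<in> borel_measurable borel" "h \<in> borel_measurable borel"
  shows "remainder_quotient u h \<in> borel_measurable borel"
  unfolding remainder_quotient_def[abs_def] by measurable

lemma remainder_quotient_mult: "remainder_quotient u h x * h x = superpos_fun (\<lambda>x. u x + h x) x - superpos_fun u x - superpos_deriv_fun u x * h x"
proof (cases "h x = 0")
  case True
  then show ?thesis by (simp add: remainder_quotient_def superpos_fun_def)
next
  case False
  then have "remainder_quotient u h x = (superpos_fun (\<lambda>x. u x + h x) x - superpos_fun u x) / h x - superpos_deriv_fun u x"
    by (simp add: remainder_quotient_def)
  with False show ?thesis by (simp add: field_simps)
qed

lemma remainder_quotient_bound: "\<bar>remainder_quotient u h x\<bar> \<le> 2 * M"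
proof (cases "h x = 0")
  case False
  have "\<bar>(superpos_fun (\<lambda>x. u x + h x) x - superpos_fun u x) / h x\<bar> \<le> M"
    using superpos_fun_lipschitz[of "\<lambda>x. u x + h x" x u] False by (simp add: abs_divide divide_le_eq)
  then show ?thesis
    using superpos_deriv_fun_bound[of u x] False
      abs_triangle_ineq4[of "(superpos_fun (\<lambda>x. u x + h x) x - superpos_fun u x) / h x" "superpos_deriv_fun u x"]
    unfolding remainder_quotient_def by simp
qed (use M_nonneg in \<open>simp add: remainder_quotient_def\<close>)

lemma remainder_quotient_tendsto:
  assumes "(\<lambda>n. h n x) \<longlonglongrightarrow> 0"
  shows "(\<lambda>n. remainder_quotient u (h n) x) \<longlonglongrightarrow> 0"
proof (cases "x \<in> \<Omega>")
  case x: True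
  \<comment> \<open>Differentiability of f in its second variable is continuity of q at 0. Defining
    q at 0 matters, since some increments \<open>h n x\<close> may vanish.\<close>
  define q where "q s = (if s = 0 then 0 else (f (x, u x + s) - f (x, u x)) / s - pderiv2 f (x, u x))" for s
  have "((\<lambda>s. (f (x, u x + s) - f (x, u x)) / s) \<longlongrightarrow> pderiv2 f (x, u x)) (at 0)"
    using f_has_derivative[OF x, of "u x"] by (simp add: DERIV_def)
  then have "((\<lambda>s. (f (x, u x + s) - f (x, u x)) / s - pderiv2 f (x, u x)) \<longlongrightarrow> 0) (at 0)"
    by (simp add: LIM_zero)
  moreover have "\<forall>\<^sub>F s in at 0. (f (x, u x + s) - f (x, u x)) / s - pderiv2 f (x, u x) = q s"
    by (auto simp: eventually_at_filter q_def)
  ultimately have "(q \<longlongrightarrow> q 0) (at 0)"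
    by (rule Lim_transform_eventually[THEN tendsto_eq_rhs]) (simp add: q_def)
  then have "isCont q 0" by (simp add: isCont_def)
  then have "(\<lambda>n. q (h n x)) \<longlonglongrightarrow> q 0" using assms by (rule isCont_tendsto_compose)
  moreover have "q (h n x) = remainder_quotient u (h n) x" for n
    using x by (simp add: q_def remainder_quotient_def superpos_fun_def superpos_deriv_fun_def)
  ultimately show ?thesis by (simp add: q_def)
next
  case False
  then have "remainder_quotient u (h n) x = 0" for n
    by (auto simp: remainder_quotient_def superpos_fun_def superpos_deriv_fun_def)
  then show ?thesis by simp
qed

lemma remainder_eq:
  "superpos (u + h) - superpos u - superpos_deriv u h = to_l2 (\<lambda>x. remainder_quotient (l2_fun u) (l2_fun h) x * l2_fun h x)"
proof (rule l2_eqI)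
  have si: "square_integrable (\<lambda>x. remainder_quotient (l2_fun u) (l2_fun h) x * l2_fun h x)"
    by (rule square_integrable_dominated[OF square_integrable_l2_fun[of h], where C = "2 * M"])
      (auto simp: abs_mult intro!: mult_right_mono remainder_quotient_bound)
  have nf: "AE x in lborel. l2_fun (superpos v) x = superpos_fun (l2_fun v) x" for v
    unfolding superpos_def by (intro l2_fun_to_l2 square_integrable_superpos_fun square_integrable_l2_fun)
  show "AE x in lborel. l2_fun (superpos (u + h) - superpos u - superpos_deriv u h) x =
      l2_fun (to_l2 (\<lambda>x. remainder_quotient (l2_fun u) (l2_fun h) x * l2_fun h x)) x"
    using l2_fun_to_l2[OF si] nf[of "u + h"] nf[of u] superpos_deriv_fun[of u h] l2_fun_add[of u h]
      l2_fun_diff[of "superpos (u + h) - superpos u" "superpos_deriv u h"] l2_fun_diff[of "superpos (u + h)" "superpos u"]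
    by eventually_elim (simp add: remainder_quotient_mult, simp add: superpos_fun_def)
qed

text \<open>
  The superposition operator is not differentiable on \<open>L\<^sup>2\<close>; on \<open>H\<^sup>1\<^sub>0\<close> normalized increments are
  precompact in \<open>L\<^sup>2\<close>, so that dominated convergence applies along a subsequence.
\<close>

theorem nemytskii_differentiable:
  assumes e: "e > 0"
  shows "\<exists>d>0. \<forall>h\<in>H10 \<Omega>. h1_norm \<Omega> h < d \<longrightarrow>
    norm (superpos (u + h) - superpos u - superpos_deriv u h) \<le> e * h1_norm \<Omega> h"
proof (rule ccontr)
  assume neg: "\<not> ?thesis"
  have "\<exists>h\<in>H10 \<Omega>. h1_norm \<Omega> h < 1 / real (Suc n) \<and>
      e * h1_norm \<Omega> h < norm (superpos (u + h) - superpos u - superpos_deriv u h)" for n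
  proof -
    have "1 / real (Suc n) > 0" by simp
    with neg show ?thesis by (meson not_le)
  qed
  then obtain h where h: "\<And>n. h n \<in> H10 \<Omega>" "\<And>n. h1_norm \<Omega> (h n) < 1 / real (Suc n)"
      "\<And>n. e * h1_norm \<Omega> (h n) < norm (superpos (u + h n) - superpos u - superpos_deriv u (h n))" by metis
  define t where "t n = h1_norm \<Omega> (h n)" for n
  have t0: "t n \<ge> 0" for n using H10.nrm_nonneg[OF h(1)] by (simp add: t_def h1_norm_eq)
  \<comment> \<open>A zero increment has zero remainder and cannot violate the estimate, so the
    increments can be normalized.\<close>
  have t: "t n > 0" for n
  proof (rule ccontr)
    assume "\<not> t n > 0"
    then have "t n = 0" using t0[of n] by simp
    then have "h n = 0" using poincare[OF h(1)[of n]] by (simp add: t_def)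
    moreover have "superpos_deriv u 0 = 0" using superpos_deriv_scaleR[of u 0 0] by simp
    ultimately show False using h(3)[of n] \<open>t n = 0\<close> by (simp add: t_def)
  qed
  define k where "k n = (1 / t n) *\<^sub>R h n" for n
  have hk: "h n = t n *\<^sub>R k n" for n using t[of n] by (simp add: k_def)
  have kH: "k n \<in> H10 \<Omega>" for n using h(1) by (simp add: k_def)
  have "h1_norm \<Omega> (k n) \<le> 1" for n
    using H10.nrm_scale[OF h(1)[of n], of "1 / t n"] t[of n] by (simp add: k_def h1_norm_eq t_def)
  from rellich[of k, OF kH this] obtain r where r: "strict_mono r" "Cauchy (k \<circ> r)" by blast
  obtain k0 where k0: "(k \<circ> r) \<longlonglongrightarrow> k0" using l2_complete[OF r(2)] by (auto simp: convergent_def)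
  have "h \<longlonglongrightarrow> 0"
  proof (rule Lim_null_comparison)
    show "\<forall>\<^sub>F n in sequentially. norm (h n) \<le> poincare_const * (1 / real (Suc n))"
    proof (intro always_eventually allI)
      fix n
      have "poincare_const * h1_norm \<Omega> (h n) \<le> poincare_const * (1 / real (Suc n))"
        using h(2)[of n] poincare_const_pos by (intro mult_left_mono) auto
      then show "norm (h n) \<le> poincare_const * (1 / real (Suc n))"
        using poincare[OF h(1)[of n]] by linarith
    qed
    show "(\<lambda>n. poincare_const * (1 / real (Suc n))) \<longlonglongrightarrow> 0"
      by (intro tendsto_mult_right_zero LIMSEQ_Suc[OF lim_1_over_n])
  qed
  from l2_tendsto_subseq_AE[OF LIMSEQ_subseq_LIMSEQ[OF this r(1)]]
  obtain s where s: "strict_mono s" "AE x in lborel. (\<lambda>n. l2_fun ((h \<circ> r) (s n)) x) \<longlonglongrightarrow> l2_fun 0 x" by blast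
  \<comment> \<open>Two extractions: r makes the normalized increments converge in
    \<open>L\<^sup>2\<close>, and s makes the increments themselves tend to zero almost
    everywhere.\<close>
  define q where "q n = r (s n)" for n
  have hq: "AE x in lborel. (\<lambda>n. l2_fun (h (q n)) x) \<longlonglongrightarrow> 0"
    using s(2) l2_fun_zero by eventually_elim (simp add: q_def)
  have kq: "(\<lambda>n. k (q n)) \<longlonglongrightarrow> k0"
    using LIMSEQ_subseq_LIMSEQ[OF k0 s(1)] by (simp add: o_def q_def)
  define \<rho> where "\<rho> n = remainder_quotient (l2_fun u) (l2_fun (h (q n)))" for n
  have [measurable]: "\<rho> n \<in> borel_measurable borel" for n
    unfolding \<rho>_def by measurable
  have \<rho>_bnd: "\<bar>\<rho> n x\<bar> \<le> 2 * M" for n x unfolding \<rho>_def by (rule remainder_quotient_bound)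
  have si: "square_integrable (\<lambda>x. \<rho> n x * l2_fun v x)" for n v
    by (rule square_integrable_dominated[OF square_integrable_l2_fun[of v], where C = "2 * M"])
      (auto simp: abs_mult intro!: mult_right_mono \<rho>_bnd)
  have "norm (to_l2 (\<lambda>x. \<rho> n x * l2_fun (k (q n)) x)) > e" for n
  proof -
    have "superpos (u + h (q n)) - superpos u - superpos_deriv u (h (q n)) = to_l2 (\<lambda>x. t (q n) * (\<rho> n x * l2_fun (k (q n)) x))"
    proof -
      have "AE x in lborel. \<rho> n x * l2_fun (h (q n)) x = t (q n) * (\<rho> n x * l2_fun (k (q n)) x)"
        using l2_fun_scaleR[of "t (q n)" "k (q n)"] unfolding hk[of "q n", symmetric] by eventually_elim simp
      then show ?thesis
        unfolding remainder_eq \<rho>_def[symmetric]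
        by (subst to_l2_eq_iff[OF si square_integrable_cmult[OF si]])
    qed
    also have "norm \<dots> = t (q n) * norm (to_l2 (\<lambda>x. \<rho> n x * l2_fun (k (q n)) x))"
      using t0[of "q n"] by (simp add: to_l2_scaleR[OF si, symmetric])
    finally have "t (q n) * e < t (q n) * norm (to_l2 (\<lambda>x. \<rho> n x * l2_fun (k (q n)) x))"
      using h(3)[of "q n"] by (simp add: t_def mult.commute)
    then show ?thesis using t[of "q n"] by (simp add: mult_less_cancel_left_pos)
  qed
  moreover have "(\<lambda>n. norm (to_l2 (\<lambda>x. \<rho> n x * l2_fun (k (q n)) x))) \<longlonglongrightarrow> 0"
  proof (rule Lim_null_comparison)
    \<comment> \<open>The factor \<rho> tends to zero only pointwise, so the varying
      \<open>k (q n)\<close> are compared with their limit \<open>k0\<close>: dominated convergence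
      handles \<open>k0\<close>, and the bound 2 M handles the difference.\<close>
    have "(\<lambda>n. LINT x|lborel. (\<rho> n x * l2_fun k0 x)\<^sup>2) \<longlonglongrightarrow> (LINT x|(lborel::'a measure). 0)"
    proof (rule integral_dominated_convergence)
      show "integrable lborel (\<lambda>x. (2 * M)\<^sup>2 * (l2_fun k0 x)\<^sup>2)"
        by (intro integrable_mult_right square_integrable_integrable square_integrable_l2_fun)
      show "AE x in lborel. (\<lambda>n. (\<rho> n x * l2_fun k0 x)\<^sup>2) \<longlonglongrightarrow> 0"
        using hq
      proof eventually_elim
        case (elim x)
        have "(\<lambda>n. \<rho> n x) \<longlonglongrightarrow> 0" unfolding \<rho>_def by (rule remainder_quotient_tendsto) (rule elim)
        then have "(\<lambda>n. (\<rho> n x * l2_fun k0 x)\<^sup>2) \<longlonglongrightarrow> (0 * l2_fun k0 x)\<^sup>2" by (intro tendsto_intros)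
        then show ?case by simp
      qed
      show "AE x in lborel. norm ((\<rho> n x * l2_fun k0 x)\<^sup>2) \<le> (2 * M)\<^sup>2 * (l2_fun k0 x)\<^sup>2" for n
        using power_mono[OF \<rho>_bnd abs_ge_zero, of n _ 2]
        by (auto simp: power_mult_distrib intro!: mult_right_mono)
    qed measurable
    then have "(\<lambda>n. (norm (to_l2 (\<lambda>x. \<rho> n x * l2_fun k0 x)))\<^sup>2) \<longlonglongrightarrow> 0"
      by (simp add: norm_to_l2_square si)
    from tendsto_real_sqrt[OF this]
    have lim0: "(\<lambda>n. norm (to_l2 (\<lambda>x. \<rho> n x * l2_fun k0 x))) \<longlonglongrightarrow> 0" by simp
    have lim1: "(\<lambda>n. norm (k (q n) - k0)) \<longlonglongrightarrow> 0"
      using kq by (simp add: tendsto_norm_zero_iff LIM_zero_iff)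
    show "(\<lambda>n. 2 * M * norm (k (q n) - k0) + norm (to_l2 (\<lambda>x. \<rho> n x * l2_fun k0 x))) \<longlonglongrightarrow> 0"
      using tendsto_add[OF tendsto_mult_right_zero[OF lim1] lim0] by simp
    have "norm (to_l2 (\<lambda>x. \<rho> n x * l2_fun (k (q n)) x)) \<le>
        2 * M * norm (k (q n) - k0) + norm (to_l2 (\<lambda>x. \<rho> n x * l2_fun k0 x))" for n
    proof -
      have "to_l2 (\<lambda>x. \<rho> n x * l2_fun (k (q n)) x) =
          to_l2 (\<lambda>x. \<rho> n x * l2_fun (k (q n) - k0) x) + to_l2 (\<lambda>x. \<rho> n x * l2_fun k0 x)"
      proof -
        have "AE x in lborel. \<rho> n x * l2_fun (k (q n)) x = \<rho> n x * l2_fun (k (q n) - k0) x + \<rho> n x * l2_fun k0 x"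
          using l2_fun_diff[of "k (q n)" k0] by eventually_elim (simp add: right_diff_distrib)
        then show ?thesis
          unfolding to_l2_add[OF si si] by (subst to_l2_eq_iff[OF si square_integrable_add[OF si si]])
      qed
      moreover have "norm (to_l2 (\<lambda>x. \<rho> n x * l2_fun (k (q n) - k0) x)) \<le> 2 * M * norm (to_l2 (l2_fun (k (q n) - k0)))"
        by (rule norm_to_l2_le[OF square_integrable_l2_fun])
          (use M_nonneg in \<open>auto simp: abs_mult intro!: mult_right_mono \<rho>_bnd\<close>)
      ultimately show ?thesis
        using norm_triangle_ineq[of "to_l2 (\<lambda>x. \<rho> n x * l2_fun (k (q n) - k0) x)" "to_l2 (\<lambda>x. \<rho> n x * l2_fun k0 x)"]
        by simp
    qed
    then show "\<forall>\<^sub>F n in sequentially. norm (norm (to_l2 (\<lambda>x. \<rho> n x * l2_fun (k (q n)) x))) \<le>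
        2 * M * norm (k (q n) - k0) + norm (to_l2 (\<lambda>x. \<rho> n x * l2_fun k0 x))" by simp
  qed
  then have "\<forall>\<^sub>F n in sequentially. norm (to_l2 (\<lambda>x. \<rho> n x * l2_fun (k (q n)) x)) < e"
    using e by (intro order_tendstoD(2)) auto
  ultimately show False by (auto simp: eventually_sequentially dest: less_asym)
qed

end


section \<open>The dual space and the projected restrictions\<close>

text \<open>The lower bound gives injectivity and, read backwards, the bound 1 / C on the
  inverse.\<close>

lemma invertible_betweenI:
  assumes L: "bounded_linear_between W nW U nU L"
    and W: "subspace W"
    and lower: "\<And>x. x \<in> W \<Longrightarrow> C * nW x \<le> nU (L x)" and C: "C > 0"
    and definite: "\<And>x. x \<in> W \<Longrightarrow> nW x \<le> 0 \<Longrightarrow> x = 0"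
    and nU0: "nU 0 = 0"
    and surj: "\<And>y. y \<in> U \<Longrightarrow> \<exists>x\<in>W. L x = y"
  shows "invertible_between W nW U nU L"
proof -
  have LU: "\<And>x. x \<in> W \<Longrightarrow> L x \<in> U"
    and add: "\<And>x y. x \<in> W \<Longrightarrow> y \<in> W \<Longrightarrow> L (x + y) = L x + L y"
    and scale: "\<And>c x. x \<in> W \<Longrightarrow> L (c *\<^sub>R x) = c *\<^sub>R L x"
    using L by (auto simp: bounded_linear_between_def)
  have inj: "x = y" if "x \<in> W" "y \<in> W" "L x = L y" for x y
  proof -
    have "L (x + (-1) *\<^sub>R y) = 0"
      using that add[OF that(1) subspace_scale[OF W that(2), of "-1"]] scale[OF that(2), of "-1"] by simp
    then have "L (x - y) = 0" by simp
    then have "C * nW (x - y) \<le> 0"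
      using lower[OF subspace_diff[OF W that(1,2)]] nU0 by simp
    then have "x - y = 0"
      using C by (intro definite subspace_diff[OF W that(1,2)]) (simp add: mult_le_0_iff)
    then show ?thesis by simp
  qed
  define T where "T y = (SOME x. x \<in> W \<and> L x = y)" for y
  have T: "T y \<in> W" "L (T y) = y" if "y \<in> U" for y
    using someI_ex[of "\<lambda>x. x \<in> W \<and> L x = y"] surj[OF that] by (auto simp: T_def)
  have TL: "T (L x) = x" if "x \<in> W" for x
    using that by (intro inj T LU)
  have "bounded_linear_between U nU W nW T"
    unfolding bounded_linear_between_def
  proof (intro conjI ballI allI exI[of _ "1 / C"])
    fix x y c assume x: "x \<in> U"
    show "T x \<in> W" by (rule T[OF x])
    have sx: "T (c *\<^sub>R x) = T (L (c *\<^sub>R T x))" using T[OF x] by (simp add: scale)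
    show "T (c *\<^sub>R x) = c *\<^sub>R T x" unfolding sx by (intro TL subspace_scale[OF W] T x)
    show "nW (T x) \<le> 1 / C * nU x"
      using lower[OF T(1)[OF x]] T(2)[OF x] C by (simp add: field_simps)
    assume y: "y \<in> U"
    have sxy: "T (x + y) = T (L (T x + T y))" using T[OF x] T[OF y] by (simp add: add)
    show "T (x + y) = T x + T y" unfolding sxy by (intro TL subspace_add[OF W] T x y)
  qed
  then show ?thesis
    unfolding invertible_between_def using L TL T(2) by blast
qed

lemma (in semi_inner_space) orthogonal_span:
  assumes "x \<in> S" "A \<subseteq> S" "\<And>y. y \<in> A \<Longrightarrow> ip x y = 0" "y \<in> span A"
  shows "ip x y = 0"
proof -
  have "span A \<subseteq> {y \<in> S. ip x y = 0}"
    using assms(1-3) by (intro span_minimal subspaceI) (auto simp: expand)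
  with assms(4) show ?thesis by auto
qed

section \<open>The Riesz isomorphism between \<open>H\<^sup>1\<^sub>0\<close> and its dual\<close>

context bounded_domain
begin

abbreviation neg_lap :: "'a l2 \<Rightarrow> 'a l2 \<Rightarrow> real" where "neg_lap \<equiv> neg_laplacian \<Omega>"

text \<open>The very expression inside \<open>hm1_inner\<close>, so that the transported inner
  product unfolds to \<open>h1_inner\<close> of representatives.\<close>

definition riesz_rep :: "('a l2 \<Rightarrow> real) \<Rightarrow> 'a l2" where
  "riesz_rep g = inv_into (H10 \<Omega>) neg_lap g"

lemma neg_lap_inj: "inj_on neg_lap (H10 \<Omega>)"
proof (rule inj_onI)
  fix u v assume u: "u \<in> H10 \<Omega>" and v: "v \<in> H10 \<Omega>" and eq: "neg_lap u = neg_lap v"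
  have "h1_inner \<Omega> (u - v) (u - v) = neg_lap u (u - v) - neg_lap v (u - v)"
    using u v by (simp add: neg_laplacian_def H10.diff_left)
  then have "u - v = 0" using u v eq by (intro H10_definite) auto
  then show "u = v" by simp
qed

lemma neg_lap_Hminus1: "u \<in> H10 \<Omega> \<Longrightarrow> neg_lap u \<in> Hminus1 \<Omega>"
  unfolding Hminus1_def bounded_linear_between_def mem_Collect_eq
proof (intro conjI allI ballI impI exI[of _ "h1_norm \<Omega> u"])
  fix x assume "u \<in> H10 \<Omega>" "x \<in> H10 \<Omega>"
  then show "norm (neg_lap u x) \<le> h1_norm \<Omega> u * h1_norm \<Omega> x"
    using H10.cauchy_schwarz[of u x] by (simp add: neg_laplacian_def h1_norm_eq)
qed (auto simp: neg_laplacian_def H10.expand)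

lemma Hminus1_riesz: "g \<in> Hminus1 \<Omega> \<Longrightarrow> g \<in> neg_lap ` H10 \<Omega>"
proof -
  assume g: "g \<in> Hminus1 \<Omega>"
  then have "\<exists>K. \<forall>x\<in>H10 \<Omega>. \<bar>g x\<bar> \<le> K * h1_norm \<Omega> x"
    by (simp add: Hminus1_def bounded_linear_between_def)
  then obtain K where K: "\<And>x. x \<in> H10 \<Omega> \<Longrightarrow> \<bar>g x\<bar> \<le> K * h1_norm \<Omega> x" by blast
  have "\<exists>r\<in>H10 \<Omega>. \<forall>z\<in>H10 \<Omega>. g z = h1_inner \<Omega> r z"
  proof (rule H10.riesz[OF H10_complete])
    show "\<bar>g x\<bar> \<le> K * H10.nrm x" if "x \<in> H10 \<Omega>" for x using K[OF that] by (simp add: h1_norm_eq)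
  qed (use g in \<open>auto simp: Hminus1_def bounded_linear_between_def\<close>)
  then obtain r where r: "r \<in> H10 \<Omega>" "\<And>z. z \<in> H10 \<Omega> \<Longrightarrow> g z = h1_inner \<Omega> r z" by blast
  have "g = neg_lap r"
    using r(2) g by (auto simp: fun_eq_iff neg_laplacian_def Hminus1_def)
  with r(1) show ?thesis by blast
qed

lemma riesz_rep_neg_lap [simp]: "u \<in> H10 \<Omega> \<Longrightarrow> riesz_rep (neg_lap u) = u"
  unfolding riesz_rep_def by (rule inv_into_f_f[OF neg_lap_inj])

lemma riesz_rep_mem [simp, intro]: "g \<in> Hminus1 \<Omega> \<Longrightarrow> riesz_rep g \<in> H10 \<Omega>"
  unfolding riesz_rep_def by (rule inv_into_into[OF Hminus1_riesz])

lemma neg_lap_riesz_rep: "g \<in> Hminus1 \<Omega> \<Longrightarrow> neg_lap (riesz_rep g) = g"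
  unfolding riesz_rep_def by (rule f_inv_into_f[OF Hminus1_riesz])

lemma riesz_rep_inner: "g \<in> Hminus1 \<Omega> \<Longrightarrow> z \<in> H10 \<Omega> \<Longrightarrow> h1_inner \<Omega> (riesz_rep g) z = g z"
  using fun_cong[OF neg_lap_riesz_rep, of g z] by (simp add: neg_laplacian_def)

lemma neg_lap_add: "u \<in> H10 \<Omega> \<Longrightarrow> v \<in> H10 \<Omega> \<Longrightarrow> neg_lap (u + v) = neg_lap u + neg_lap v"
  by (auto simp: fun_eq_iff neg_laplacian_def H10.add_left)

lemma neg_lap_diff: "u \<in> H10 \<Omega> \<Longrightarrow> v \<in> H10 \<Omega> \<Longrightarrow> neg_lap (u - v) = neg_lap u - neg_lap v"
  by (auto simp: fun_eq_iff neg_laplacian_def H10.diff_left)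

lemma neg_lap_scale: "u \<in> H10 \<Omega> \<Longrightarrow> neg_lap (c *\<^sub>R u) = c *\<^sub>R neg_lap u"
  by (auto simp: fun_eq_iff neg_laplacian_def H10.scale_left scaleR_fun_def)

lemma Hminus1_subspace: "subspace (Hminus1 \<Omega>)"
proof (rule subspaceI)
  have "neg_lap 0 = 0" by (auto simp: fun_eq_iff neg_laplacian_def)
  then show "0 \<in> Hminus1 \<Omega>" using neg_lap_Hminus1[OF H10.mem(1)] by simp
  show "g + k \<in> Hminus1 \<Omega>" if "g \<in> Hminus1 \<Omega>" "k \<in> Hminus1 \<Omega>" for g k
    using neg_lap_Hminus1[of "riesz_rep g + riesz_rep k"] that by (simp add: neg_lap_add neg_lap_riesz_rep)
  show "c *\<^sub>R g \<in> Hminus1 \<Omega>" if "g \<in> Hminus1 \<Omega>" for c g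
    using neg_lap_Hminus1[of "c *\<^sub>R riesz_rep g"] that by (simp add: neg_lap_scale neg_lap_riesz_rep)
qed

lemma riesz_rep_add: "g \<in> Hminus1 \<Omega> \<Longrightarrow> k \<in> Hminus1 \<Omega> \<Longrightarrow> riesz_rep (g + k) = riesz_rep g + riesz_rep k"
  using riesz_rep_neg_lap[of "riesz_rep g + riesz_rep k"] by (simp add: neg_lap_add neg_lap_riesz_rep)

lemma riesz_rep_diff: "g \<in> Hminus1 \<Omega> \<Longrightarrow> k \<in> Hminus1 \<Omega> \<Longrightarrow> riesz_rep (g - k) = riesz_rep g - riesz_rep k"
  using riesz_rep_neg_lap[of "riesz_rep g - riesz_rep k"] by (simp add: neg_lap_diff neg_lap_riesz_rep)

lemma riesz_rep_scale: "g \<in> Hminus1 \<Omega> \<Longrightarrow> riesz_rep (c *\<^sub>R g) = c *\<^sub>R riesz_rep g"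
  using riesz_rep_neg_lap[of "c *\<^sub>R riesz_rep g"] by (simp add: neg_lap_scale neg_lap_riesz_rep)

lemma hm1_inner_eq: "hm1_inner \<Omega> g k = h1_inner \<Omega> (riesz_rep g) (riesz_rep k)"
  by (simp add: hm1_inner_def riesz_rep_def)

sublocale Hm: semi_inner_space "Hminus1 \<Omega>" "hm1_inner \<Omega>"
proof
  show "subspace (Hminus1 \<Omega>)" by (rule Hminus1_subspace)
qed (auto simp: hm1_inner_eq riesz_rep_add riesz_rep_scale H10.expand H10.nonneg intro: H10.sym)

text \<open>The supremum in the dual norm is attained at the normalized Riesz representative, or at
  0 when that representative has norm zero.\<close>

lemma hm1_norm_eq:
  assumes g: "g \<in> Hminus1 \<Omega>"
  shows "hm1_norm \<Omega> g = h1_norm \<Omega> (riesz_rep g)"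
  unfolding hm1_norm_def
proof (rule cSup_eq_maximum)
  define n where "n = h1_norm \<Omega> (riesz_rep g)"
  have n0: "n \<ge> 0" using H10.nrm_nonneg[OF riesz_rep_mem[OF g]] by (simp add: n_def h1_norm_eq)
  define z where "z = (if n = 0 then 0 else (1 / n) *\<^sub>R riesz_rep g)"
  have zH: "z \<in> H10 \<Omega>" using g by (simp add: z_def)
  have "h1_norm \<Omega> z \<le> 1"
    using H10.nrm_scale[OF riesz_rep_mem[OF g], of "1 / n"] n0
    by (auto simp: z_def h1_norm_eq n_def)
  moreover have "n = \<bar>g z\<bar>"
  proof (cases "n = 0")
    case True
    then show ?thesis using g riesz_rep_inner[OF g H10.mem(1)] by (simp add: z_def)
  next
    case False
    have "g z = 1 / n * n\<^sup>2"
      using False g H10.nrm_sq[OF riesz_rep_mem[OF g]]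
      by (simp add: z_def riesz_rep_inner[OF g, symmetric] H10.scale_right n_def h1_norm_eq)
    then show ?thesis using False n0 by (simp add: power2_eq_square)
  qed
  ultimately show "h1_norm \<Omega> (riesz_rep g) \<in> (\<lambda>z. \<bar>g z\<bar>) ` {z \<in> H10 \<Omega>. h1_norm \<Omega> z \<le> 1}"
    using zH by (auto simp: n_def)
  fix y assume "y \<in> (\<lambda>z. \<bar>g z\<bar>) ` {z \<in> H10 \<Omega>. h1_norm \<Omega> z \<le> 1}"
  then obtain z where z: "z \<in> H10 \<Omega>" "h1_norm \<Omega> z \<le> 1" "y = \<bar>g z\<bar>" by blast
  have "y \<le> n * h1_norm \<Omega> z"
    using H10.cauchy_schwarz[OF riesz_rep_mem[OF g] z(1)] z riesz_rep_inner[OF g z(1)]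
    by (simp add: n_def h1_norm_eq)
  also have "\<dots> \<le> n * 1" using n0 z(2) by (intro mult_left_mono)
  finally show "y \<le> h1_norm \<Omega> (riesz_rep g)" by (simp add: n_def)
qed

lemma hm1_norm_neg_lap: "u \<in> H10 \<Omega> \<Longrightarrow> hm1_norm \<Omega> (neg_lap u) = h1_norm \<Omega> u"
  by (simp add: hm1_norm_eq neg_lap_Hminus1)

lemma hm1_norm_form: "g \<in> Hminus1 \<Omega> \<Longrightarrow> hm1_norm \<Omega> g = form_norm (hm1_inner \<Omega>) g"
  by (simp add: hm1_norm_eq form_norm_def hm1_inner_eq h1_norm_def)

lemma hm1_norm_diff_le:
  "g \<in> Hminus1 \<Omega> \<Longrightarrow> k \<in> Hminus1 \<Omega> \<Longrightarrow> hm1_norm \<Omega> (g - k) \<le> hm1_norm \<Omega> g + hm1_norm \<Omega> k"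
  using Hm.nrm_triangle[of g "- k"] by (simp add: hm1_norm_form Hm.nrm_minus)

lemma l2_functional_Hminus1: "l2_functional \<Omega> e \<in> Hminus1 \<Omega>"
  unfolding Hminus1_def bounded_linear_between_def mem_Collect_eq
proof (intro conjI allI ballI impI exI[of _ "norm e * poincare_const"])
  fix x assume x: "x \<in> H10 \<Omega>"
  have "\<bar>e \<bullet> x\<bar> \<le> norm e * norm x" by (rule Cauchy_Schwarz_ineq2)
  also have "\<dots> \<le> norm e * (poincare_const * h1_norm \<Omega> x)" by (intro mult_left_mono poincare x) simp
  finally show "norm (l2_functional \<Omega> e x) \<le> norm e * poincare_const * h1_norm \<Omega> x"
    using x by (simp add: l2_functional_def mult.assoc)
qed (auto simp: l2_functional_def inner_add_right)

text \<open>The weak solution operator of the Dirichlet problem with right-hand side e.\<close>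

definition inv_lap :: "'a l2 \<Rightarrow> 'a l2" where
  "inv_lap e = riesz_rep (l2_functional \<Omega> e)"

lemma inv_lap_mem [simp, intro]: "inv_lap e \<in> H10 \<Omega>"
  by (simp add: inv_lap_def l2_functional_Hminus1)

lemma inv_lap_inner: "z \<in> H10 \<Omega> \<Longrightarrow> h1_inner \<Omega> (inv_lap e) z = e \<bullet> z"
  by (simp add: inv_lap_def riesz_rep_inner l2_functional_Hminus1) (simp add: l2_functional_def)

lemma l2_functional_add: "l2_functional \<Omega> (e + e') = l2_functional \<Omega> e + l2_functional \<Omega> e'"
  by (auto simp: fun_eq_iff l2_functional_def inner_add_left)

lemma l2_functional_scale: "l2_functional \<Omega> (c *\<^sub>R e) = c *\<^sub>R l2_functional \<Omega> e"
  by (auto simp: fun_eq_iff l2_functional_def scaleR_fun_def)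

lemma inv_lap_add: "inv_lap (e + e') = inv_lap e + inv_lap e'"
  by (simp add: inv_lap_def l2_functional_add riesz_rep_add l2_functional_Hminus1)

lemma inv_lap_scale: "inv_lap (c *\<^sub>R e) = c *\<^sub>R inv_lap e"
  by (simp add: inv_lap_def l2_functional_scale riesz_rep_scale l2_functional_Hminus1)

lemma inv_lap_diff: "inv_lap (e - e') = inv_lap e - inv_lap e'"
  using inv_lap_add[of "e - e'" e'] by simp

text \<open>The energy estimate: the equation is tested with its own solution, and the Poincare
  inequality turns the ambient norm of the solution into its energy norm, which cancels.\<close>

lemma inv_lap_norm: "h1_norm \<Omega> (inv_lap e) \<le> poincare_const * norm e"
proof -
  define n where "n = h1_norm \<Omega> (inv_lap e)"
  have n0: "n \<ge> 0" using H10.nrm_nonneg[OF inv_lap_mem] by (simp add: n_def h1_norm_eq)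
  have "n\<^sup>2 = e \<bullet> inv_lap e"
    using H10.nrm_sq[OF inv_lap_mem[of e]] by (simp add: n_def h1_norm_eq inv_lap_inner)
  also have "\<dots> \<le> norm e * norm (inv_lap e)" by (rule norm_cauchy_schwarz)
  also have "\<dots> \<le> norm e * (poincare_const * n)"
    unfolding n_def by (intro mult_left_mono poincare) auto
  finally have "n * n \<le> (poincare_const * norm e) * n" by (simp add: power2_eq_square mult_ac)
  moreover have "0 \<le> poincare_const * norm e" using poincare_const_pos by simp
  ultimately have "n \<le> poincare_const * norm e"
    using n0 by (cases "n = 0") (auto dest: mult_right_le_imp_le)
  then show ?thesis by (simp add: n_def)
qed

lemma H10_L2_space: "u \<in> H10 \<Omega> \<Longrightarrow> u \<in> L2_space \<Omega>"
  by (simp add: H10_def H1_def)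

end

section \<open>The decompositions and the linearized operator\<close>

locale dirichlet_problem = nemytskii \<Omega> f M
  for \<Omega> :: "'a::euclidean_space set" and f M +
  fixes ev :: "nat \<Rightarrow> real" and \<phi> :: "nat \<Rightarrow> 'a l2" and a b :: real
  assumes eigsys: "dirichlet_eigensystem \<Omega> ev \<phi>"
    and ab: "a \<le> b"
    and slope: "\<And>x t. x \<in> \<Omega> \<Longrightarrow> pderiv2 f (x, t) \<in> {a..b}"
begin

sublocale EF: compact_form "H10 \<Omega>" "h1_inner \<Omega>" poincare_const ev \<phi>
proof
  show "norm u \<le> poincare_const * form_norm (h1_inner \<Omega>) u" if "u \<in> H10 \<Omega>" for u
    using poincare[OF that] by (simp add: h1_norm_eq)
  show "complete_wrt (h1_inner \<Omega>) (H10 \<Omega>)" by (rule H10_complete)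
  show "\<exists>r. strict_mono r \<and> Cauchy (X \<circ> r)"
    if "\<And>n. X n \<in> H10 \<Omega>" "\<And>n. form_norm (h1_inner \<Omega>) (X n) \<le> B" for X :: "nat \<Rightarrow> 'a l2" and B
    using rellich[of X B] that by (simp add: h1_norm_eq)
  show "0 < ev k" for k
    using eigsys incseqD[of ev 0 k] unfolding dirichlet_eigensystem_def by fastforce
  show "\<phi> k \<in> H10 \<Omega>" "\<phi> k \<noteq> 0" for k using eigsys by (auto simp: dirichlet_eigensystem_def)
  show "h1_inner \<Omega> (\<phi> k) z = ev k * (\<phi> k \<bullet> z)" if "z \<in> H10 \<Omega>" for k z
  proof -
    have "neg_laplacian \<Omega> (\<phi> k) z = (ev k *\<^sub>R l2_functional \<Omega> (\<phi> k)) z"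
      using eigsys by (simp add: dirichlet_eigensystem_def)
    then show ?thesis using that by (simp add: neg_laplacian_def l2_functional_def scaleR_fun_def)
  qed
  show "\<phi> i \<bullet> \<phi> j = 0" if "i \<noteq> j" for i j using eigsys that by (auto simp: dirichlet_eigensystem_def)
  show "u \<in> span (\<phi> ` {k. ev k = \<mu>})"
    if "u \<in> H10 \<Omega>" "\<And>z. z \<in> H10 \<Omega> \<Longrightarrow> h1_inner \<Omega> u z = \<mu> * (u \<bullet> z)" for u \<mu>
  proof -
    have "neg_laplacian \<Omega> u = \<mu> *\<^sub>R l2_functional \<Omega> u"
      using that by (auto simp: fun_eq_iff neg_laplacian_def l2_functional_def scaleR_fun_def)
    then show ?thesis using eigsys that(1) unfolding dirichlet_eigensystem_def by blast
  qed
qed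

abbreviation WX :: "'a l2 set" where "WX \<equiv> W_X \<Omega> ev \<phi> {a..b}"
abbreviation WY :: "('a l2 \<Rightarrow> real) set" where "WY \<equiv> W_Y \<Omega> ev \<phi> {a..b}"

lemma V_X_H10: "V_X ev \<phi> {a..b} \<subseteq> H10 \<Omega>"
  unfolding V_X_def using EF.eigen_mem by (intro span_minimal H10_subspace) auto

lemma WX_iff: "h \<in> WX \<longleftrightarrow> h \<in> H10 \<Omega> \<and> (\<forall>k. ev k \<in> {a..b} \<longrightarrow> h1_inner \<Omega> h (\<phi> k) = 0)"
proof
  assume h: "h \<in> WX"
  then have "h1_inner \<Omega> h (\<phi> k) = 0" if "ev k \<in> {a..b}" for k
    using that span_base[of "\<phi> k" "\<phi> ` index_set ev {a..b}"]
    by (auto simp: W_X_def orthogonal_complement_in_def V_X_def index_set_def)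
  with h show "h \<in> H10 \<Omega> \<and> (\<forall>k. ev k \<in> {a..b} \<longrightarrow> h1_inner \<Omega> h (\<phi> k) = 0)"
    by (simp add: W_X_def orthogonal_complement_in_def)
next
  assume h: "h \<in> H10 \<Omega> \<and> (\<forall>k. ev k \<in> {a..b} \<longrightarrow> h1_inner \<Omega> h (\<phi> k) = 0)"
  have "h1_inner \<Omega> h y = 0" if "y \<in> V_X ev \<phi> {a..b}" for y
    by (rule H10.orthogonal_span[OF _ _ _ that[unfolded V_X_def]])
      (use h EF.eigen_mem in \<open>auto simp: index_set_def\<close>)
  with h show "h \<in> WX" by (simp add: W_X_def orthogonal_complement_in_def)
qed

lemma WX_H10: "h \<in> WX \<Longrightarrow> h \<in> H10 \<Omega>"
  by (simp add: WX_iff)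

lemma WX_subspace: "subspace WX"
  unfolding W_X_def orthogonal_complement_in_def
  by (rule H10.orthogonal_complement_subspace[OF V_X_H10])

lemma WX_complete: "complete_wrt (h1_inner \<Omega>) WX"
  unfolding W_X_def orthogonal_complement_in_def
  by (rule H10.orthogonal_complement_complete[OF H10_complete V_X_H10])

sublocale WX: semi_inner_space WX "h1_inner \<Omega>"
  using H10.semi_inner_subspace[OF WX_subspace] WX_H10 by blast

text \<open>The functional of \<open>\<phi> k\<close> is its image under -\<Delta> divided by
  \<open>ev k\<close>. The Riesz isometry therefore matches \<open>V_Y\<close> with
  \<open>V_X\<close>, and hence the orthogonal complements with each other.\<close>

lemma WY_iff: "g \<in> WY \<longleftrightarrow> g \<in> Hminus1 \<Omega> \<and> riesz_rep g \<in> WX"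
proof -
  have inner: "hm1_inner \<Omega> g (l2_functional \<Omega> (\<phi> k)) = h1_inner \<Omega> (riesz_rep g) (\<phi> k) / ev k"
    if "g \<in> Hminus1 \<Omega>" for g k
  proof -
    have "hm1_inner \<Omega> g (l2_functional \<Omega> (\<phi> k)) = h1_inner \<Omega> (inv_lap (\<phi> k)) (riesz_rep g)"
      unfolding hm1_inner_eq using that H10.sym[of "riesz_rep g" "inv_lap (\<phi> k)"] by (simp flip: inv_lap_def)
    then have "hm1_inner \<Omega> g (l2_functional \<Omega> (\<phi> k)) = \<phi> k \<bullet> riesz_rep g"
      using that by (simp add: inv_lap_inner)
    then show ?thesis
      using EF.eigen_right[OF riesz_rep_mem[OF that], of k] EF.ev_pos[of k] by (simp add: inner_commute)
  qed
  let ?A = "(\<lambda>i. l2_functional \<Omega> (\<phi> i)) ` index_set ev {a..b}"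
  have A: "?A \<subseteq> Hminus1 \<Omega>" using l2_functional_Hminus1 by auto
  have "(\<forall>y\<in>V_Y \<Omega> ev \<phi> {a..b}. hm1_inner \<Omega> g y = 0) \<longleftrightarrow>
      (\<forall>k. ev k \<in> {a..b} \<longrightarrow> h1_inner \<Omega> (riesz_rep g) (\<phi> k) = 0)" if g: "g \<in> Hminus1 \<Omega>"
  proof
    assume h: "\<forall>y\<in>V_Y \<Omega> ev \<phi> {a..b}. hm1_inner \<Omega> g y = 0"
    show "\<forall>k. ev k \<in> {a..b} \<longrightarrow> h1_inner \<Omega> (riesz_rep g) (\<phi> k) = 0"
    proof (intro allI impI)
      fix k assume "ev k \<in> {a..b}"
      then have "l2_functional \<Omega> (\<phi> k) \<in> V_Y \<Omega> ev \<phi> {a..b}"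
        unfolding V_Y_def by (intro span_base) (auto simp: index_set_def)
      with h inner[OF g, of k] EF.ev_pos[of k] show "h1_inner \<Omega> (riesz_rep g) (\<phi> k) = 0" by simp
    qed
  next
    assume h: "\<forall>k. ev k \<in> {a..b} \<longrightarrow> h1_inner \<Omega> (riesz_rep g) (\<phi> k) = 0"
    show "\<forall>y\<in>V_Y \<Omega> ev \<phi> {a..b}. hm1_inner \<Omega> g y = 0"
    proof
      fix y assume "y \<in> V_Y \<Omega> ev \<phi> {a..b}"
      then show "hm1_inner \<Omega> g y = 0"
        unfolding V_Y_def
        by (rule Hm.orthogonal_span[OF g A, rotated]) (use h inner[OF g] in \<open>auto simp: index_set_def\<close>)
    qed
  qed
  then show ?thesis by (auto simp: W_Y_def orthogonal_complement_in_def WX_iff)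
qed

lemma WY_Hminus1: "g \<in> WY \<Longrightarrow> g \<in> Hminus1 \<Omega>"
  by (simp add: WY_iff)

lemma neg_lap_WY: "h \<in> WX \<Longrightarrow> neg_lap h \<in> WY"
  using WX_H10 by (simp add: WY_iff neg_lap_Hminus1)

definition proj_WX :: "'a l2 \<Rightarrow> 'a l2" where
  "proj_WX u = (SOME m. m \<in> WX \<and> (\<forall>y\<in>WX. h1_inner \<Omega> (u - m) y = 0))"

lemma proj_WX_props:
  assumes "u \<in> H10 \<Omega>"
  shows "proj_WX u \<in> WX" "y \<in> WX \<Longrightarrow> h1_inner \<Omega> (u - proj_WX u) y = 0"
proof -
  have "\<exists>m. m \<in> WX \<and> (\<forall>y\<in>WX. h1_inner \<Omega> (u - m) y = 0)"
    using H10.projection_exists[OF WX_subspace _ WX_complete assms] WX_H10 by blast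
  from someI_ex[OF this] show "proj_WX u \<in> WX" "y \<in> WX \<Longrightarrow> h1_inner \<Omega> (u - proj_WX u) y = 0"
    unfolding proj_WX_def[symmetric] by auto
qed

lemma proj_WX_H10 [simp, intro]: "u \<in> H10 \<Omega> \<Longrightarrow> proj_WX u \<in> H10 \<Omega>"
  using proj_WX_props(1) WX_H10 by blast

lemma proj_WX_inner: "u \<in> H10 \<Omega> \<Longrightarrow> y \<in> WX \<Longrightarrow> h1_inner \<Omega> (proj_WX u) y = h1_inner \<Omega> u y"
  using proj_WX_props(2)[of u y] WX_H10[of y] by (simp add: H10.diff_left)

lemma proj_WX_unique:
  assumes "u \<in> H10 \<Omega>" "m \<in> WX" "\<And>y. y \<in> WX \<Longrightarrow> h1_inner \<Omega> (u - m) y = 0"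
  shows "proj_WX u = m"
proof -
  have d: "proj_WX u - m \<in> WX" using proj_WX_props(1)[OF assms(1)] assms(2) by (rule WX.mem(3))
  have "h1_inner \<Omega> (proj_WX u - m) (proj_WX u - m) = 0"
    using proj_WX_inner[OF assms(1) d] assms(3)[OF d] assms(1,2) WX_H10[OF d] WX_H10[OF assms(2)]
    by (simp add: H10.diff_left)
  then have "proj_WX u - m = 0" using WX_H10[OF d] by (intro H10_definite)
  then show ?thesis by simp
qed

lemma proj_WX_add: "u \<in> H10 \<Omega> \<Longrightarrow> v \<in> H10 \<Omega> \<Longrightarrow> proj_WX (u + v) = proj_WX u + proj_WX v"
  by (rule proj_WX_unique) (auto simp: proj_WX_props(1) WX_H10 proj_WX_inner H10.expand)

lemma proj_WX_scale: "u \<in> H10 \<Omega> \<Longrightarrow> proj_WX (c *\<^sub>R u) = c *\<^sub>R proj_WX u"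
  by (rule proj_WX_unique) (auto simp: proj_WX_props(1) WX_H10 proj_WX_inner H10.expand)

lemma proj_WX_diff: "u \<in> H10 \<Omega> \<Longrightarrow> v \<in> H10 \<Omega> \<Longrightarrow> proj_WX (u - v) = proj_WX u - proj_WX v"
  by (rule proj_WX_unique) (auto simp: proj_WX_props(1) WX_H10 proj_WX_inner H10.expand)

lemma proj_WX_norm: "u \<in> H10 \<Omega> \<Longrightarrow> h1_norm \<Omega> (proj_WX u) \<le> h1_norm \<Omega> u"
proof -
  assume u: "u \<in> H10 \<Omega>"
  define n where "n = h1_norm \<Omega> (proj_WX u)"
  have n0: "n \<ge> 0" using H10.nrm_nonneg[OF proj_WX_H10[OF u]] by (simp add: n_def h1_norm_eq)
  have "n * n = h1_inner \<Omega> u (proj_WX u)"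
    using H10.nrm_sq[OF proj_WX_H10[OF u]] proj_WX_inner[OF u proj_WX_props(1)[OF u]]
    by (simp add: n_def h1_norm_eq power2_eq_square)
  also have "\<dots> \<le> h1_norm \<Omega> u * n"
    using H10.cauchy_schwarz[OF u proj_WX_H10[OF u]] by (simp add: n_def h1_norm_eq)
  finally have "n \<le> h1_norm \<Omega> u"
    using n0 H10.nrm_nonneg[OF u] by (cases "n = 0") (auto simp: h1_norm_eq dest: mult_right_le_imp_le)
  then show ?thesis by (simp add: n_def)
qed

text \<open>An isometry that matches \<open>WY\<close> with \<open>WX\<close> conjugates the
  orthogonal projections. The definite description in \<open>orthogonal_projection\<close> asks for
  existence and uniqueness, and both are transported from \<open>proj_WX\<close>.\<close>

lemma P_Y_eq:
  assumes g: "g \<in> Hminus1 \<Omega>"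
  shows "P_Y \<Omega> ev \<phi> {a..b} g = neg_lap (proj_WX (riesz_rep g))"
  unfolding P_Y_def orthogonal_projection_def
proof (rule the_equality)
  show "neg_lap (proj_WX (riesz_rep g)) \<in> WY \<and> (\<forall>y\<in>WY. hm1_inner \<Omega> (g - neg_lap (proj_WX (riesz_rep g))) y = 0)"
    using g proj_WX_props(1)[OF riesz_rep_mem[OF g]] proj_WX_props(2)[OF riesz_rep_mem[OF g]]
    by (auto simp: neg_lap_WY hm1_inner_eq riesz_rep_diff neg_lap_Hminus1 WY_iff)
next
  fix w assume w: "w \<in> WY \<and> (\<forall>y\<in>WY. hm1_inner \<Omega> (g - w) y = 0)"
  then have wH: "w \<in> Hminus1 \<Omega>" "riesz_rep w \<in> WX" by (auto simp: WY_iff)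
  have "proj_WX (riesz_rep g) = riesz_rep w"
  proof (rule proj_WX_unique[OF riesz_rep_mem[OF g] wH(2)])
    fix y assume y: "y \<in> WX"
    have "hm1_inner \<Omega> (g - w) (neg_lap y) = 0" using w neg_lap_WY[OF y] by blast
    then show "h1_inner \<Omega> (riesz_rep g - riesz_rep w) y = 0"
      using g wH WX_H10[OF y] by (simp add: hm1_inner_eq riesz_rep_diff)
  qed
  then show "w = neg_lap (proj_WX (riesz_rep g))" using neg_lap_riesz_rep[OF wH(1)] by simp
qed

lemma F_map_eq: "u \<in> H10 \<Omega> \<Longrightarrow> F_map \<Omega> f u = neg_lap (u - inv_lap (superpos u))"
  by (auto simp: fun_eq_iff F_map_def neg_laplacian_def H10.diff_left inv_lap_inner superpos_inner)

lemma F_restr_eq: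
  assumes "w + v \<in> H10 \<Omega>"
  shows "F_restr \<Omega> f ev \<phi> {a..b} v w = neg_lap (proj_WX (w + v - inv_lap (superpos (w + v))))"
  unfolding F_restr_def F_map_eq[OF assms] using assms by (subst P_Y_eq) (auto simp: neg_lap_Hminus1)

text \<open>The Riesz representative of the derivative. On \<open>WX\<close> its domain and target
  coincide, so its self-adjointness can be stated.\<close>

definition linearized :: "'a l2 \<Rightarrow> 'a l2 \<Rightarrow> 'a l2" where
  "linearized u h = proj_WX (h - inv_lap (superpos_deriv u h))"

lemma linearized_WX: "h \<in> WX \<Longrightarrow> linearized u h \<in> WX"
  unfolding linearized_def using WX_H10 by (intro proj_WX_props) auto

lemma linearized_add: "h \<in> H10 \<Omega> \<Longrightarrow> k \<in> H10 \<Omega> \<Longrightarrow> linearized u (h + k) = linearized u h + linearized u k"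
proof -
  assume h: "h \<in> H10 \<Omega>" "k \<in> H10 \<Omega>"
  have eq: "h + k - inv_lap (superpos_deriv u (h + k)) = (h - inv_lap (superpos_deriv u h)) + (k - inv_lap (superpos_deriv u k))"
    by (simp add: superpos_deriv_add inv_lap_add)
  show ?thesis unfolding linearized_def eq using h by (intro proj_WX_add) auto
qed

lemma linearized_scale: "h \<in> H10 \<Omega> \<Longrightarrow> linearized u (c *\<^sub>R h) = c *\<^sub>R linearized u h"
  by (simp add: linearized_def superpos_deriv_scaleR inv_lap_scale proj_WX_scale flip: scaleR_diff_right)

lemma linearized_inner:
  assumes "h \<in> WX" "z \<in> WX"
  shows "h1_inner \<Omega> (linearized u h) z = h1_inner \<Omega> h z - superpos_deriv u h \<bullet> z"
  using assms WX_H10 by (simp add: linearized_def proj_WX_inner H10.diff_left inv_lap_inner)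

lemma linearized_bound:
  assumes h: "h \<in> H10 \<Omega>"
  shows "h1_norm \<Omega> (linearized u h) \<le> (1 + poincare_const * M * poincare_const) * h1_norm \<Omega> h"
proof -
  have "h1_norm \<Omega> (linearized u h) \<le> h1_norm \<Omega> (h - inv_lap (superpos_deriv u h))"
    unfolding linearized_def using h by (intro proj_WX_norm) auto
  also have "\<dots> \<le> h1_norm \<Omega> h + h1_norm \<Omega> (inv_lap (superpos_deriv u h))"
    using H10.nrm_triangle[OF h, of "- inv_lap (superpos_deriv u h)"] by (simp add: h1_norm_eq H10.nrm_minus)
  also have "h1_norm \<Omega> (inv_lap (superpos_deriv u h)) \<le> poincare_const * norm (superpos_deriv u h)" by (rule inv_lap_norm)
  also have "\<dots> \<le> poincare_const * (M * (poincare_const * h1_norm \<Omega> h))"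
  proof (rule mult_left_mono)
    have "norm (superpos_deriv u h) \<le> M * norm h" by (rule norm_superpos_deriv_le)
    also have "\<dots> \<le> M * (poincare_const * h1_norm \<Omega> h)" by (intro mult_left_mono poincare h M_nonneg)
    finally show "norm (superpos_deriv u h) \<le> M * (poincare_const * h1_norm \<Omega> h)" .
  qed (use poincare_const_pos in simp)
  finally show ?thesis by (simp add: algebra_simps)
qed

lemma bounded_linear_linearized:
  "bounded_linear_between WX (h1_norm \<Omega>) WY (hm1_norm \<Omega>) (\<lambda>h. neg_lap (linearized u h))"
  unfolding bounded_linear_between_def
proof (intro conjI ballI allI exI[of _ "1 + poincare_const * M * poincare_const"])
  fix h assume h: "h \<in> WX"
  show "neg_lap (linearized u h) \<in> WY" by (intro neg_lap_WY linearized_WX h)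
  show "neg_lap (linearized u (c *\<^sub>R h)) = c *\<^sub>R neg_lap (linearized u h)" for c
    using h WX_H10 linearized_WX by (simp add: linearized_scale neg_lap_scale)
  show "hm1_norm \<Omega> (neg_lap (linearized u h)) \<le> (1 + poincare_const * M * poincare_const) * h1_norm \<Omega> h"
    using linearized_bound[OF WX_H10[OF h]] by (simp add: hm1_norm_neg_lap WX_H10 linearized_WX h)
  fix k assume k: "k \<in> WX"
  show "neg_lap (linearized u (h + k)) = neg_lap (linearized u h) + neg_lap (linearized u k)"
    using h k WX_H10 linearized_WX by (simp add: linearized_add neg_lap_add)
qed

text \<open>In representatives F is the identity minus \<open>inv_lap\<close> after
  \<open>superpos\<close>, so the identity parts cancel and only minus \<open>inv_lap\<close> of the
  superposition remainder is left. The projection does not increase norms.\<close>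

lemma F_restr_derivative:
  assumes v: "v \<in> V_X ev \<phi> {a..b}" and w: "w \<in> WX"
  shows "F_restr_has_derivative \<Omega> f ev \<phi> {a..b} v (\<lambda>h. neg_lap (linearized (w + v) h)) w"
  unfolding F_restr_has_derivative_def has_frechet_derivative_between_def
proof (intro conjI bounded_linear_linearized allI impI)
  fix e :: real assume e: "e > 0"
  define u where "u = w + v"
  have u: "u \<in> H10 \<Omega>" using v w V_X_H10 WX_H10 by (auto simp: u_def)
  \<comment> \<open>\<open>inv_lap\<close> costs a factor \<open>poincare_const\<close>, which is
    divided out in advance.\<close>
  have "e / poincare_const > 0" using e poincare_const_pos by simp
  from nemytskii_differentiable[OF this, of u] obtain d where d: "d > 0"
    "\<And>h. h \<in> H10 \<Omega> \<Longrightarrow> h1_norm \<Omega> h < d \<Longrightarrow>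
      norm (superpos (u + h) - superpos u - superpos_deriv u h) \<le> e / poincare_const * h1_norm \<Omega> h" by blast
  show "\<exists>d>0. \<forall>h\<in>WX. h1_norm \<Omega> h < d \<longrightarrow>
      hm1_norm \<Omega> (F_restr \<Omega> f ev \<phi> {a..b} v (w + h) - F_restr \<Omega> f ev \<phi> {a..b} v w - neg_lap (linearized (w + v) h))
        \<le> e * h1_norm \<Omega> h"
  proof (intro exI[of _ d] conjI d(1) ballI impI)
    fix h assume h: "h \<in> WX" "h1_norm \<Omega> h < d"
    have hH: "h \<in> H10 \<Omega>" using h WX_H10 by blast
    have uh: "w + h + v = u + h" by (simp add: u_def)
    let ?R = "superpos (u + h) - superpos u - superpos_deriv u h"
    have "F_restr \<Omega> f ev \<phi> {a..b} v (w + h) - F_restr \<Omega> f ev \<phi> {a..b} v w - neg_lap (linearized (w + v) h) =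
        neg_lap (proj_WX ((u + h - inv_lap (superpos (u + h))) - (u - inv_lap (superpos u)) - (h - inv_lap (superpos_deriv u h))))"
    proof -
      have split: "neg_lap (proj_WX (A - B - D)) = neg_lap (proj_WX A) - neg_lap (proj_WX B) - neg_lap (proj_WX D)"
        if "A \<in> H10 \<Omega>" "B \<in> H10 \<Omega>" "D \<in> H10 \<Omega>" for A B D
        using that by (simp add: proj_WX_diff neg_lap_diff)
      have F1: "F_restr \<Omega> f ev \<phi> {a..b} v (w + h) = neg_lap (proj_WX (u + h - inv_lap (superpos (u + h))))"
        using F_restr_eq[of "w + h" v] u hH unfolding uh by auto
      have F2: "F_restr \<Omega> f ev \<phi> {a..b} v w = neg_lap (proj_WX (u - inv_lap (superpos u)))"
        using F_restr_eq[of w v] u unfolding u_def by auto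
      show ?thesis
        unfolding F1 F2 linearized_def u_def[symmetric] using u hH by (intro split[symmetric]) auto
    qed
    also have "(u + h - inv_lap (superpos (u + h))) - (u - inv_lap (superpos u)) - (h - inv_lap (superpos_deriv u h)) = - inv_lap ?R"
      by (simp add: inv_lap_diff)
    finally have "F_restr \<Omega> f ev \<phi> {a..b} v (w + h) - F_restr \<Omega> f ev \<phi> {a..b} v w - neg_lap (linearized (w + v) h)
        = neg_lap (proj_WX (- inv_lap ?R))" .
    then have "hm1_norm \<Omega> (F_restr \<Omega> f ev \<phi> {a..b} v (w + h) - F_restr \<Omega> f ev \<phi> {a..b} v w - neg_lap (linearized (w + v) h))
        = h1_norm \<Omega> (proj_WX (- inv_lap ?R))"
      by (simp only: hm1_norm_neg_lap proj_WX_H10 H10.mem inv_lap_mem)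
    also have "\<dots> \<le> h1_norm \<Omega> (- inv_lap ?R)" by (rule proj_WX_norm) simp
    also have "\<dots> = h1_norm \<Omega> (inv_lap ?R)" by (simp add: h1_norm_eq H10.nrm_minus)
    also have "\<dots> \<le> poincare_const * norm ?R" by (rule inv_lap_norm)
    also have "\<dots> \<le> poincare_const * (e / poincare_const * h1_norm \<Omega> h)"
      using poincare_const_pos by (intro mult_left_mono d(2) hH h(2)) simp
    also have "\<dots> = e * h1_norm \<Omega> h" using poincare_const_pos by simp
    finally show "hm1_norm \<Omega> (F_restr \<Omega> f ev \<phi> {a..b} v (w + h) - F_restr \<Omega> f ev \<phi> {a..b} v w - neg_lap (linearized (w + v) h))
        \<le> e * h1_norm \<Omega> h" .
  qed
qed

text \<open>\<open>DF_restr\<close> is an arbitrary choice among derivatives, so its values must be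
  pinned down. This is possible only for directions in \<open>WX\<close>: elsewhere a derivative may
  take any values.\<close>

lemma F_restr_derivative_unique:
  assumes "v \<in> V_X ev \<phi> {a..b}" and w: "w \<in> WX" and h: "h \<in> WX"
    and L: "F_restr_has_derivative \<Omega> f ev \<phi> {a..b} v L w"
    and L': "F_restr_has_derivative \<Omega> f ev \<phi> {a..b} v L' w"
  shows "L h = L' h"
proof -
  let ?G = "F_restr \<Omega> f ev \<phi> {a..b} v"
  have GH: "?G x \<in> Hminus1 \<Omega>" if "x \<in> WX" for x
    using that assms(1) V_X_H10 WX_H10 by (subst F_restr_eq) (auto intro!: neg_lap_Hminus1)
  have LH: "L x \<in> Hminus1 \<Omega>" "L' x \<in> Hminus1 \<Omega>" if "x \<in> WX" for x
    using that L L' WY_Hminus1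
    by (auto simp: F_restr_has_derivative_def has_frechet_derivative_between_def bounded_linear_between_def)
  define n where "n = hm1_norm \<Omega> (L h - L' h)"
  have n0: "n \<ge> 0"
    using Hm.nrm_nonneg[of "L h - L' h"] LH[OF h] by (simp add: n_def hm1_norm_form)
  have hn0: "0 \<le> h1_norm \<Omega> h" using H10.nrm_nonneg[OF WX_H10[OF h]] by (simp add: h1_norm_eq)
  have bound: "n \<le> 2 * e * h1_norm \<Omega> h" if e: "e > 0" for e
  proof -
    obtain d where d: "d > 0"
      "\<And>h. h \<in> WX \<Longrightarrow> h1_norm \<Omega> h < d \<Longrightarrow> hm1_norm \<Omega> (?G (w + h) - ?G w - L h) \<le> e * h1_norm \<Omega> h"
      using L e unfolding F_restr_has_derivative_def has_frechet_derivative_between_def by blast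
    obtain d' where d': "d' > 0"
      "\<And>h. h \<in> WX \<Longrightarrow> h1_norm \<Omega> h < d' \<Longrightarrow> hm1_norm \<Omega> (?G (w + h) - ?G w - L' h) \<le> e * h1_norm \<Omega> h"
      using L' e unfolding F_restr_has_derivative_def has_frechet_derivative_between_def by blast
    \<comment> \<open>Scales h below both radii; the summand 1 covers directions of norm
      zero.\<close>
    define t where "t = min d d' / (h1_norm \<Omega> h + 1)"
    have t: "t > 0" using d(1) d'(1) hn0 by (simp add: t_def)
    define k where "k = t *\<^sub>R h"
    have k: "k \<in> WX" using h by (simp add: k_def)
    have kn: "h1_norm \<Omega> k = t * h1_norm \<Omega> h"
      using H10.nrm_scale[OF WX_H10[OF h], of t] t by (simp add: k_def h1_norm_eq)
    have "t * h1_norm \<Omega> h < t * (h1_norm \<Omega> h + 1)" using t by simp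
    also have "\<dots> = min d d'" using hn0 by (simp add: t_def)
    finally have small: "h1_norm \<Omega> k < d" "h1_norm \<Omega> k < d'" by (auto simp: kn)
    have kH: "?G (w + k) - ?G w - L k \<in> Hminus1 \<Omega>" "?G (w + k) - ?G w - L' k \<in> Hminus1 \<Omega>"
      using GH w k LH[OF k] by auto
    have Lk: "L k = t *\<^sub>R L h" "L' k = t *\<^sub>R L' h"
      using h L L'
      by (auto simp: F_restr_has_derivative_def has_frechet_derivative_between_def bounded_linear_between_def k_def)
    have eq: "(?G (w + k) - ?G w - L' k) - (?G (w + k) - ?G w - L k) = t *\<^sub>R (L h - L' h)"
      unfolding Lk by (simp add: scaleR_diff_right)
    have "t * n = hm1_norm \<Omega> (t *\<^sub>R (L h - L' h))"
      using Hm.nrm_scale[of "L h - L' h" t] LH[OF h] t by (simp add: n_def hm1_norm_form)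
    also have "\<dots> \<le> hm1_norm \<Omega> (?G (w + k) - ?G w - L' k) + hm1_norm \<Omega> (?G (w + k) - ?G w - L k)"
      unfolding eq[symmetric] by (rule hm1_norm_diff_le[OF kH(2,1)])
    also have "\<dots> \<le> e * (t * h1_norm \<Omega> h) + e * (t * h1_norm \<Omega> h)"
      using d(2)[OF k small(1)] d'(2)[OF k small(2)] unfolding kn by linarith
    also have "\<dots> = t * (2 * e * h1_norm \<Omega> h)" by simp
    finally show ?thesis using t by (simp add: mult_le_cancel_left_pos)
  qed
  have "n \<le> 0"
  proof (rule field_le_epsilon)
    fix e :: real assume e: "e > 0"
    define e' where "e' = e / (2 * (h1_norm \<Omega> h + 1))"
    have "e' > 0" using e hn0 by (simp add: e'_def)
    from bound[OF this] have "n \<le> 2 * e' * h1_norm \<Omega> h" .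
    also have "\<dots> \<le> 2 * e' * (h1_norm \<Omega> h + 1)" using \<open>e' > 0\<close> by simp
    also have "\<dots> = e" using hn0 by (simp add: e'_def field_simps)
    finally show "n \<le> 0 + e" by simp
  qed
  then have "h1_norm \<Omega> (riesz_rep (L h - L' h)) = 0" using n0 LH[OF h] by (simp add: n_def hm1_norm_eq)
  then have "riesz_rep (L h - L' h) = 0"
    using LH[OF h] by (intro H10_definite) (auto simp: h1_norm_def)
  then have "riesz_rep (L h) = riesz_rep (L' h)" using LH[OF h] by (simp add: riesz_rep_diff)
  then show ?thesis using neg_lap_riesz_rep LH[OF h] by metis
qed

lemma DF_restr_eq:
  assumes "v \<in> V_X ev \<phi> {a..b}" "w \<in> WX" "h \<in> WX"
  shows "DF_restr \<Omega> f ev \<phi> {a..b} v w h = neg_lap (linearized (w + v) h)"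
  unfolding DF_restr_def
  by (rule F_restr_derivative_unique[OF assms someI[of "\<lambda>L. F_restr_has_derivative \<Omega> f ev \<phi> {a..b} v L w"]
      F_restr_derivative[OF assms(1,2)]]) (rule F_restr_derivative[OF assms(1,2)])

text \<open>The constant is obtained before u is chosen, since \<open>reflected_coercivity\<close>
  asks of the form m only additivity, symmetry and the bounds a and b; this is the uniformity in v
  and w. The reflected vector has the norm of h, so after Cauchy-Schwarz one factor of that norm
  cancels.\<close>

lemma linearized_coercive:
  obtains C where "C > 0" "\<And>u h. h \<in> WX \<Longrightarrow> C * h1_norm \<Omega> h \<le> h1_norm \<Omega> (linearized u h)"
proof (rule EF.reflected_coercivity[OF ab])
  fix C :: real
  assume C: "C > 0" and refl: "\<And>h m. h \<in> H10 \<Omega> \<Longrightarrow> (\<And>k. ev k \<in> {a..b} \<Longrightarrow> h1_inner \<Omega> h (\<phi> k) = 0) \<Longrightarrow>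
      (\<And>x y z. m (x + y) z = m x z + m y z) \<Longrightarrow> (\<And>x y. m x y = m y x) \<Longrightarrow>
      (\<And>u. u \<in> H10 \<Omega> \<Longrightarrow> a * (u \<bullet> u) \<le> m u u) \<Longrightarrow> (\<And>u. u \<in> H10 \<Omega> \<Longrightarrow> m u u \<le> b * (u \<bullet> u)) \<Longrightarrow>
      \<exists>z\<in>H10 \<Omega>. (\<forall>k. ev k \<in> {a..b} \<longrightarrow> h1_inner \<Omega> z (\<phi> k) = 0) \<and> form_norm (h1_inner \<Omega>) z = form_norm (h1_inner \<Omega>) h \<and>
        C * (form_norm (h1_inner \<Omega>) h)\<^sup>2 \<le> h1_inner \<Omega> h z - (m h z :: real)"
  show thesis
  proof (rule that[OF C])
    fix u h assume h: "h \<in> WX"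
    have "\<exists>z\<in>H10 \<Omega>. (\<forall>k. ev k \<in> {a..b} \<longrightarrow> h1_inner \<Omega> z (\<phi> k) = 0) \<and>
        form_norm (h1_inner \<Omega>) z = form_norm (h1_inner \<Omega>) h \<and>
        C * (form_norm (h1_inner \<Omega>) h)\<^sup>2 \<le> h1_inner \<Omega> h z - superpos_deriv u h \<bullet> z"
      using h superpos_deriv_bounds[OF H10_L2_space slope]
      by (intro refl) (auto simp: WX_iff superpos_deriv_add inner_add_left superpos_deriv_sym)
    then obtain z where z: "z \<in> WX" "h1_norm \<Omega> z = h1_norm \<Omega> h"
        "C * (h1_norm \<Omega> h)\<^sup>2 \<le> h1_inner \<Omega> h z - superpos_deriv u h \<bullet> z"
      by (auto simp: WX_iff h1_norm_eq)
    define n where "n = h1_norm \<Omega> h"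
    have n0: "n \<ge> 0" using H10.nrm_nonneg[OF WX_H10[OF h]] by (simp add: n_def h1_norm_eq)
    have l0: "0 \<le> h1_norm \<Omega> (linearized u h)"
      using H10.nrm_nonneg[OF WX_H10[OF linearized_WX[OF h]]] by (simp add: h1_norm_eq)
    have "C * n\<^sup>2 \<le> h1_inner \<Omega> (linearized u h) z" using z(3) by (simp add: linearized_inner h z(1) n_def)
    also have "\<dots> \<le> h1_norm \<Omega> (linearized u h) * n"
      using H10.cauchy_schwarz[OF WX_H10[OF linearized_WX[OF h]] WX_H10[OF z(1)], of u] z(2)
      by (simp add: h1_norm_eq n_def)
    finally have "(C * n) * n \<le> h1_norm \<Omega> (linearized u h) * n" by (simp add: power2_eq_square mult.assoc)
    then have "C * n \<le> h1_norm \<Omega> (linearized u h)"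
      using n0 l0 by (cases "n = 0") (auto dest: mult_right_le_imp_le)
    then show "C * h1_norm \<Omega> h \<le> h1_norm \<Omega> (linearized u h)" by (simp add: n_def)
  qed
qed

text \<open>By \<open>linearized_inner\<close> the operator represents a symmetric form on
  \<open>WX\<close>, as multiplication by the slope is symmetric; hence it is self-adjoint and
  \<open>selfadjoint_surjective\<close> applies.\<close>

lemma linearized_surjective:
  assumes "g \<in> WX"
  shows "\<exists>h\<in>WX. linearized u h = g"
proof -
  obtain C where C: "C > 0" "\<And>h. h \<in> WX \<Longrightarrow> C * h1_norm \<Omega> h \<le> h1_norm \<Omega> (linearized u h)"
    using linearized_coercive by metis
  show ?thesis
  proof (rule WX.selfadjoint_surjective[OF WX_complete, where A = "linearized u" and C = C])
    show "x = 0" if "x \<in> WX" "h1_inner \<Omega> x x = 0" for x using that WX_H10 H10_definite by blast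
    show "h1_inner \<Omega> (linearized u x) y = h1_inner \<Omega> x (linearized u y)" if "x \<in> WX" "y \<in> WX" for x y
    proof -
      have "h1_inner \<Omega> x (linearized u y) = h1_inner \<Omega> (linearized u y) x" using that linearized_WX by (intro WX.sym)
      also have "\<dots> = h1_inner \<Omega> (linearized u x) y"
        using that WX.sym[of x y] superpos_deriv_sym[of u x y] by (simp add: linearized_inner)
      finally show ?thesis by simp
    qed
    show "form_norm (h1_inner \<Omega>) (linearized u x) \<le> (1 + poincare_const * M * poincare_const) * form_norm (h1_inner \<Omega>) x"
      if "x \<in> WX" for x using linearized_bound[OF WX_H10[OF that]] by (simp add: h1_norm_eq)
    show "C * form_norm (h1_inner \<Omega>) x \<le> form_norm (h1_inner \<Omega>) (linearized u x)" if "x \<in> WX" for x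
      using C(2)[OF that] by (simp add: h1_norm_eq)
  qed (use linearized_WX linearized_add linearized_scale WX_H10 C assms in auto)
qed

end

theorem proposition5:
  fixes \<Omega> :: "'a::euclidean_space set"
    and f :: "'a \<times> real \<Rightarrow> real"
    and ev :: "nat \<Rightarrow> real"
    and \<phi> :: "nat \<Rightarrow> 'a l2"
    and a b :: real
  assumes "open \<Omega>" and "bounded \<Omega>" and "connected \<Omega>" and "lipschitz_boundary \<Omega>"
    and "dirichlet_eigensystem \<Omega> ev \<phi>"
    and "appropriate \<Omega> f"
    and "closure (pderiv2 f ` (\<Omega> \<times> UNIV)) \<subseteq> {a..b}"
  shows "(\<forall>v\<in>V_X ev \<phi> {a..b}. \<forall>w\<in>W_X \<Omega> ev \<phi> {a..b}.
            \<exists>L. F_restr_has_derivative \<Omega> f ev \<phi> {a..b} v L w) \<and>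
         (\<exists>C>0. \<forall>v\<in>V_X ev \<phi> {a..b}. \<forall>w\<in>W_X \<Omega> ev \<phi> {a..b}. \<forall>h\<in>W_X \<Omega> ev \<phi> {a..b}.
            hm1_norm \<Omega> (DF_restr \<Omega> f ev \<phi> {a..b} v w h) \<ge> C * h1_norm \<Omega> h) \<and>
         (\<forall>v\<in>V_X ev \<phi> {a..b}. \<forall>w\<in>W_X \<Omega> ev \<phi> {a..b}.
            invertible_between (W_X \<Omega> ev \<phi> {a..b}) (h1_norm \<Omega>)
              (W_Y \<Omega> ev \<phi> {a..b}) (hm1_norm \<Omega>) (DF_restr \<Omega> f ev \<phi> {a..b} v w))"
proof -
  have slope: "pderiv2 f (x, t) \<in> {a..b}" if "x \<in> \<Omega>" for x t
    using that assms(7) closure_subset[of "pderiv2 f ` (\<Omega> \<times> UNIV)"] by blast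
  obtain M0 where M0: "\<And>x t. x \<in> \<Omega> \<Longrightarrow> \<bar>pderiv2 f (x, t)\<bar> \<le> M0"
    using assms(6) by (auto simp: appropriate_def bounded_iff)
  \<comment> \<open>An eigenfunction is a nonzero class vanishing outside \<Omega>, so \<Omega>
    cannot be empty. Some slope value then lies in the interval, which gives a \<le> b.\<close>
  have "\<Omega> \<noteq> {}"
  proof
    assume "\<Omega> = {}"
    have p: "\<phi> 0 \<in> H10 \<Omega>" "\<phi> 0 \<noteq> 0" using assms(5) by (auto simp: dirichlet_eigensystem_def)
    then have "\<phi> 0 \<in> L2_space {}" using \<open>\<Omega> = {}\<close> by (simp add: H10_def H1_def)
    then have "AE x in lborel. l2_fun (\<phi> 0) x = l2_fun 0 x"
      using l2_fun_zero by (auto simp: L2_space_def)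
    then have "\<phi> 0 = 0" by (rule l2_eqI)
    with p show False by simp
  qed
  then have ab: "a \<le> b" using slope by fastforce
  \<comment> \<open>The absolute value makes the bound nonnegative, as the locale asks.\<close>
  interpret dirichlet_problem \<Omega> f "\<bar>M0\<bar>" ev \<phi> a b
  proof
    show "\<bar>pderiv2 f (x, t)\<bar> \<le> \<bar>M0\<bar>" if "x \<in> \<Omega>" for x t using M0[OF that, of t] by simp
  qed (use assms ab slope in \<open>auto simp: appropriate_def\<close>)
  obtain C where C: "C > 0" "\<And>u h. h \<in> WX \<Longrightarrow> C * h1_norm \<Omega> h \<le> h1_norm \<Omega> (linearized u h)"
    using linearized_coercive by metis
  have lower: "C * h1_norm \<Omega> h \<le> hm1_norm \<Omega> (DF_restr \<Omega> f ev \<phi> {a..b} v w h)"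
    if "v \<in> V_X ev \<phi> {a..b}" "w \<in> WX" "h \<in> WX" for v w h
    using C(2)[OF that(3)] by (simp add: DF_restr_eq[OF that] hm1_norm_neg_lap WX_H10 linearized_WX that(3))
  show ?thesis
  proof (intro conjI ballI)
    show "\<exists>L. F_restr_has_derivative \<Omega> f ev \<phi> {a..b} v L w"
      if "v \<in> V_X ev \<phi> {a..b}" "w \<in> WX" for v w
      using F_restr_derivative[OF that] by blast
    show "\<exists>C>0. \<forall>v\<in>V_X ev \<phi> {a..b}. \<forall>w\<in>WX. \<forall>h\<in>WX.
        hm1_norm \<Omega> (DF_restr \<Omega> f ev \<phi> {a..b} v w h) \<ge> C * h1_norm \<Omega> h"
      using C(1) lower by blast
    fix v w assume vw: "v \<in> V_X ev \<phi> {a..b}" "w \<in> WX"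
    show "invertible_between WX (h1_norm \<Omega>) WY (hm1_norm \<Omega>) (DF_restr \<Omega> f ev \<phi> {a..b} v w)"
    proof (rule invertible_betweenI[where C = C, OF _ WX_subspace _ C(1)])
      \<comment> \<open>As some derivative exists, the chosen map is one itself, and bounded
        linearity is part of being a derivative.\<close>
      have "F_restr_has_derivative \<Omega> f ev \<phi> {a..b} v (DF_restr \<Omega> f ev \<phi> {a..b} v w) w"
        unfolding DF_restr_def
        by (rule someI[of "\<lambda>L. F_restr_has_derivative \<Omega> f ev \<phi> {a..b} v L w", OF F_restr_derivative[OF vw]])
      then show "bounded_linear_between WX (h1_norm \<Omega>) WY (hm1_norm \<Omega>) (DF_restr \<Omega> f ev \<phi> {a..b} v w)"
        by (simp add: F_restr_has_derivative_def has_frechet_derivative_between_def)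
      show "C * h1_norm \<Omega> x \<le> hm1_norm \<Omega> (DF_restr \<Omega> f ev \<phi> {a..b} v w x)" if "x \<in> WX" for x
        by (rule lower[OF vw that])
      show "x = 0" if "x \<in> WX" "h1_norm \<Omega> x \<le> 0" for x
        using that H10_definite[OF WX_H10[OF that(1)]] H10.nonneg[OF WX_H10[OF that(1)]]
        by (simp add: h1_norm_def)
      show "hm1_norm \<Omega> 0 = 0" using Hm.nrm_zero by (simp add: hm1_norm_form)
      show "\<exists>x\<in>WX. DF_restr \<Omega> f ev \<phi> {a..b} v w x = g" if g: "g \<in> WY" for g
      proof -
        obtain h where "h \<in> WX" "linearized (w + v) h = riesz_rep g" using linearized_surjective g WY_iff by blast
        with g show ?thesis by (intro bexI[of _ h]) (auto simp: DF_restr_eq[OF vw] neg_lap_riesz_rep WY_Hminus1)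
      qed
    qed
  qed
qed

end
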